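(* Let $\tau\in\{A',A,B,C,D\}$ and let $(G_N)_N$ be a sequence of compact classical groups of type $\tau$ with $G_N\subset\mathrm{GL}_N(\mathbb C)$. For every integer $p\ge1$ and every $t>0$, as $N\to\infty$: (1) If $\tau\in\{A',A\}$, $$\mathrm{Tr}(e^{\frac t2\Delta_{G_N}})=\int_{\mathcal R^2}\mathbf 1_{\{\chi(X_1)+\chi(X_2)\ge-2p\}}\,\Phi^{2p,\tau}_{t,N}(X_1,X_2)\,N^{\chi(X_1)+\chi(X_2)}\,d\rho_t^{\otimes2}([X_1],[X_2])+O_t(N^{-2p-2}).$$ (2) If $\tau\in\{B,C,D\}$, $$\mathrm{Tr}(e^{\frac t2\Delta_{G_N}})=\int_{\mathcal R}\mathbf 1_{\{\chi(X)\ge-p\}}\,\Phi^{\tau}_{t,N}(X)\,N^{\chi(X)}\,d\rho_t([X])+O_t(N^{-p-1}).$$ Here, with $q_t=e^{-t/2}$, for an integer $s\ge1$ and $I_s(X_1,X_2)=\{0,1,\dots,s+\frac12\chi(X_1)+\frac12\chi(X_2)\}$, $$\Phi^{s,A'}_{t,N}(X_1,X_2)=\sum_{k\in I_s(X_1,X_2)}\sum_{n\in\mathbb Z}q_t^{n^2}\frac{[nt(\deg(X_1)-\deg(X_2))]^{2k}}{N^{2k}(2k)!},$$ $$\Phi^{s,A}_{t,N}(X_1,X_2)=\sum_{k\in I_s(X_1,X_2)}\frac{t^k(\deg(X_1)-\deg(X_2))^{2k}}{2^kN^{2k}k!},$$ $$\Phi^B_{t,N}(X)=\Phi^D_{t,N}(X)=e^{\frac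 t{2N}\deg(X)},\qquad \Phi^C_{t,N}(X)=e^{-\frac t{2N}\deg(X)}.$$
   Context: **Groups and central heat trace.** Compact classical groups are indexed by matrix size $N$, $G_N\subset\mathrm{GL}_N(\mathbb C)$: type $A'$: $\mathrm U(N)$; type $A$: $\mathrm{SU}(N)$; type $B$: $\mathrm{SO}(N)$ with $N$ odd; type $D$: $\mathrm{SO}(N)$ with $N$ even; type $C$: $\mathrm{Sp}(N/2)=\{S\in\mathrm{GL}_N(\mathbb C):S^*=S^{-1},S^tJS=J\}$ with $N$ even, $J=\begin{pmatrix}0&I\\-I&0\end{pmatrix}$. $N\to\infty$ through the values admissible for the type. $\Delta_{G_N}$ is the Laplace–Beltrami operator of $G_N$ for an invariant inner product on its Lie algebra. For an irreducible representation $\lambda\in\widehat G_N$ with character $\chi_\lambda$, $\Delta_{G_N}\chi_\lambda=-c_2(\lambda)\chi_\lambda$ with $c_2(\lambda)\ge0$; the inner product is normalized so that the numbers $c_2(\lambda)$ are those listed below. The central heat trace is the trace of $e^{\frac t2\Delta_{G_N}}$ on the Hilbert space of square-integrable central (conjugation-invariant) functions: $$\mathrm{Tr}(e^{\frac t2\Delta_{G_N}})=\sum_{\lambda\in\widehat G_N}e^{-\frac t2c_2(\lambda)}.$$ With highest weights $\lambda=(\lambda_1,\dots,\lambda_r)$, $r=N$ for $A',A$, $r=(N-1)/2$ for $B$, $r=N/2$ for $C,D$ ($\mathbb N$ contains $0$): - $A'$: $\lambda\in\mathbb Z^N$ nonincreasing, $c_2(\lambda)=\frac1N\sum_i\lambda_i(\lambda_i+N+1-2i)$;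 - $A$: $\lambda\in\mathbb N^N$ nonincreasing with $\lambda_N=0$, $c_2(\lambda)=\frac1N\sum_i\lambda_i(\lambda_i+N+1-2i)-\frac1{N^2}(\sum_i\lambda_i)^2$; - $B$: $\lambda\in\mathbb N^r$ nonincreasing, $c_2(\lambda)=\frac1N\sum_i\lambda_i(\lambda_i+N-2i)$; - $C$: $\lambda\in\mathbb N^r$ nonincreasing, $c_2(\lambda)=\frac1N\sum_i\lambda_i(\lambda_i+N+2-2i)$; - $D$: $\lambda\in\mathbb N^{r-1}\times\mathbb Z$ with $\lambda_1\ge\dots\ge\lambda_{r-1}\ge|\lambda_r|$, $c_2(\lambda)=\frac1N\sum_i\lambda_i(\lambda_i+N-2i)$. **Hurwitz spaces.** For $n\ge1$, $k\ge0$, let $\mathbb X_1(n,k)$ be the set of ramified coverings $X$ of a complex torus of degree $n$ with $k$ generic ramifications; via monodromy it is the set of tuples $(\sigma_1,\sigma_2,\tau_1,\dots,\tau_k)\in S_n^{2+k}$ with all $\tau_i$ transpositions and $[\sigma_1,\sigma_2]\tau_1\cdots\tau_k=1$. The Hurwitz space $\mathcal H_1(n,k)=\mathbb X_1(n,k)/S_n$ (quotient by simultaneous conjugation) is the set of equivalence classes $[X]$ of such coverings. Its cardinality is the Hurwitz number $H_1(n,k)$, for which the formula $H_1(n,k)=\sum_{\alpha\vdash n}K(\alpha)^k$ is used, where $K(\alpha)=\frac12\sum_i\alpha_i(\alpha_i+1-2i)$ is the total content of the partition $\alpha$; it vanishes for $k$ odd. For $[X]\in\mathcal H_1(n,2k)$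 one has $\deg(X)=n$ and Euler characteristic $\chi(X)=-2k$. Put $\mathcal R=\bigsqcup_{n\ge1}\bigsqcup_{k\ge0}\mathcal H_1(n,2k)$ and let $\rho_t$ be the measure on the countable set $\mathcal R$ given by $$d\rho_t([X])=\sum_{n\ge1}q_t^n\sum_{k\ge0}\frac{t^{2k}}{(2k)!}\sum_{[Y]\in\mathcal H_1(n,2k)}\delta_{[Y]}([X]),$$ with the resulting identity $\int_{\mathcal R}f(\deg(X),\chi(X))\,d\rho_t([X])=\sum_{n\ge1}q_t^n\sum_{k\ge0}\frac{t^{2k}}{(2k)!}f(n,-2k)H_1(n,2k)$. **Notation.** $f(t,N)=O_t(g(t,N))$ as $N\to\infty$ means: for every $t>0$ there are a constant $C(t)$ and an integer $N_0$ (which may depend on the other fixed parameters such as $p$) such that $|f(t,N)|\le C(t)|g(t,N)|$ for all $N\ge N_0$.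
   Formalization: The space R also includes degree n = 0 (one empty covering, k = 0), and ρ_t weights each class [X] by 1/|Aut(X)|, so that H_1(n,k) is the sum of K(α)^k over partitions α of n; with n ≥ 1 and unweighted classes the expansion is false. *)

theory Defs
  imports "HOL-Analysis.Analysis" "HOL-Combinatorics.Combinatorics"
begin

section \<open>Classical groups: highest weights and Casimir numbers\<close>

datatype classical_type = TypeA' | TypeA | TypeB | TypeC | TypeD

text \<open>
  The types stand for U(N), SU(N), SO(N) with N odd, Sp(N/2), and SO(N) with N even, all
  inside GL(N).
\<close>

fun admissible :: "classical_type \<Rightarrow> nat \<Rightarrow> bool" where
  "admissible TypeA' N \<longleftrightarrow> N \<ge> 1"
| "admissible TypeA N \<longleftrightarrow> N \<ge> 1"
| "admissible TypeB N \<longleftrightarrow> odd N"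
| "admissible TypeC N \<longleftrightarrow> N \<ge> 1 \<and> even N"
| "admissible TypeD N \<longleftrightarrow> N \<ge> 1 \<and> even N"

fun weight_length :: "classical_type \<Rightarrow> nat \<Rightarrow> nat" where
  "weight_length TypeA' N = N"
| "weight_length TypeA N = N"
| "weight_length TypeB N = (N - 1) div 2"
| "weight_length TypeC N = N div 2"
| "weight_length TypeD N = N div 2"

text \<open>
  A highest weight is a list of integers; the entry with index i in the usual 1-based notation
  is \<open>l ! (i - 1)\<close>. In type D the condition says that the first r - 1 entries decrease and are
  bounded below by the absolute value of the last one.
\<close>

fun weight_shape :: "classical_type \<Rightarrow> int list \<Rightarrow> bool" where
  "weight_shape TypeA' l \<longleftrightarrow> sorted_wrt (\<ge>) l"
| "weight_shape TypeA l \<longleftrightarrow> sorted_wrt (\<ge>) l \<and> (\<forall>a\<in>set l. a \<ge> 0) \<and> last l = 0"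
| "weight_shape TypeB l \<longleftrightarrow> sorted_wrt (\<ge>) l \<and> (\<forall>a\<in>set l. a \<ge> 0)"
| "weight_shape TypeC l \<longleftrightarrow> sorted_wrt (\<ge>) l \<and> (\<forall>a\<in>set l. a \<ge> 0)"
| "weight_shape TypeD l \<longleftrightarrow> sorted_wrt (\<ge>) (butlast l @ [\<bar>last l\<bar>])"

definition highest_weights :: "classical_type \<Rightarrow> nat \<Rightarrow> int list set" where
  "highest_weights T N = {l. length l = weight_length T N \<and> weight_shape T l}"

definition casimir_sum :: "int \<Rightarrow> nat \<Rightarrow> int list \<Rightarrow> real" where
  "casimir_sum shift N l =
     real_of_int (\<Sum>i=1..length l. l ! (i - 1) * (l ! (i - 1) + int N + shift - 2 * int i)) / real N"

fun casimir :: "classical_type \<Rightarrow> nat \<Rightarrow> int list \<Rightarrow> real" where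
  "casimir TypeA' N l = casimir_sum 1 N l"
| "casimir TypeA N l = casimir_sum 1 N l - (real_of_int (sum_list l))\<^sup>2 / (real N)\<^sup>2"
| "casimir TypeB N l = casimir_sum 0 N l"
| "casimir TypeC N l = casimir_sum 2 N l"
| "casimir TypeD N l = casimir_sum 0 N l"

text \<open>
  The trace of \<open>exp (t/2 \<Delta>)\<close> on square-integrable central functions: the irreducible characters
  form an orthonormal eigenbasis, indexed by the highest weights, on which \<open>- \<Delta>\<close> has the
  eigenvalues \<^const>\<open>casimir\<close>.
\<close>

definition central_heat_trace :: "classical_type \<Rightarrow> nat \<Rightarrow> real \<Rightarrow> real" where
  "central_heat_trace T N t = (\<Sum>\<^sub>\<infinity>l\<in>highest_weights T N. exp (- (t / 2) * casimir T N l))"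


section \<open>Hurwitz spaces of the torus\<close>

text \<open>
  A covering with labelled sheets \<open>{..<n}\<close> is given by its monodromy: the permutations of the two
  standard loops and the list of transpositions at the branch points.
\<close>

type_synonym monodromy = "(nat \<Rightarrow> nat) \<times> (nat \<Rightarrow> nat) \<times> (nat \<Rightarrow> nat) list"

definition labelled_coverings :: "nat \<Rightarrow> nat \<Rightarrow> monodromy set" where
  "labelled_coverings n k =
     {(s1, s2, ts). s1 permutes {..<n} \<and> s2 permutes {..<n} \<and> length ts = k \<and>
        (\<forall>s\<in>set ts. \<exists>i<n. \<exists>j<n. i \<noteq> j \<and> s = Transposition.transpose i j) \<and>
        s1 \<circ> s2 \<circ> inv s1 \<circ> inv s2 \<circ> foldr (\<circ>) ts id = id}"

fun relabel :: "(nat \<Rightarrow> nat) \<Rightarrow> monodromy \<Rightarrow> monodromy" where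
  "relabel g (s1, s2, ts) =
     (g \<circ> s1 \<circ> inv g, g \<circ> s2 \<circ> inv g, map (\<lambda>s. g \<circ> s \<circ> inv g) ts)"

definition covering_class :: "nat \<Rightarrow> monodromy \<Rightarrow> monodromy set" where
  "covering_class n X = {relabel g X | g. g permutes {..<n}}"

definition covering_aut :: "nat \<Rightarrow> monodromy \<Rightarrow> (nat \<Rightarrow> nat) set" where
  "covering_aut n X = {g. g permutes {..<n} \<and> relabel g X = X}"

definition hurwitz_space :: "nat \<Rightarrow> nat \<Rightarrow> monodromy set set" where
  "hurwitz_space n k = covering_class n ` labelled_coverings n k"

text \<open>
  The disjoint union of the Hurwitz spaces with an even number k of ramifications. A point is
  \<open>(n, k, c)\<close> with c in \<open>hurwitz_space n k\<close>. The degree \<open>n = 0\<close> is included: it contributes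
  exactly one point, the empty covering, which has k = 0. It accounts for the empty partition;
  without it the expansion of the heat trace already misses the contribution 1 of the trivial
  representation.
\<close>

type_synonym covering = "nat \<times> nat \<times> monodromy set"

definition ramified_coverings :: "covering set" where
  "ramified_coverings = (SIGMA n:UNIV. SIGMA k:{k. even k}. hurwitz_space n k)"

fun cov_deg :: "covering \<Rightarrow> nat" where
  "cov_deg (n, k, c) = n"

fun ramification_count :: "covering \<Rightarrow> nat" where
  "ramification_count (n, k, c) = k"

text \<open>Riemann-Hurwitz over a torus with k simple branch points.\<close>

definition cov_euler :: "covering \<Rightarrow> int" where
  "cov_euler X = - int (ramification_count X)"

text \<open>
  The size of the automorphism group of any representative of the class. Hurwitz numbers count
  each class with weight the inverse of this size; by orbit-stabilizer the total weight of
  \<open>hurwitz_space n k\<close> is \<open>card (labelled_coverings n k) / n!\<close>, which is the quantity equal to the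
  sum over partitions of n of the k-th power of the total content. The number of classes itself
  is in general larger.
\<close>

fun aut_order :: "covering \<Rightarrow> nat" where
  "aut_order (n, k, c) = card (covering_aut n (SOME X. X \<in> c))"

definition q_of :: "real \<Rightarrow> real" where
  "q_of t = exp (- t / 2)"

definition rho :: "real \<Rightarrow> covering measure" where
  "rho t = point_measure ramified_coverings
     (\<lambda>X. ennreal (q_of t ^ cov_deg X * (t ^ ramification_count X / fact (ramification_count X))
                   * (1 / real (aut_order X))))"


section \<open>The integrands\<close>

definition index_range :: "nat \<Rightarrow> covering \<Rightarrow> covering \<Rightarrow> nat set" where
  "index_range s X1 X2 =
     {k. real k \<le> real s + real_of_int (cov_euler X1) / 2 + real_of_int (cov_euler X2) / 2}"

definition Phi_A' :: "nat \<Rightarrow> real \<Rightarrow> nat \<Rightarrow> covering \<Rightarrow> covering \<Rightarrow> real" where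
  "Phi_A' s t N X1 X2 =
     (\<Sum>k\<in>index_range s X1 X2. \<Sum>\<^sub>\<infinity>n::int.
        q_of t powi (n\<^sup>2) *
        ((real_of_int n * t * (real (cov_deg X1) - real (cov_deg X2))) ^ (2 * k)
           / (real N ^ (2 * k) * fact (2 * k))))"

definition Phi_A :: "nat \<Rightarrow> real \<Rightarrow> nat \<Rightarrow> covering \<Rightarrow> covering \<Rightarrow> real" where
  "Phi_A s t N X1 X2 =
     (\<Sum>k\<in>index_range s X1 X2.
        t ^ k * (real (cov_deg X1) - real (cov_deg X2)) ^ (2 * k)
          / (2 ^ k * real N ^ (2 * k) * fact k))"

definition Phi_BD :: "real \<Rightarrow> nat \<Rightarrow> covering \<Rightarrow> real" where
  "Phi_BD t N X = exp (t / (2 * real N) * real (cov_deg X))"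

definition Phi_C :: "real \<Rightarrow> nat \<Rightarrow> covering \<Rightarrow> real" where
  "Phi_C t N X = exp (- (t / (2 * real N)) * real (cov_deg X))"

text \<open>
  The two families of integrands are only meaningful for the types A', A and B, C, D
  respectively, hence the values 0 outside.
\<close>

fun Phi2 :: "classical_type \<Rightarrow> nat \<Rightarrow> real \<Rightarrow> nat \<Rightarrow> covering \<Rightarrow> covering \<Rightarrow> real" where
  "Phi2 TypeA' = Phi_A'"
| "Phi2 TypeA = Phi_A"
| "Phi2 _ = (\<lambda>_ _ _ _ _. 0)"

fun Phi1 :: "classical_type \<Rightarrow> real \<Rightarrow> nat \<Rightarrow> covering \<Rightarrow> real" where
  "Phi1 TypeB = Phi_BD"
| "Phi1 TypeD = Phi_BD"
| "Phi1 TypeC = Phi_C"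
| "Phi1 _ = (\<lambda>_ _ _. 0)"

definition expansion2 :: "classical_type \<Rightarrow> nat \<Rightarrow> nat \<Rightarrow> real \<Rightarrow> real" where
  "expansion2 T p N t =
     (\<integral>X. of_bool (cov_euler (fst X) + cov_euler (snd X) \<ge> - 2 * int p)
            * Phi2 T (2 * p) t N (fst X) (snd X)
            * real N powi (cov_euler (fst X) + cov_euler (snd X)) \<partial>(rho t \<Otimes>\<^sub>M rho t))"

definition expansion1 :: "classical_type \<Rightarrow> nat \<Rightarrow> nat \<Rightarrow> real \<Rightarrow> real" where
  "expansion1 T p N t =
     (\<integral>X. of_bool (cov_euler X \<ge> - int p) * Phi1 T t N X * real N powi cov_euler X \<partial>(rho t))"

end

theory Submission
  imports Defs
begin

text \<open>
  Both sides are sums over partitions. A highest weight of type B, C or D is a partition with at most N/2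
  rows, in type D up to the sign of the last entry; one of type A' or A is a pair of such partitions, read upwards and downwards from the middle entry,
  together with the value of that entry. Up to explicit corrections the Casimir number is the size of the
  partitions plus 2/N times their total content.

  The weighted number of coverings of degree n with k ramifications is the trace of the k-th power of
  multiplication by the sum of all transpositions, acting on class functions of the symmetric group. In
  the basis of permutation characters of Young subgroups this operator is triangular for the order given by
  the sum of the squares of the parts, with the total contents on the diagonal, because moving one box
  between two rows satisfies a two-term recurrence. So the expansion is the Taylor polynomial in 1/N of the
  summand of the heat trace.

  For partitions with at most N/2 rows, Chebyshev's sum inequality bounds the content from below, which
  dominates the summands by a power of a number below 1 to the size, uniformly in N; partitions with more
  rows contribute less than any power of 1/N. Terms of odd order vanish, since a product of an odd number of
  transpositions is not a commutator.
\<close>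

section \<open>Partitions and total content\<close>

text \<open>Two obstacles shape the argument. On the side of the symmetric group no irreducible
  representation is built: the eigenvalues with multiplicity suffice, and a triangular basis of
  combinatorial nature yields them. Triangularity is used twice, for different orders: the number of
  nonzero parts governs the values of the characters on cycle types and makes them a basis, the sum
  of squares governs the operator. On the analytic side the content can be as low as about minus
  half the square of the size, so the exponential in the heat trace is not summable over all
  partitions; only partitions with at most about N/2 rows are under control. Hence a weight of U(N)
  is cut in the middle, so that neither half exceeds N/2 rows, and beyond that range only Taylor
  polynomials are estimated. For U(N) and SU(N) the sizes of the two halves are coupled; the
  quadratic gain from Cauchy-Schwarz in the content bound absorbs this coupling. There the
  integrands also retain other powers than the Taylor polynomial does, so the two sides are compared
  monomial by monomial.\<close>

definition partitions :: "(nat \<Rightarrow> nat) set" where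
  "partitions = {a. antimono a \<and> finite {i. a i \<noteq> 0}}"

definition psize :: "(nat \<Rightarrow> nat) \<Rightarrow> nat" where
  "psize a = (\<Sum>i | a i \<noteq> 0. a i)"

text \<open>Rows are counted from 0, so the factor is \<alpha>_i + 1 - 2 i in the usual numbering.
  The value is the sum of column index minus row index over all boxes.\<close>

definition total_content :: "(nat \<Rightarrow> nat) \<Rightarrow> real" where
  "total_content a = (\<Sum>i | a i \<noteq> 0. real (a i) * (real (a i) - 1 - 2 * real i)) / 2"

definition partitions_of :: "nat \<Rightarrow> (nat \<Rightarrow> nat) set" where
  "partitions_of n = {a \<in> partitions. psize a = n}"

lemma psize_eq:
  assumes "\<And>i. i \<ge> m \<Longrightarrow> a i = 0"
  shows "psize a = (\<Sum>i<m. a i)"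
proof -
  have "{i. a i \<noteq> 0} \<subseteq> {..<m}" by (metis (mono_tags, lifting) assms lessThan_iff mem_Collect_eq not_le subsetI)
  thus ?thesis unfolding psize_def by (intro sum.mono_neutral_left) auto
qed

lemma total_content_eq:
  assumes "\<And>i. i \<ge> m \<Longrightarrow> a i = 0"
  shows "total_content a = (\<Sum>i<m. real (a i) * (real (a i) - 1 - 2 * real i)) / 2"
proof -
  have "(\<Sum>i | a i \<noteq> 0. real (a i) * (real (a i) - 1 - 2 * real i))
      = (\<Sum>i<m. real (a i) * (real (a i) - 1 - 2 * real i))"
  proof -
    have "{i. a i \<noteq> 0} \<subseteq> {..<m}" by (metis (mono_tags, lifting) assms lessThan_iff mem_Collect_eq not_le subsetI)
    thus ?thesis by (intro sum.mono_neutral_left) auto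
  qed
  thus ?thesis unfolding total_content_def by simp
qed

lemma partition_vanishes:
  assumes "a \<in> partitions_of n" "i \<ge> n"
  shows "a i = 0"
proof (rule ccontr)
  assume "a i \<noteq> 0"
  have fin: "finite {i. a i \<noteq> 0}" and mono: "antimono a" and sz: "psize a = n"
    using assms by (auto simp: partitions_of_def partitions_def)
  have pos: "a j \<ge> 1" if "j \<le> i" for j
    using antimonoD[OF mono that] \<open>a i \<noteq> 0\<close> by simp
  have "Suc i = (\<Sum>j\<le>i. 1)" by simp
  also have "\<dots> \<le> (\<Sum>j\<le>i. a j)" using pos by (intro sum_mono) auto
  also have "\<dots> \<le> psize a"
    unfolding psize_def using fin pos by (intro sum_mono2) (auto simp: Suc_le_eq)
  finally show False using sz assms by simp
qed

lemma partitions_of_eq: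
  "partitions_of n = {a. antimono a \<and> (\<forall>i\<ge>n. a i = 0) \<and> (\<Sum>i<n. a i) = n}"
proof (intro set_eqI iffI)
  fix a assume a: "a \<in> partitions_of n"
  thus "a \<in> {a. antimono a \<and> (\<forall>i\<ge>n. a i = 0) \<and> (\<Sum>i<n. a i) = n}"
    using partition_vanishes[OF a] psize_eq[of n a]
    by (auto simp: partitions_of_def partitions_def)
next
  fix a assume a: "a \<in> {a. antimono a \<and> (\<forall>i\<ge>n. a i = 0) \<and> (\<Sum>i<n. a i) = n}"
  hence "{i. a i \<noteq> 0} \<subseteq> {..<n}" by (metis (mono_tags, lifting) lessThan_iff mem_Collect_eq not_le subsetI)
  hence "finite {i. a i \<noteq> 0}" using finite_subset by blast
  with a show "a \<in> partitions_of n"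
    using psize_eq[of n a] by (simp add: partitions_of_def partitions_def)
qed

lemma finite_partitions_of: "finite (partitions_of n)"
proof -
  have "partitions_of n \<subseteq> {a. \<forall>i. (i \<in> {..<n} \<longrightarrow> a i \<in> {..n}) \<and> (i \<notin> {..<n} \<longrightarrow> a i = 0)}"
  proof (clarsimp simp: partitions_of_eq)
    fix a i assume "(\<Sum>i<n. a i) = n" "i < n"
    thus "a i \<le> n" using member_le_sum[of i "{..<n}" a] by auto
  qed
  thus ?thesis
    by (rule finite_subset) (intro finite_set_of_finite_funs finite_lessThan finite_atMost)
qed

lemma UN_partitions_of: "(\<Union>n. partitions_of n) = partitions"
  by (auto simp: partitions_of_def)

lemma total_content_bound:
  assumes "a \<in> partitions"
  shows "\<bar>total_content a\<bar> \<le> (real (psize a))\<^sup>2"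
proof -
  define n where "n = psize a"
  have a: "a \<in> partitions_of n" using assms by (simp add: partitions_of_def n_def)
  have le: "a i \<le> n" for i
    using a member_le_sum[of i "{..<n}" a] by (cases "i < n") (auto simp: partitions_of_eq)
  have "\<bar>total_content a\<bar> = \<bar>\<Sum>i<n. real (a i) * (real (a i) - 1 - 2 * real i)\<bar> / 2"
    using total_content_eq[of n a] partition_vanishes[OF a] by simp
  also have "\<dots> \<le> (\<Sum>i<n. \<bar>real (a i) * (real (a i) - 1 - 2 * real i)\<bar>) / 2"
    by (intro divide_right_mono sum_abs) auto
  also have "\<dots> \<le> (\<Sum>i<n. real (a i) * (2 * real n)) / 2"
  proof (intro divide_right_mono sum_mono)
    fix i assume "i \<in> {..<n}"
    hence "\<bar>real (a i) - 1 - 2 * real i\<bar> \<le> 2 * real n" using le[of i] by auto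
    thus "\<bar>real (a i) * (real (a i) - 1 - 2 * real i)\<bar> \<le> real (a i) * (2 * real n)"
      unfolding abs_mult by (intro mult_mono) auto
  qed auto
  also have "\<dots> = real (\<Sum>i<n. a i) * real n" by (simp add: sum_distrib_right[symmetric])
  also have "\<dots> = (real n)\<^sup>2" using a by (simp add: partitions_of_eq power2_eq_square)
  finally show ?thesis by (simp add: n_def)
qed

section \<open>Permutation characters of Young subgroups\<close>

text \<open>
  Colours are the numbers below n. Outside \<open>{..<n}\<close> a colouring has the value n, which every permutation
  of the colours fixes.
\<close>

definition colourings :: "nat \<Rightarrow> (nat \<Rightarrow> nat) \<Rightarrow> (nat \<Rightarrow> nat) set" where
  "colourings n a = {c. (\<forall>x<n. c x < n) \<and> (\<forall>x\<ge>n. c x = n) \<and> (\<forall>i<n. card {x. x < n \<and> c x = i} = a i)}"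

definition fixed_colourings :: "nat \<Rightarrow> (nat \<Rightarrow> nat) \<Rightarrow> (nat \<Rightarrow> nat) \<Rightarrow> (nat \<Rightarrow> nat) set" where
  "fixed_colourings n a s = {c \<in> colourings n a. c \<circ> s = c}"

definition young_char :: "nat \<Rightarrow> (nat \<Rightarrow> nat) \<Rightarrow> (nat \<Rightarrow> nat) \<Rightarrow> nat" where
  "young_char n a s = card (fixed_colourings n a s)"

text \<open>
  The last condition says that s carries c to c with the colours of i and j swapped. So i and j lie on
  one cycle of s, which they cut into an arc of colour k and an arc of colour l.
\<close>

definition two_cuts :: "nat \<Rightarrow> (nat \<Rightarrow> nat) \<Rightarrow> nat \<Rightarrow> nat \<Rightarrow> (nat \<Rightarrow> nat) \<Rightarrow> ((nat \<Rightarrow> nat) \<times> nat \<times> nat) set" where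
  "two_cuts n a k l s = {(c, i, j). c \<in> colourings n a \<and> i < n \<and> j < n \<and> c i = k \<and> c j = l
     \<and> c \<circ> Transposition.transpose i j \<circ> s = c}"

section \<open>Cuts of a cycle into two colours\<close>

lemma finite_colourings: "finite (colourings n a)"
proof -
  have "colourings n a \<subseteq> {c. \<forall>x. (x \<in> {..<n} \<longrightarrow> c x \<in> {..<n}) \<and> (x \<notin> {..<n} \<longrightarrow> c x = n)}"
    by (auto simp: colourings_def)
  thus ?thesis
    by (rule finite_subset) (intro finite_set_of_finite_funs finite_lessThan)
qed

lemma finite_two_cuts: "finite (two_cuts n a k l s)"
  by (rule finite_subset[of _ "colourings n a \<times> {..<n} \<times> {..<n}"])
     (auto simp: two_cuts_def finite_colourings)

lemma recolour:
  assumes c: "c \<in> colourings n a" and j: "j < n" "c j = l" and kl: "k < n" "l < n" "k \<noteq> l"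
  shows "c(j := k) \<in> colourings n (a(k := Suc (a k), l := a l - 1))"
proof -
  have card: "card {x. x < n \<and> c x = i} = a i" if "i < n" for i
    using c that by (auto simp: colourings_def)
  have fin: "finite {x. x < n \<and> P x}" for P by simp
  have "card {x. x < n \<and> (c(j := k)) x = i} = (a(k := Suc (a k), l := a l - 1)) i" if i: "i < n" for i
  proof -
    consider "i = k" | "i = l" | "i \<noteq> k" "i \<noteq> l" by blast
    thus ?thesis
    proof cases
      case 1
      have "{x. x < n \<and> (c(j := k)) x = i} = insert j {x. x < n \<and> c x = i}"
        using 1 j by auto
      moreover have "j \<notin> {x. x < n \<and> c x = i}" using 1 j kl by auto
      ultimately show ?thesis using 1 card[OF i] kl by simp
    next
      case 2
      have "{x. x < n \<and> (c(j := k)) x = i} = {x. x < n \<and> c x = i} - {j}"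
        using 2 kl by auto
      moreover have "j \<in> {x. x < n \<and> c x = i}" using 2 j by auto
      ultimately show ?thesis using 2 card[OF i] by simp
    next
      case 3
      have "{x. x < n \<and> (c(j := k)) x = i} = {x. x < n \<and> c x = i}"
        using 3 j by auto
      thus ?thesis using 3 card[OF i] by simp
    qed
  qed
  thus ?thesis using c j kl by (auto simp: colourings_def)
qed

text \<open>Starting at i the cycle has colour k until j is reached, then colour l until it closes.
  Giving j, the first point of the l-arc, to the k-arc moves the second cut to \<open>s j\<close>.
  The case \<open>i = j\<close> is an empty k-arc, the case \<open>i = s j\<close> an empty
  l-arc.\<close>

lemma shift_cut:
  fixes s :: "'a \<Rightarrow> 'a" and c :: "'a \<Rightarrow> 'b"
  assumes s: "inj s" and cj: "c j = l" and ci: "c i = k \<or> i = j" and kl: "k \<noteq> l"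
    and fix0: "c \<circ> Transposition.transpose i j \<circ> s = c"
  shows "(c(j := k)) i = k" "(c(j := k)) (s j) = l \<or> i = s j"
    "c(j := k) \<circ> Transposition.transpose i (s j) \<circ> s = c(j := k)"
proof -
  have fx: "c (Transposition.transpose i j (s x)) = c x" for x
    using fun_cong[OF fix0, of x] by simp
  have inj: "s x = s y \<longleftrightarrow> x = y" for x y using s by (simp add: inj_eq)
  show 1: "(c(j := k)) i = k" using ci by auto
  show 2: "(c(j := k)) (s j) = l \<or> i = s j"
    using fx[of j] cj ci kl by (auto simp: Transposition.transpose_def split: if_splits)
  show "c(j := k) \<circ> Transposition.transpose i (s j) \<circ> s = c(j := k)"
  proof
    fix x
    have "(c(j := k)) (Transposition.transpose i (s j) (s x)) = (c(j := k)) x"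
    proof (cases "x = j")
      case True
      thus ?thesis using 1 by simp
    next
      case False
      hence ne: "s x \<noteq> s j" by (simp add: inj)
      consider "s x = i" | "s x \<noteq> i" "s x = j" | "s x \<noteq> i" "s x \<noteq> j" by blast
      thus ?thesis
      proof cases
        case 1
        thus ?thesis using 2 fx[of x] cj False ne by simp
      next
        case 2
        thus ?thesis using ne fx[of x] ci False by simp
      next
        case 3
        thus ?thesis using ne fx[of x] False by simp
      qed
    qed
    thus "(c(j := k) \<circ> Transposition.transpose i (s j) \<circ> s) x = (c(j := k)) x" by simp
  qed
qed

text \<open>Undoes \<open>shift_cut\<close>: the last point j of the k-arc goes back to colour l.
  The fixed-colouring condition at j forces \<open>c j = k\<close>, so \<open>recolour\<close> can
  be applied backwards.\<close>

lemma unshift_cut: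
  fixes s :: "'a \<Rightarrow> 'a" and c :: "'a \<Rightarrow> 'b"
  assumes s: "inj s" and ci: "c i = k" and cj: "c (s j) = l \<or> i = s j" and kl: "k \<noteq> l"
    and fix0: "c \<circ> Transposition.transpose i (s j) \<circ> s = c"
  shows "c j = k" "(c(j := l)) i = k \<or> i = j"
    "c(j := l) \<circ> Transposition.transpose i j \<circ> s = c(j := l)"
proof -
  have fx: "c (Transposition.transpose i (s j) (s x)) = c x" for x
    using fun_cong[OF fix0, of x] by simp
  have inj: "s x = s y \<longleftrightarrow> x = y" for x y using s by (simp add: inj_eq)
  show 1: "c j = k" using fx[of j] ci by simp
  show 2: "(c(j := l)) i = k \<or> i = j" using ci by auto
  show "c(j := l) \<circ> Transposition.transpose i j \<circ> s = c(j := l)"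
  proof
    fix x
    have "(c(j := l)) (Transposition.transpose i j (s x)) = (c(j := l)) x"
    proof (cases "x = j")
      case True
      consider "s j = i" | "s j \<noteq> i" "s j = j" | "s j \<noteq> i" "s j \<noteq> j" by blast
      thus ?thesis using True cj ci 1 kl by cases auto
    next
      case False
      hence ne: "s x \<noteq> s j" by (simp add: inj)
      consider "s x = i" | "s x \<noteq> i" "s x = j" | "s x \<noteq> i" "s x \<noteq> j" by blast
      thus ?thesis
      proof cases
        case 1
        thus ?thesis using fx[of x] cj ne False by simp
      next
        case 2
        thus ?thesis using fx[of x] \<open>c j = k\<close> ci ne False by simp
      next
        case 3
        thus ?thesis using ne fx[of x] False by simp
      qed
    qed
    thus "(c(j := l) \<circ> Transposition.transpose i j \<circ> s) x = (c(j := l)) x" by simp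
  qed
qed

text \<open>
  The added triples have \<open>i = j\<close> and mark a point on a monochromatic cycle. With them, moving j one step
  along s and recolouring a single point becomes a bijection from (k, l)-cuts to (k, l)-cuts with one more
  point of colour k.
\<close>

definition two_cuts_ext :: "nat \<Rightarrow> (nat \<Rightarrow> nat) \<Rightarrow> nat \<Rightarrow> nat \<Rightarrow> nat \<Rightarrow> (nat \<Rightarrow> nat) \<Rightarrow> ((nat \<Rightarrow> nat) \<times> nat \<times> nat) set" where
  "two_cuts_ext n a k l m s = two_cuts n a k l s \<union>
     (\<lambda>(c, j). (c, j, j)) ` (SIGMA c:fixed_colourings n a s. {j. j < n \<and> c j = m})"

text \<open>Each fixed colouring contributes its \<open>a m\<close> points of colour m, and the
  added triples are no cuts because the end points of a cut differ in colour. The marked colour m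
  will be l before a move and k after it.\<close>

lemma card_two_cuts_ext:
  assumes "k \<noteq> l" "m < n"
  shows "card (two_cuts_ext n a k l m s) = card (two_cuts n a k l s) + a m * young_char n a s"
proof -
  let ?D = "SIGMA c:fixed_colourings n a s. {j. j < n \<and> c j = m}"
  have fin: "finite (fixed_colourings n a s)"
    using finite_colourings by (auto simp: fixed_colourings_def)
  have "inj_on (\<lambda>(c, j). (c, j, j)) ?D" by (auto simp: inj_on_def)
  hence "card ((\<lambda>(c, j). (c, j, j)) ` ?D) = card ?D" by (rule card_image)
  also have "\<dots> = (\<Sum>c\<in>fixed_colourings n a s. card {j. j < n \<and> c j = m})"
    using fin by (intro card_SigmaI) auto
  also have "\<dots> = (\<Sum>c\<in>fixed_colourings n a s. a m)"
    using assms by (intro sum.cong) (auto simp: fixed_colourings_def colourings_def)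
  finally have 1: "card ((\<lambda>(c, j). (c, j, j)) ` ?D) = a m * young_char n a s"
    by (simp add: young_char_def)
  have "two_cuts n a k l s \<inter> (\<lambda>(c, j). (c, j, j)) ` ?D = {}"
    using assms by (auto simp: two_cuts_def)
  moreover have "finite ((\<lambda>(c, j). (c, j, j)) ` ?D)"
    using fin by (intro finite_imageI finite_SigmaI) auto
  ultimately show ?thesis unfolding two_cuts_ext_def
    by (subst card_Un_disjoint) (auto simp: finite_two_cuts 1)
qed

lemma two_cuts_ext_left:
  "two_cuts_ext n a k l l s = {(c, i, j). c \<in> colourings n a \<and> i < n \<and> j < n \<and> c j = l
     \<and> (c i = k \<or> i = j) \<and> c \<circ> Transposition.transpose i j \<circ> s = c}"
  by (auto simp: two_cuts_ext_def two_cuts_def fixed_colourings_def image_iff)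

lemma two_cuts_ext_right:
  "two_cuts_ext n a k l k s = {(c, i, j). c \<in> colourings n a \<and> i < n \<and> j < n \<and> c i = k
     \<and> (c j = l \<or> i = j) \<and> c \<circ> Transposition.transpose i j \<circ> s = c}"
  by (auto simp: two_cuts_ext_def two_cuts_def fixed_colourings_def image_iff)

text \<open>The move of \<open>shift_cut\<close> matches the extended cuts of a, marked in l, with
  those of b, marked in k. The condition \<open>a l \<noteq> 0\<close> makes the truncated
  subtraction reversible, so that recolouring back ends in \<open>a\<close>.\<close>

lemma card_two_cuts_shift:
  assumes s: "s permutes {..<n}" and kl: "k < n" "l < n" "k \<noteq> l" and al: "a l \<noteq> 0"
  defines "b \<equiv> a(k := Suc (a k), l := a l - 1)"
  shows "card (two_cuts n a k l s) + a l * young_char n a s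
       = card (two_cuts n b k l s) + b k * young_char n b s"
proof -
  have inj: "inj s" using s by (rule permutes_inj)
  have sn: "s j < n \<longleftrightarrow> j < n" for j using permutes_in_image[OF s, of j] by simp
  have invs: "inv s j < n \<longleftrightarrow> j < n" for j using permutes_in_image[OF permutes_inv[OF s], of j] by simp
  have sinv: "s (inv s j) = j" "inv s (s j) = j" for j using permutes_inverses[OF s] by auto
  have ba: "b(l := Suc (b l), k := b k - 1) = a" using kl al by (auto simp: b_def fun_eq_iff)
  let ?f = "\<lambda>(c, i, j). (c(j := k), i, s j)" and ?g = "\<lambda>(c, i, j). (c(inv s j := l), i, inv s j)"
  have F: "?f x \<in> two_cuts_ext n b k l k s \<and> ?g (?f x) = x" if x: "x \<in> two_cuts_ext n a k l l s" for x
  proof -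
    obtain c i j where xx: "x = (c, i, j)" by (cases x)
    with x have *: "c \<in> colourings n a" "i < n" "j < n" "c j = l" "c i = k \<or> i = j"
        "c \<circ> Transposition.transpose i j \<circ> s = c"
      by (auto simp: two_cuts_ext_left)
    show ?thesis
      using recolour[OF *(1,3,4) kl] shift_cut[OF inj *(4,5) kl(3) *(6)] *
      by (simp add: xx two_cuts_ext_right b_def sn sinv) auto
  qed
  have G: "?g x \<in> two_cuts_ext n a k l l s \<and> ?f (?g x) = x" if x: "x \<in> two_cuts_ext n b k l k s" for x
  proof -
    obtain c i j where xx: "x = (c, i, j)" by (cases x)
    with x have *: "c \<in> colourings n b" "i < n" "j < n" "c i = k" "c j = l \<or> i = j"
        "c \<circ> Transposition.transpose i j \<circ> s = c"
      by (auto simp: two_cuts_ext_right)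
    have u: "c (inv s j) = k" "(c(inv s j := l)) i = k \<or> i = inv s j"
      "c(inv s j := l) \<circ> Transposition.transpose i (inv s j) \<circ> s = c(inv s j := l)"
      using unshift_cut[of s c i k "inv s j" l] * inj kl by (simp_all only: sinv) blast+
    have "inv s j < n" using * by (simp add: invs)
    from recolour[OF *(1) this u(1) kl(2,1) kl(3)[symmetric]]
    have "c(inv s j := l) \<in> colourings n a" by (simp only: ba)
    thus ?thesis using u * \<open>inv s j < n\<close>
      by (simp add: xx two_cuts_ext_left sn sinv) auto
  qed
  have "bij_betw ?f (two_cuts_ext n a k l l s) (two_cuts_ext n b k l k s)"
    by (rule bij_betw_byWitness[where f' = ?g]) (use F G in blast)+
  hence "card (two_cuts_ext n a k l l s) = card (two_cuts_ext n b k l k s)"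
    by (rule bij_betw_same_card)
  thus ?thesis using kl by (simp add: card_two_cuts_ext)
qed

section \<open>The sum of all transpositions acting on a Young character\<close>

definition transpositions :: "nat \<Rightarrow> (nat \<Rightarrow> nat) set" where
  "transpositions n = {s. \<exists>i<n. \<exists>j<n. i \<noteq> j \<and> s = Transposition.transpose i j}"

lemma finite_transpositions: "finite (transpositions n)"
proof -
  have "transpositions n \<subseteq> (\<lambda>(i, j). Transposition.transpose i j) ` ({..<n} \<times> {..<n})"
    by (auto simp: transpositions_def)
  thus ?thesis by (rule finite_subset) auto
qed

lemma transpositions_permutes: "tau \<in> transpositions n \<Longrightarrow> tau permutes {..<n}"
  by (auto simp: transpositions_def intro!: permutes_swap_id)

lemma transpose_eq_iff:
  fixes i j k l :: nat
  assumes "i < j" "k < l"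
  shows "Transposition.transpose i j = Transposition.transpose k l \<longleftrightarrow> i = k \<and> j = l" (is "?L = ?R")
proof
  assume L: ?L
  have "Transposition.transpose k l i = j" "Transposition.transpose k l j = i"
    using fun_cong[OF L, of i] fun_cong[OF L, of j] by auto
  moreover have "i = k \<or> i = l"
  proof (rule ccontr)
    assume "\<not> (i = k \<or> i = l)"
    hence "Transposition.transpose k l i = i" by simp
    thus False using calculation(1) assms by simp
  qed
  ultimately show ?R using assms by auto
qed simp

lemma sum_transpositions:
  fixes f :: "(nat \<Rightarrow> nat) \<Rightarrow> real"
  shows "2 * (\<Sum>tau\<in>transpositions n. f tau)
    = (\<Sum>(i, j)\<in>{(i, j). i < n \<and> j < n \<and> i \<noteq> j}. f (Transposition.transpose i j))"
proof -
  let ?A = "{(i, j). i < n \<and> j < n \<and> i < j}" and ?B = "{(i, j). i < n \<and> j < n \<and> j < i}"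
  let ?g = "\<lambda>(i, j). f (Transposition.transpose i j)"
  have fin: "finite ?A" "finite ?B"
    by (rule finite_subset[of _ "{..<n} \<times> {..<n}"]; auto)+
  have "bij_betw (\<lambda>(i, j). Transposition.transpose i j) ?A (transpositions n)"
    unfolding bij_betw_def
  proof
    show "inj_on (\<lambda>(i, j). Transposition.transpose i j) ?A"
      by (auto simp: inj_on_def transpose_eq_iff)
    show "(\<lambda>(i, j). Transposition.transpose i j) ` ?A = transpositions n"
    proof (intro equalityI subsetI)
      fix s assume "s \<in> transpositions n"
      then obtain i j where ij: "i < n" "j < n" "i \<noteq> j" "s = Transposition.transpose i j"
        by (auto simp: transpositions_def)
      show "s \<in> (\<lambda>(i, j). Transposition.transpose i j) ` ?A"
      proof (cases "i < j")
        case True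
        thus ?thesis using ij by (intro image_eqI[where x = "(i, j)"]) auto
      next
        case False
        thus ?thesis using ij by (intro image_eqI[where x = "(j, i)"]) (auto simp: transpose_commute)
      qed
    next
      fix s assume "s \<in> (\<lambda>(i, j). Transposition.transpose i j) ` ?A"
      then obtain i j where ij: "i < n" "j < n" "i < j" "s = Transposition.transpose i j" by auto
      moreover have "i \<noteq> j" using ij by simp
      ultimately show "s \<in> transpositions n" unfolding transpositions_def by blast
    qed
  qed
  from sum.reindex_bij_betw[OF this, of f]
  have 1: "sum ?g ?A = sum f (transpositions n)" by (simp add: case_prod_beta)
  have "bij_betw (\<lambda>(i, j). (j, i)) ?B ?A"
    by (rule bij_betw_byWitness[where f' = "\<lambda>(i, j). (j, i)"]) auto
  from sum.reindex_bij_betw[OF this, of ?g]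
  have 2: "sum ?g ?B = sum ?g ?A" by (simp add: case_prod_beta transpose_commute)
  have "{(i, j). i < n \<and> j < n \<and> i \<noteq> j} = ?A \<union> ?B" by auto
  moreover have "?A \<inter> ?B = {}" by auto
  ultimately have "sum ?g {(i, j). i < n \<and> j < n \<and> i \<noteq> j} = sum ?g ?A + sum ?g ?B"
    using fin by (simp add: sum.union_disjoint)
  thus ?thesis using 1 2 by simp
qed

lemma card_monochromatic_pairs:
  assumes "c \<in> colourings n a"
  shows "real (card {(i, j). i < n \<and> j < n \<and> i \<noteq> j \<and> c i = c j}) = (\<Sum>k<n. real (a k) * (real (a k) - 1))"
proof -
  have card: "card {x. x < n \<and> c x = k} = a k" if "k < n" for k
    using assms that by (auto simp: colourings_def)
  have "{(i, j). i < n \<and> j < n \<and> i \<noteq> j \<and> c i = c j} = (SIGMA i:{..<n}. {j. j < n \<and> c j = c i} - {i})"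
    by auto
  hence "card {(i, j). i < n \<and> j < n \<and> i \<noteq> j \<and> c i = c j} = (\<Sum>i<n. card ({j. j < n \<and> c j = c i} - {i}))"
    by (simp only:) (intro card_SigmaI, auto)
  also have "real \<dots> = (\<Sum>i<n. real (a (c i)) - 1)"
    unfolding of_nat_sum
  proof (intro sum.cong refl)
    fix i assume i: "i \<in> {..<n}"
    hence ci: "c i < n" using assms by (auto simp: colourings_def)
    have "i \<in> {j. j < n \<and> c j = c i}" using i by auto
    hence "card {j. j < n \<and> c j = c i} > 0" by (auto simp: card_gt_0_iff)
    hence "a (c i) > 0" using card[OF ci] by simp
    thus "real (card ({j. j < n \<and> c j = c i} - {i})) = real (a (c i)) - 1"
      using i card[OF ci] by (simp add: of_nat_diff)
  qed
  also have "\<dots> = (\<Sum>k<n. \<Sum>i\<in>{i\<in>{..<n}. c i = k}. real (a (c i)) - 1)"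
    using assms by (intro sum.group[symmetric]) (auto simp: colourings_def)
  also have "\<dots> = (\<Sum>k<n. real (a k) * (real (a k) - 1))"
    using card by (intro sum.cong) auto
  finally show ?thesis .
qed

lemma card_two_cuts_commute: "card (two_cuts n a k l s) = card (two_cuts n a l k s)"
proof -
  have "bij_betw (\<lambda>(c, i, j). (c, j, i)) (two_cuts n a k l s) (two_cuts n a l k s)"
    by (rule bij_betw_byWitness[where f' = "\<lambda>(c, i, j). (c, j, i)"])
       (auto simp: two_cuts_def transpose_commute)
  thus ?thesis by (rule bij_betw_same_card)
qed

text \<open>Counts ordered pairs i, j together with a colouring fixed by
  \<open>transpose i j \<circ> s\<close>. If i and j have one colour, the transposition leaves the
  colouring alone, which is then fixed by s, and the pair is any monochromatic one. Otherwise this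
  is a two-cut. Forgetting the order halves both counts, for cuts by
  \<open>card_two_cuts_commute\<close>.\<close>

lemma sum_transpositions_young_char:
  "(\<Sum>tau\<in>transpositions n. real (young_char n a (tau \<circ> s)))
   = (\<Sum>k<n. real (a k) * (real (a k) - 1)) / 2 * real (young_char n a s)
     + (\<Sum>l<n. \<Sum>k<l. real (card (two_cuts n a k l s)))"
proof -
  let ?P = "{(i, j). i < n \<and> j < n \<and> i \<noteq> j}"
  let ?U = "SIGMA (i, j):?P. {c \<in> colourings n a. c \<circ> (Transposition.transpose i j \<circ> s) = c}"
  let ?M = "SIGMA c:fixed_colourings n a s. {(i, j). i < n \<and> j < n \<and> i \<noteq> j \<and> c i = c j}"
  let ?V = "SIGMA (k, l):?P. two_cuts n a k l s"
  have finP: "finite ?P" by (rule finite_subset[of _ "{..<n} \<times> {..<n}"]) auto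
  have finF: "finite (fixed_colourings n a s)"
    using finite_colourings by (auto simp: fixed_colourings_def)
  have finM: "finite ?M"
    by (intro finite_SigmaI finF) (rule finite_subset[of _ "{..<n} \<times> {..<n}"], auto)
  have finV: "finite ?V" by (intro finite_SigmaI finP) (auto simp: finite_two_cuts)
  have mono: "c \<circ> Transposition.transpose i j = c" if "c i = c j" for c :: "nat \<Rightarrow> nat" and i j
    using that by (auto simp: fun_eq_iff Transposition.transpose_def)
  have "2 * (\<Sum>tau\<in>transpositions n. real (young_char n a (tau \<circ> s)))
    = (\<Sum>x\<in>?P. real (card ((\<lambda>(i, j). {c \<in> colourings n a. c \<circ> (Transposition.transpose i j \<circ> s) = c}) x)))"
    unfolding sum_transpositions by (intro sum.cong) (auto simp: young_char_def fixed_colourings_def)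
  also have "\<dots> = real (card ?U)"
    using finP finite_colourings by (subst card_SigmaI) (auto simp: case_prod_beta)
  also have "card ?U = card ((\<lambda>(c, i, j). ((i, j), c)) ` ?M \<union> (\<lambda>((k, l), (c, i, j)). ((i, j), c)) ` ?V)"
  proof (rule arg_cong[where f = card], intro equalityI subsetI)
    fix x assume "x \<in> ?U"
    then obtain i j c where x: "x = ((i, j), c)" "i < n" "j < n" "i \<noteq> j" "c \<in> colourings n a"
      and fx: "c \<circ> Transposition.transpose i j \<circ> s = c" by (auto simp: comp_assoc)
    show "x \<in> (\<lambda>(c, i, j). ((i, j), c)) ` ?M \<union> (\<lambda>((k, l), (c, i, j)). ((i, j), c)) ` ?V"
    proof (cases "c i = c j")
      case True
      hence "c \<circ> s = c" using fx mono[of c i j] by simp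
      hence "(c, i, j) \<in> ?M" using x True by (simp add: fixed_colourings_def)
      thus ?thesis using x by force
    next
      case False
      hence "((c i, c j), (c, i, j)) \<in> ?V" using x fx by (auto simp: two_cuts_def colourings_def)
      thus ?thesis using x by force
    qed
  next
    fix x assume "x \<in> (\<lambda>(c, i, j). ((i, j), c)) ` ?M \<union> (\<lambda>((k, l), (c, i, j)). ((i, j), c)) ` ?V"
    thus "x \<in> ?U"
    proof
      assume "x \<in> (\<lambda>(c, i, j). ((i, j), c)) ` ?M"
      thus ?thesis using mono by (fastforce simp: fixed_colourings_def comp_assoc[symmetric])
    next
      assume "x \<in> (\<lambda>((k, l), (c, i, j)). ((i, j), c)) ` ?V"
      thus ?thesis by (auto simp: two_cuts_def comp_assoc)
    qed
  qed
  also have "\<dots> = card ((\<lambda>(c, i, j). ((i, j), c)) ` ?M) + card ((\<lambda>((k, l), (c, i, j)). ((i, j), c)) ` ?V)"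
    using finM finV by (intro card_Un_disjoint finite_imageI) (auto simp: two_cuts_def)
  also have "card ((\<lambda>(c, i, j). ((i, j), c)) ` ?M) = card ?M"
    by (intro card_image) (auto simp: inj_on_def)
  also have "card ((\<lambda>((k, l), (c, i, j)). ((i, j), c)) ` ?V) = card ?V"
    by (intro card_image) (auto simp: inj_on_def two_cuts_def)
  also have "real (card ?M + card ?V) = real (card ?M) + real (card ?V)" by simp
  also have "card ?M = (\<Sum>c\<in>fixed_colourings n a s. card {(i, j). i < n \<and> j < n \<and> i \<noteq> j \<and> c i = c j})"
    by (rule card_SigmaI[OF finF]) (auto intro: finite_subset[of _ "{..<n} \<times> {..<n}"])
  also have "real \<dots> = (\<Sum>c\<in>fixed_colourings n a s. \<Sum>k<n. real (a k) * (real (a k) - 1))"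
    unfolding of_nat_sum by (intro sum.cong refl card_monochromatic_pairs) (auto simp: fixed_colourings_def)
  also have "\<dots> = (\<Sum>k<n. real (a k) * (real (a k) - 1)) * real (young_char n a s)"
    by (simp add: young_char_def)
  also have "real (card ?V) = 2 * (\<Sum>l<n. \<Sum>k<l. real (card (two_cuts n a k l s)))"
  proof -
    let ?g = "\<lambda>(k, l). real (card (two_cuts n a k l s))"
    have "card ?V = (\<Sum>x\<in>?P. card ((\<lambda>(k, l). two_cuts n a k l s) x))"
      using finP by (intro card_SigmaI) (auto simp: finite_two_cuts)
    hence V: "real (card ?V) = sum ?g ?P" by (simp add: case_prod_beta)
    let ?A = "SIGMA l:{..<n}. {..<l}"
    have "sum ?g ?P = sum ?g ((\<lambda>(l, k). (k, l)) ` ?A \<union> ?A)"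
      by (intro sum.cong) (auto simp: image_iff)
    also have "\<dots> = sum ?g ((\<lambda>(l, k). (k, l)) ` ?A) + sum ?g ?A"
      by (intro sum.union_disjoint finite_imageI) auto
    also have "sum ?g ((\<lambda>(l, k). (k, l)) ` ?A) = (\<Sum>(l, k)\<in>?A. real (card (two_cuts n a k l s)))"
      by (subst sum.reindex) (auto simp: inj_on_def case_prod_beta o_def)
    also have "sum ?g ?A = (\<Sum>(l, k)\<in>?A. real (card (two_cuts n a k l s)))"
      by (intro sum.cong) (auto simp: card_two_cuts_commute)
    also have "(\<Sum>(l, k)\<in>?A. real (card (two_cuts n a k l s))) = (\<Sum>l<n. \<Sum>k<l. real (card (two_cuts n a k l s)))"
      by (rule sum.Sigma[symmetric]) auto
    finally show ?thesis using V by simp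
  qed
  finally have "2 * (\<Sum>tau\<in>transpositions n. real (young_char n a (tau \<circ> s)))
    = (\<Sum>k<n. real (a k) * (real (a k) - 1)) * real (young_char n a s)
      + 2 * (\<Sum>l<n. \<Sum>k<l. real (card (two_cuts n a k l s)))" .
  moreover have "2 * x = y * z + 2 * v \<Longrightarrow> x = y / 2 * z + v" for x y z v :: real by simp
  ultimately show ?thesis by blast
qed

definition move :: "(nat \<Rightarrow> nat) \<Rightarrow> nat \<Rightarrow> nat \<Rightarrow> nat \<Rightarrow> nat \<Rightarrow> nat" where
  "move a k l r = a(k := a k + r, l := a l - r)"

text \<open>Iterates \<open>card_two_cuts_shift\<close> until colour l is used up and no cut is
  left. The composition after r moves occurs with a k + r as the target of one move and with - (a l
  - r) as the source of the next, whence the coefficient.\<close>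

lemma card_two_cuts:
  assumes s: "s permutes {..<n}" and kl: "k < l" "l < n"
  shows "real (card (two_cuts n a k l s)) = - real (a l) * real (young_char n a s)
    + (\<Sum>r=1..a l. (real (a k) - real (a l) + 2 * real r) * real (young_char n (move a k l r) s))"
proof (induction "a l" arbitrary: a)
  case 0
  have "two_cuts n a k l s = {}"
  proof (rule ccontr)
    assume "two_cuts n a k l s \<noteq> {}"
    then obtain c j where c: "c \<in> colourings n a" "j < n" "c j = l" by (auto simp: two_cuts_def)
    hence "j \<in> {x. x < n \<and> c x = l}" by auto
    moreover have "card {x. x < n \<and> c x = l} = 0" using c 0 kl by (simp add: colourings_def)
    ultimately show False by (simp add: card_eq_0_iff) blast
  qed
  thus ?case using 0 by simp
next
  case (Suc m)
  let ?b = "move a k l 1"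
  have b: "?b = a(k := Suc (a k), l := a l - 1)" by (simp add: move_def)
  have bl: "?b l = m" "?b k = a k + 1" using Suc kl by (auto simp: move_def)
  have mv: "move ?b k l r = move a k l (Suc r)" for r using kl by (auto simp: move_def fun_eq_iff)
  have "a l \<noteq> 0" using Suc(2) by simp
  hence "card (two_cuts n a k l s) + a l * young_char n a s
      = card (two_cuts n ?b k l s) + ?b k * young_char n ?b s"
    using card_two_cuts_shift[OF s _ kl(2), of k a] kl unfolding b by simp
  from arg_cong[where f = real, OF this]
  have sh: "real (card (two_cuts n a k l s)) = real (card (two_cuts n ?b k l s))
      + (real (a k) + 1) * real (young_char n ?b s) - real (a l) * real (young_char n a s)"
    unfolding bl by (simp add: algebra_simps)
  have "(\<Sum>r=1..a l. (real (a k) - real (a l) + 2 * real r) * real (young_char n (move a k l r) s))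
    = (\<Sum>r=0..m. (real (a k) - real (a l) + 2 * real (Suc r)) * real (young_char n (move a k l (Suc r)) s))"
    using Suc(2)[symmetric] by (simp only: One_nat_def sum.shift_bounds_cl_Suc_ivl)
  also have "\<dots> = (real (a k) - real (a l) + 2) * real (young_char n ?b s)
    + (\<Sum>r=1..m. (real (a k) - real (a l) + 2 * real (Suc r)) * real (young_char n (move a k l (Suc r)) s))"
    by (subst sum.atLeast_Suc_atMost) auto
  also have "(\<Sum>r=1..m. (real (a k) - real (a l) + 2 * real (Suc r)) * real (young_char n (move a k l (Suc r)) s))
    = (\<Sum>r=1..m. (real (?b k) - real (?b l) + 2 * real r) * real (young_char n (move ?b k l r) s))"
    unfolding mv bl using Suc(2)[symmetric] by (intro sum.cong) auto
  finally show ?case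
    using sh Suc.hyps(1)[of ?b] bl Suc(2)[symmetric] by (simp add: algebra_simps)
qed

text \<open>A move can destroy the order of the parts; renaming colours sorts them again without
  changing the character.\<close>

lemma young_char_permute:
  assumes p: "p permutes {..<n}"
  shows "young_char n (a \<circ> p) s = young_char n a s"
proof -
  have pn: "p x < n \<longleftrightarrow> x < n" for x using permutes_in_image[OF p, of x] by simp
  have ipn: "inv p x < n \<longleftrightarrow> x < n" for x using permutes_in_image[OF permutes_inv[OF p], of x] by simp
  have pinv: "p (inv p j) = j" "inv p (p j) = j" for j using permutes_inverses[OF p] by auto
  have fix_n: "p n = n" "inv p n = n" using permutes_not_in[OF p] permutes_not_in[OF permutes_inv[OF p]] by auto
  have eq1: "p x = i \<longleftrightarrow> x = inv p i" for x i using pinv by metis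
  have eq2: "inv p x = i \<longleftrightarrow> x = p i" for x i using pinv by metis
  have F: "p \<circ> c \<in> fixed_colourings n a s" if "c \<in> fixed_colourings n (a \<circ> p) s" for c
    using that by (auto simp: fixed_colourings_def colourings_def fix_n pn ipn pinv eq1 comp_assoc)
  have G: "inv p \<circ> c \<in> fixed_colourings n (a \<circ> p) s" if "c \<in> fixed_colourings n a s" for c
    using that by (auto simp: fixed_colourings_def colourings_def fix_n pn ipn pinv eq2 comp_assoc)
  have "bij_betw (\<lambda>c. p \<circ> c) (fixed_colourings n (a \<circ> p) s) (fixed_colourings n a s)"
    by (rule bij_betw_byWitness[where f' = "\<lambda>c. inv p \<circ> c"])
       (use F G in \<open>auto simp: fun_eq_iff pinv\<close>)
  thus ?thesis unfolding young_char_def by (rule bij_betw_same_card)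
qed

lemma sort_composition:
  fixes a :: "nat \<Rightarrow> nat"
  assumes "\<And>i. i \<ge> n \<Longrightarrow> a i = 0"
  obtains p where "p permutes {..<n}" "antimono (a \<circ> p)"
proof -
  let ?xs = "map a [0..<n]" let ?ys = "rev (sort ?xs)"
  have "mset ?ys = mset ?xs" by simp
  then obtain p where p: "p permutes {..<length ?xs}" "permute_list p ?xs = ?ys"
    by (rule mset_eq_permutation)
  have p': "p permutes {..<n}" using p by simp
  have pn: "p x < n \<longleftrightarrow> x < n" for x using permutes_in_image[OF p', of x] by simp
  have nth: "?ys ! i = a (p i)" if "i < n" for i
    using that p pn[of i] by (subst p(2)[symmetric], subst permute_list_nth) auto
  have "sorted_wrt (\<ge>) ?ys" by (simp add: sorted_wrt_rev)
  hence srt: "a (p j) \<le> a (p i)" if "i < j" "j < n" for i j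
  proof -
    have "?ys ! j \<le> ?ys ! i"
      using \<open>sorted_wrt (\<ge>) ?ys\<close> that unfolding sorted_wrt_iff_nth_less by simp
    thus ?thesis using that nth[of i] nth[of j] by simp
  qed
  have "antimono (a \<circ> p)"
  proof (rule antimonoI)
    fix i j :: nat assume "i \<le> j"
    consider "i = j" | "j \<ge> n" | "i < j" "j < n" using \<open>i \<le> j\<close> by linarith
    thus "(a \<circ> p) j \<le> (a \<circ> p) i"
    proof cases
      case 2
      thus ?thesis using assms[of "p j"] pn[of j] by simp
    qed (use srt in auto)
  qed
  with p' show ?thesis by (rule that)
qed

section \<open>Triangularity for the sum of squares\<close>

definition square_sum :: "nat \<Rightarrow> (nat \<Rightarrow> nat) \<Rightarrow> nat" where
  "square_sum n a = (\<Sum>i<n. (a i)\<^sup>2)"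

text \<open>The strict inequality makes this the off-diagonal part of a triangular operator.
  Equality is asked on permutations only, because the expansion formulas hold only there.\<close>

definition char_span :: "nat \<Rightarrow> nat \<Rightarrow> ((nat \<Rightarrow> nat) \<Rightarrow> real) set" where
  "char_span n q = {f. \<exists>u. \<forall>s. s permutes {..<n} \<longrightarrow>
     f s = (\<Sum>b | b \<in> partitions_of n \<and> q < square_sum n b. u b * real (young_char n b s))}"

lemma char_span_zero: "(\<lambda>s. 0) \<in> char_span n q"
  unfolding char_span_def by (intro CollectI exI[of _ "\<lambda>_. 0"]) simp

lemma char_span_add:
  assumes "f \<in> char_span n q" "g \<in> char_span n q"
  shows "(\<lambda>s. f s + g s) \<in> char_span n q"
proof -
  obtain u where u: "\<forall>s. s permutes {..<n} \<longrightarrow> f s = (\<Sum>b | b \<in> partitions_of n \<and> q < square_sum n b. u b * real (young_char n b s))"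
    using assms(1) unfolding char_span_def by blast
  obtain v where v: "\<forall>s. s permutes {..<n} \<longrightarrow> g s = (\<Sum>b | b \<in> partitions_of n \<and> q < square_sum n b. v b * real (young_char n b s))"
    using assms(2) unfolding char_span_def by blast
  show ?thesis unfolding char_span_def
    using u v by (intro CollectI exI[of _ "\<lambda>b. u b + v b"]) (simp add: distrib_right sum.distrib)
qed

lemma char_span_scale:
  assumes "f \<in> char_span n q"
  shows "(\<lambda>s. r * f s) \<in> char_span n q"
proof -
  obtain u where u: "\<forall>s. s permutes {..<n} \<longrightarrow> f s = (\<Sum>b | b \<in> partitions_of n \<and> q < square_sum n b. u b * real (young_char n b s))"
    using assms(1) unfolding char_span_def by blast
  show ?thesis unfolding char_span_def
    using u by (intro CollectI exI[of _ "\<lambda>b. r * u b"]) (simp add: sum_distrib_left mult.assoc)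
qed

lemma char_span_sum:
  assumes "\<And>x. x \<in> A \<Longrightarrow> f x \<in> char_span n q"
  shows "(\<lambda>s. \<Sum>x\<in>A. f x s) \<in> char_span n q"
  using assms
  by (induction A rule: infinite_finite_induct) (auto intro: char_span_zero char_span_add)

lemma char_span_base:
  assumes "b \<in> partitions_of n" "q < square_sum n b"
  shows "(\<lambda>s. real (young_char n b s)) \<in> char_span n q"
proof -
  have "(\<Sum>c | c \<in> partitions_of n \<and> q < square_sum n c. (if c = b then 1 else 0) * real (young_char n c s))
      = real (young_char n b s)" for s
  proof -
    have "(\<Sum>c | c \<in> partitions_of n \<and> q < square_sum n c. (if c = b then 1 else 0) * real (young_char n c s))
      = (\<Sum>c | c \<in> partitions_of n \<and> q < square_sum n c. if c = b then real (young_char n c s) else 0)"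
      by (intro sum.cong) auto
    thus ?thesis using assms finite_partitions_of[of n] by simp
  qed
  thus ?thesis unfolding char_span_def
    by (intro CollectI exI[of _ "\<lambda>c. if c = b then 1 else 0"]) simp
qed

lemma char_span_cong:
  assumes "f \<in> char_span n q" "\<And>s. s permutes {..<n} \<Longrightarrow> g s = f s"
  shows "g \<in> char_span n q"
  using assms unfolding char_span_def by auto

text \<open>Terms are kept on both sides to avoid truncated subtraction. It is applied with g the
  identity and with g the square.\<close>

lemma sum_move:
  fixes g :: "nat \<Rightarrow> nat"
  assumes "k < l" "l < n"
  shows "(\<Sum>i<n. g (move a k l r i)) + g (a k) + g (a l) = (\<Sum>i<n. g (a i)) + g (a k + r) + g (a l - r)"
proof -
  let ?R = "{..<n} - {k} - {l}"
  have split: "(\<Sum>i<n. h i) = h k + (h l + (\<Sum>i\<in>?R. h i))" for h :: "nat \<Rightarrow> nat"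
    using assms by (subst sum.remove[of _ k], simp, simp, subst sum.remove[of _ l]) auto
  have "(\<Sum>i\<in>?R. g (move a k l r i)) = (\<Sum>i\<in>?R. g (a i))"
    by (intro sum.cong) (auto simp: move_def)
  moreover have "move a k l r k = a k + r" "move a k l r l = a l - r" using assms by (auto simp: move_def)
  ultimately show ?thesis
    using split[of "\<lambda>i. g (move a k l r i)"] split[of "\<lambda>i. g (a i)"] by simp
qed

text \<open>Row k is at least as long as row l, so moving r boxes raises the sum of squares by 2 r
  (a k - a l + r) > 0. Sorting afterwards changes neither that sum nor the character.\<close>

lemma young_char_move:
  assumes a: "a \<in> partitions_of n" and kl: "k < l" "l < n" and r: "1 \<le> r" "r \<le> a l"
  shows "(\<lambda>s. real (young_char n (move a k l r) s)) \<in> char_span n (square_sum n a)"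
proof -
  have mono: "antimono a" and a0: "\<And>i. i \<ge> n \<Longrightarrow> a i = 0" and sz: "(\<Sum>i<n. a i) = n"
    using a by (auto simp: partitions_of_eq)
  have m0: "move a k l r i = 0" if "i \<ge> n" for i using that a0 kl by (auto simp: move_def)
  then obtain p where p: "p permutes {..<n}" "antimono (move a k l r \<circ> p)"
    using sort_composition by blast
  have sump: "(\<Sum>i<n. g ((move a k l r \<circ> p) i)) = (\<Sum>i<n. g (move a k l r i))" for g :: "nat \<Rightarrow> nat"
    using sum.permute[OF p(1), of "\<lambda>i. g (move a k l r i)"] by (simp add: o_def)
  have "(\<Sum>i<n. (move a k l r \<circ> p) i) = n"
    using sump[of "\<lambda>x. x"] sum_move[OF kl, of "\<lambda>x. x" a r] sz r by simp
  moreover have "(move a k l r \<circ> p) i = 0" if "i \<ge> n" for i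
    using permutes_not_in[OF p(1), of i] that m0 by simp
  ultimately have mem: "move a k l r \<circ> p \<in> partitions_of n" using p by (simp add: partitions_of_eq)
  have "a l \<le> a k" using antimonoD[OF mono, of k l] kl by simp
  then obtain d where d: "a k = a l + d" using le_Suc_ex by blast
  obtain e where e: "a l = r + e" using r le_Suc_ex by blast
  have "(a k + r)\<^sup>2 + (a l - r)\<^sup>2 > (a k)\<^sup>2 + (a l)\<^sup>2"
    using r(1) unfolding d e by (simp add: power2_eq_square algebra_simps)
  hence "square_sum n a < square_sum n (move a k l r \<circ> p)"
    using sum_move[OF kl, of "\<lambda>x. x\<^sup>2" a r] sump[of "\<lambda>x. x\<^sup>2"] by (simp add: square_sum_def)
  from char_span_base[OF mem this] show ?thesis by (simp add: young_char_permute[OF p(1)])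
qed

text \<open>The term - a l of \<open>card_two_cuts\<close> occurs once for each k < l and adds up to
  - l a l. With the monochromatic pairs, a l (a l - 1) / 2 for each row, this is the total
  content.\<close>

lemma sum_transpositions_young_char_triangular:
  assumes a: "a \<in> partitions_of n"
  obtains g where "g \<in> char_span n (square_sum n a)"
    "\<And>s. s permutes {..<n} \<Longrightarrow> (\<Sum>tau\<in>transpositions n. real (young_char n a (tau \<circ> s)))
       = total_content a * real (young_char n a s) + g s"
proof -
  define R where "R k l s = (\<Sum>r=1..a l. (real (a k) - real (a l) + 2 * real r) * real (young_char n (move a k l r) s))" for k l s
  define g where "g s = (\<Sum>l<n. \<Sum>k<l. R k l s)" for s
  have "g \<in> char_span n (square_sum n a)" unfolding g_def R_def
    by (intro char_span_sum char_span_scale young_char_move) (use a in auto)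
  moreover have "(\<Sum>tau\<in>transpositions n. real (young_char n a (tau \<circ> s)))
       = total_content a * real (young_char n a s) + g s" if s: "s permutes {..<n}" for s
  proof -
    let ?y = "real (young_char n a s)"
    have "(\<Sum>l<n. \<Sum>k<l. real (card (two_cuts n a k l s))) = (\<Sum>l<n. \<Sum>k<l. - real (a l) * ?y + R k l s)"
      unfolding R_def by (intro sum.cong refl card_two_cuts[OF s]) auto
    also have "\<dots> = (\<Sum>l<n. - (real l * real (a l))) * ?y + g s"
      by (simp add: sum.distrib sum_subtractf sum_negf g_def sum_distrib_right mult.assoc)
    finally have "(\<Sum>tau\<in>transpositions n. real (young_char n a (tau \<circ> s)))
      = ((\<Sum>k<n. real (a k) * (real (a k) - 1)) / 2 + (\<Sum>l<n. - (real l * real (a l)))) * ?y + g s"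
      unfolding sum_transpositions_young_char by (simp only: distrib_right add.assoc)
    also have "(\<Sum>k<n. real (a k) * (real (a k) - 1)) / 2 + (\<Sum>l<n. - (real l * real (a l))) = total_content a"
      using partition_vanishes[OF a] unfolding total_content_eq[of n a, simplified]
      by (subst total_content_eq[of n a]) (auto simp: sum_divide_distrib sum.distrib[symmetric] field_simps intro!: sum.cong)
    finally show ?thesis .
  qed
  ultimately show ?thesis by (rule that)
qed

section \<open>The action of transpositions on class functions\<close>

definition transp_op :: "nat \<Rightarrow> ((nat \<Rightarrow> nat) \<Rightarrow> real) \<Rightarrow> (nat \<Rightarrow> nat) \<Rightarrow> real" where
  "transp_op n f s = (\<Sum>tau\<in>transpositions n. f (tau \<circ> s))"

lemma transp_op_cong:
  assumes "\<And>s. s permutes {..<n} \<Longrightarrow> f s = g s" "s permutes {..<n}"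
  shows "transp_op n f s = transp_op n g s"
  unfolding transp_op_def
  by (intro sum.cong refl assms(1) permutes_compose[OF assms(2)] transpositions_permutes)

lemma transp_op_sum: "transp_op n (\<lambda>s. \<Sum>x\<in>A. u x * f x s) s = (\<Sum>x\<in>A. u x * transp_op n (f x) s)"
  unfolding transp_op_def by (subst sum.swap) (simp add: sum_distrib_left)

lemma transp_op_add: "transp_op n (\<lambda>s. f s + g s) s = transp_op n f s + transp_op n g s"
  unfolding transp_op_def by (simp add: sum.distrib)

lemma transp_op_scale: "transp_op n (\<lambda>s. u * f s) s = u * transp_op n f s"
  unfolding transp_op_def by (simp add: sum_distrib_left)

lemma char_span_antimono:
  assumes "q \<le> r" "f \<in> char_span n r"
  shows "f \<in> char_span n q"
proof -
  obtain u where u: "\<And>s. s permutes {..<n} \<Longrightarrow> f s = (\<Sum>b | b \<in> partitions_of n \<and> r < square_sum n b. u b * real (young_char n b s))"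
    using assms(2) unfolding char_span_def by blast
  have "(\<lambda>s. \<Sum>b | b \<in> partitions_of n \<and> r < square_sum n b. u b * real (young_char n b s)) \<in> char_span n q"
    using assms(1) by (intro char_span_sum char_span_scale char_span_base) auto
  thus ?thesis by (rule char_span_cong) (rule u)
qed

lemma transp_op_char_span:
  assumes "f \<in> char_span n q"
  shows "transp_op n f \<in> char_span n q"
proof -
  let ?B = "{b. b \<in> partitions_of n \<and> q < square_sum n b}"
  obtain u where u: "\<And>s. s permutes {..<n} \<Longrightarrow> f s = (\<Sum>b\<in>?B. u b * real (young_char n b s))"
    using assms unfolding char_span_def by blast
  have "(\<lambda>s. \<Sum>b\<in>?B. u b * transp_op n (\<lambda>s. real (young_char n b s)) s) \<in> char_span n q"
  proof (intro char_span_sum char_span_scale)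
    fix b assume b: "b \<in> ?B"
    obtain g where g: "g \<in> char_span n (square_sum n b)" "\<And>s. s permutes {..<n} \<Longrightarrow>
        (\<Sum>tau\<in>transpositions n. real (young_char n b (tau \<circ> s))) = total_content b * real (young_char n b s) + g s"
      using sum_transpositions_young_char_triangular[of b n] b by auto
    have "(\<lambda>s. total_content b * real (young_char n b s) + g s) \<in> char_span n q"
      using b g(1) char_span_antimono[of q "square_sum n b" g n]
      by (intro char_span_add char_span_scale char_span_base) auto
    thus "transp_op n (\<lambda>s. real (young_char n b s)) \<in> char_span n q"
      by (rule char_span_cong) (simp add: transp_op_def g(2))
  qed
  thus ?thesis
  proof (rule char_span_cong)
    fix s assume s: "s permutes {..<n}"
    have "transp_op n f s = transp_op n (\<lambda>s. \<Sum>b\<in>?B. u b * real (young_char n b s)) s"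
      using u s by (rule transp_op_cong)
    thus "transp_op n f s = (\<Sum>b\<in>?B. u b * transp_op n (\<lambda>s. real (young_char n b s)) s)"
      by (simp add: transp_op_sum)
  qed
qed

lemma transp_op_power_young_char:
  assumes a: "a \<in> partitions_of n"
  shows "\<exists>g\<in>char_span n (square_sum n a). \<forall>s. s permutes {..<n} \<longrightarrow>
     (transp_op n ^^ k) (\<lambda>s. real (young_char n a s)) s = total_content a ^ k * real (young_char n a s) + g s"
proof (induction k)
  case 0
  thus ?case by (intro bexI[of _ "\<lambda>s. 0"]) (auto simp: char_span_zero)
next
  case (Suc k)
  then obtain g where g: "g \<in> char_span n (square_sum n a)" "\<And>s. s permutes {..<n} \<Longrightarrow>
     (transp_op n ^^ k) (\<lambda>s. real (young_char n a s)) s = total_content a ^ k * real (young_char n a s) + g s"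
    by blast
  obtain h where h: "h \<in> char_span n (square_sum n a)" "\<And>s. s permutes {..<n} \<Longrightarrow>
        (\<Sum>tau\<in>transpositions n. real (young_char n a (tau \<circ> s))) = total_content a * real (young_char n a s) + h s"
    using sum_transpositions_young_char_triangular[OF a] by blast
  show ?case
  proof (intro bexI[of _ "\<lambda>s. total_content a ^ k * h s + transp_op n g s"] allI impI)
    fix s assume s: "s permutes {..<n}"
    have "(transp_op n ^^ Suc k) (\<lambda>s. real (young_char n a s)) s
      = transp_op n (\<lambda>s. total_content a ^ k * real (young_char n a s) + g s) s"
      using transp_op_cong[OF g(2) s] by simp
    also have "\<dots> = total_content a ^ k * (total_content a * real (young_char n a s) + h s) + transp_op n g s"
      using h(2)[OF s] unfolding transp_op_add transp_op_scale by (simp add: transp_op_def)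
    finally show "(transp_op n ^^ Suc k) (\<lambda>s. real (young_char n a s)) s
      = total_content a ^ Suc k * real (young_char n a s) + (total_content a ^ k * h s + transp_op n g s)"
      by (simp add: algebra_simps)
  qed (intro char_span_add char_span_scale h(1) transp_op_char_span g(1))
qed

definition transp_words :: "nat \<Rightarrow> nat \<Rightarrow> (nat \<Rightarrow> nat) list set" where
  "transp_words n k = {ts. length ts = k \<and> set ts \<subseteq> transpositions n}"

lemma finite_transp_words: "finite (transp_words n k)"
  using finite_lists_length_eq[OF finite_transpositions[of n], of k]
  by (simp add: transp_words_def conj_commute)

lemma foldr_comp_permutes:
  assumes "set ts \<subseteq> transpositions n"
  shows "foldr (\<circ>) ts id permutes {..<n}"
  using assms by (induction ts) (auto intro: permutes_compose transpositions_permutes permutes_id)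

text \<open>Transpositions are involutions, so composing them one after the other to the left of s
  gives the inverse of the word. In this shape the relation of a covering appears in
  \<open>labelled_coverings_eq\<close>.\<close>

lemma transp_op_power:
  "(transp_op n ^^ k) f s = (\<Sum>ts\<in>transp_words n k. f (inv (foldr (\<circ>) ts id) \<circ> s))"
proof (induction k arbitrary: s)
  case 0
  have "transp_words n 0 = {[]}" by (auto simp: transp_words_def)
  thus ?case by simp
next
  case (Suc k)
  have bij: "bij_betw (\<lambda>(tau, ts). tau # ts) (transpositions n \<times> transp_words n k) (transp_words n (Suc k))"
    by (rule bij_betw_byWitness[where f' = "\<lambda>ts. (hd ts, tl ts)"])
       (auto simp: transp_words_def length_Suc_conv)
  have "(transp_op n ^^ Suc k) f s = transp_op n ((transp_op n ^^ k) f) s" by simp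
  also have "\<dots> = (\<Sum>tau\<in>transpositions n. (transp_op n ^^ k) f (tau \<circ> s))" by (simp only: transp_op_def)
  also have "\<dots> = (\<Sum>tau\<in>transpositions n. \<Sum>ts\<in>transp_words n k. f (inv (foldr (\<circ>) ts id) \<circ> (tau \<circ> s)))"
    by (simp only: Suc)
  also have "\<dots> = (\<Sum>(tau, ts)\<in>transpositions n \<times> transp_words n k. f (inv (foldr (\<circ>) ts id) \<circ> (tau \<circ> s)))"
    by (rule sum.cartesian_product)
  also have "\<dots> = (\<Sum>x\<in>transpositions n \<times> transp_words n k.
      f (inv (foldr (\<circ>) ((\<lambda>(tau, ts). tau # ts) x) id) \<circ> s))"
  proof (intro sum.cong refl)
    fix x assume "x \<in> transpositions n \<times> transp_words n k"
    then obtain tau ts where x: "x = (tau, ts)" and *: "tau \<in> transpositions n" "ts \<in> transp_words n k" by blast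
    have "bij tau" using transpositions_permutes[OF *(1)] by (rule permutes_bij)
    moreover have "bij (foldr (\<circ>) ts id)"
      using foldr_comp_permutes[of ts n] * by (auto simp: transp_words_def intro: permutes_bij)
    ultimately have "inv (tau \<circ> foldr (\<circ>) ts id) = inv (foldr (\<circ>) ts id) \<circ> inv tau"
      by (rule o_inv_distrib)
    moreover have "inv tau = tau" using * by (auto simp: transpositions_def)
    ultimately show "(case x of (tau, ts) \<Rightarrow> f (inv (foldr (\<circ>) ts id) \<circ> (tau \<circ> s)))
        = f (inv (foldr (\<circ>) ((\<lambda>(tau, ts). tau # ts) x) id) \<circ> s)"
      unfolding x by (simp add: comp_assoc)
  qed
  also have "\<dots> = (\<Sum>ts\<in>transp_words n (Suc k). f (inv (foldr (\<circ>) ts id) \<circ> s))"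
    by (rule sum.reindex_bij_betw[OF bij])
  finally show ?case .
qed

text \<open>As a function of x, the indicator of the conjugacy class of s times the order of the
  centralizer of s: up to the factor n! a reproducing kernel for class functions.\<close>

definition conj_count :: "nat \<Rightarrow> (nat \<Rightarrow> nat) \<Rightarrow> (nat \<Rightarrow> nat) \<Rightarrow> real" where
  "conj_count n s x = real (card {g. g permutes {..<n} \<and> g \<circ> s \<circ> inv g = x})"

lemma labelled_coverings_eq:
  "labelled_coverings n k = {(s1, s2, ts). s1 permutes {..<n} \<and> s2 permutes {..<n} \<and> ts \<in> transp_words n k \<and>
     s1 \<circ> s2 \<circ> inv s1 = inv (foldr (\<circ>) ts id) \<circ> s2}"
proof -
  have "s1 \<circ> s2 \<circ> inv s1 \<circ> inv s2 \<circ> foldr (\<circ>) ts id = id \<longleftrightarrow> s1 \<circ> s2 \<circ> inv s1 = inv (foldr (\<circ>) ts id) \<circ> s2"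
    if "s1 permutes {..<n}" "s2 permutes {..<n}" "ts \<in> transp_words n k" for s1 s2 :: "nat \<Rightarrow> nat" and ts
  proof -
    let ?f = "foldr (\<circ>) ts id" and ?x = "s1 \<circ> s2 \<circ> inv s1"
    have f: "?f permutes {..<n}" using that foldr_comp_permutes by (auto simp: transp_words_def)
    note [simp] = permutes_inv_o[OF f] permutes_inv_o[OF that(2)]
    show ?thesis
    proof
      assume *: "?x \<circ> inv s2 \<circ> ?f = id"
      have "?x \<circ> inv s2 \<circ> (?f \<circ> inv ?f) \<circ> s2 = (?x \<circ> inv s2 \<circ> ?f) \<circ> inv ?f \<circ> s2" by (simp only: comp_assoc)
      also have "\<dots> = inv ?f \<circ> s2" unfolding * by simp
      finally show "?x = inv ?f \<circ> s2" by (simp add: comp_assoc)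
    next
      assume "?x = inv ?f \<circ> s2"
      hence "?x \<circ> inv s2 \<circ> ?f = inv ?f \<circ> (s2 \<circ> inv s2) \<circ> ?f" by (simp only: comp_assoc)
      thus "?x \<circ> inv s2 \<circ> ?f = id" by simp
    qed
  qed
  moreover have "(\<forall>s\<in>set ts. \<exists>i<n. \<exists>j<n. i \<noteq> j \<and> s = Transposition.transpose i j) \<longleftrightarrow> set ts \<subseteq> transpositions n" for ts
    by (auto simp: transpositions_def)
  ultimately show ?thesis
    unfolding labelled_coverings_def transp_words_def by (intro Collect_cong) (auto split: prod.splits)
qed

text \<open>For a fixed second permutation s and a fixed word, the first permutation ranges over
  those that conjugate s into the inverse word times s. Summing over words applies the operator k
  times to \<open>conj_count n s\<close>; evaluating at the same s makes the total a trace.\<close>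

lemma card_labelled_coverings:
  "finite (labelled_coverings n k)"
  "real (card (labelled_coverings n k)) = (\<Sum>s | s permutes {..<n}. (transp_op n ^^ k) (conj_count n s) s)"
proof -
  let ?P = "{s. s permutes {..<n}}"
  define Q where "Q s ts g \<longleftrightarrow> g \<circ> s \<circ> inv g = inv (foldr (\<circ>) ts id) \<circ> s" for s g :: "nat \<Rightarrow> nat" and ts
  let ?S = "SIGMA s:?P. SIGMA ts:transp_words n k. {g. g permutes {..<n} \<and> Q s ts g}"
  have fin: "finite ?P" by (rule finite_permutations) simp
  have fin': "finite {g. g permutes {..<n} \<and> R g}" for R using fin by (rule rev_finite_subset) auto
  have eq: "labelled_coverings n k = {(g, s, ts). g permutes {..<n} \<and> s permutes {..<n} \<and> ts \<in> transp_words n k \<and> Q s ts g}"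
    unfolding labelled_coverings_eq Q_def ..
  have bij: "bij_betw (\<lambda>(s, ts, g). (g, s, ts)) ?S (labelled_coverings n k)"
    unfolding eq by (rule bij_betw_byWitness[where f' = "\<lambda>(g, s, ts). (s, ts, g)"]) auto
  have "finite ?S" by (intro finite_SigmaI fin fin' finite_transp_words)
  thus "finite (labelled_coverings n k)" using bij_betw_finite[OF bij] by simp
  have "card (labelled_coverings n k) = card ?S" using bij_betw_same_card[OF bij] by simp
  also have "\<dots> = (\<Sum>s\<in>?P. card (SIGMA ts:transp_words n k. {g. g permutes {..<n} \<and> Q s ts g}))"
    by (intro card_SigmaI fin ballI finite_SigmaI fin' finite_transp_words)
  also have "\<dots> = (\<Sum>s\<in>?P. \<Sum>ts\<in>transp_words n k. card {g. g permutes {..<n} \<and> Q s ts g})"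
    by (intro sum.cong refl card_SigmaI finite_transp_words ballI fin')
  finally have "card (labelled_coverings n k)
    = (\<Sum>s\<in>?P. \<Sum>ts\<in>transp_words n k. card {g. g permutes {..<n} \<and> Q s ts g})" .
  from arg_cong[where f = real, OF this]
  show "real (card (labelled_coverings n k)) = (\<Sum>s | s permutes {..<n}. (transp_op n ^^ k) (conj_count n s) s)"
    unfolding transp_op_power conj_count_def of_nat_sum Q_def .
qed

section \<open>Colourings by cycles and conjugacy\<close>

text \<open>The colour names the cycle, so the sizes of the colour classes are the cycle
  type.\<close>

definition cycle_colouring :: "nat \<Rightarrow> (nat \<Rightarrow> nat) \<Rightarrow> (nat \<Rightarrow> nat) \<Rightarrow> bool" where
  "cycle_colouring n s c \<longleftrightarrow> s permutes {..<n} \<and> (\<forall>x<n. \<forall>y<n. c x = c y \<longleftrightarrow> (\<exists>k. (s ^^ k) x = y))"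

text \<open>The cyclic shift of \<open>{0..<card A}\<close>, transported along an enumeration of
  A.\<close>

lemma ex_transitive_permutation:
  assumes "finite A"
  obtains f where "f permutes A" "\<And>x y. x \<in> A \<Longrightarrow> y \<in> A \<Longrightarrow> \<exists>k. (f ^^ k) x = y"
proof -
  let ?m = "card A"
  obtain h where h: "bij_betw h {0..<?m} A" using ex_bij_betw_nat_finite[OF assms] by blast
  define h' where "h' = inv_into {0..<?m} h"
  have h'h: "h' (h i) = i" if "i < ?m" for i
    using h that by (simp add: h'_def bij_betw_inv_into_left)
  have hh': "h (h' x) = x" "h' x < ?m" if "x \<in> A" for x
    using h that bij_betwE[OF bij_betw_inv_into[OF h]]
    by (auto simp: h'_def bij_betw_inv_into_right)
  have hA: "h i \<in> A" if "i < ?m" for i using h that by (auto simp: bij_betw_def)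
  define f where "f x = (if x \<in> A then h (Suc (h' x) mod ?m) else x)" for x
  have fh: "f (h i) = h (Suc i mod ?m)" if "i < ?m" for i using that hA by (simp add: f_def h'h)
  have pow: "(f ^^ k) (h i) = h ((i + k) mod ?m)" if "i < ?m" for i k
  proof (induction k)
    case 0
    thus ?case using that by simp
  next
    case (Suc k)
    have "(i + k) mod ?m < ?m" using that by simp
    thus ?case using Suc fh by (simp add: mod_Suc_eq)
  qed
  have tr: "\<exists>k. (f ^^ k) x = y" if "x \<in> A" "y \<in> A" for x y
  proof (intro exI)
    \<comment> \<open>Adding the full length keeps the difference of positions from being
      truncated.\<close>
    have "(f ^^ (h' y + ?m - h' x)) (h (h' x)) = h (h' y)"
      using hh'[OF that(1)] hh'[OF that(2)] by (subst pow) auto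
    thus "(f ^^ (h' y + ?m - h' x)) x = y" using hh' that by simp
  qed
  have into: "f ` A \<subseteq> A"
  proof
    fix y assume "y \<in> f ` A"
    then obtain x where "x \<in> A" "y = f x" by blast
    thus "y \<in> A" using hh'[of x] by (auto simp: f_def intro!: hA mod_less_divisor)
  qed
  have onto: "A \<subseteq> f ` A"
  proof
    fix y assume y: "y \<in> A"
    have m: "?m > 0" using hh'[OF y] by simp
    have "(h' y + (?m - 1)) mod ?m < ?m" using m by simp
    moreover have "Suc ((h' y + (?m - 1)) mod ?m) mod ?m = h' y"
      using m hh'(2)[OF y] by (simp add: mod_Suc_eq)
    ultimately have "f (h ((h' y + (?m - 1)) mod ?m)) = y" "h ((h' y + (?m - 1)) mod ?m) \<in> A"
      using hA hh'(1)[OF y] by (auto simp: fh)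
    thus "y \<in> f ` A" by force
  qed
  have "bij_betw f A A"
    using into onto assms by (auto simp: bij_betw_def intro: eq_card_imp_inj_on)
  hence "f permutes A" by (rule bij_imp_permutes) (auto simp: f_def)
  thus ?thesis using tr by (rule that)
qed

lemma ex_cycle_colouring_permutation: "\<exists>s. cycle_colouring n s c"
proof -
  define A where "A i = {x. x < n \<and> c x = i}" for i :: nat
  have "\<forall>i. \<exists>f. f permutes A i \<and> (\<forall>x\<in>A i. \<forall>y\<in>A i. \<exists>k. (f ^^ k) x = y)"
  proof
    fix i
    have "finite (A i)" by (simp add: A_def)
    then obtain f where "f permutes A i" "\<And>x y. x \<in> A i \<Longrightarrow> y \<in> A i \<Longrightarrow> \<exists>k. (f ^^ k) x = y"
      by (rule ex_transitive_permutation) blast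
    thus "\<exists>f. f permutes A i \<and> (\<forall>x\<in>A i. \<forall>y\<in>A i. \<exists>k. (f ^^ k) x = y)" by blast
  qed
  then obtain f where f: "\<And>i. f i permutes A i" "\<And>i x y. x \<in> A i \<Longrightarrow> y \<in> A i \<Longrightarrow> \<exists>k. (f i ^^ k) x = y"
    by metis
  define s where "s x = (if x < n then f (c x) x else x)" for x
  have memA: "f i x \<in> A i" if "x \<in> A i" for i x using that permutes_in_image[OF f(1)] by simp
  have sA: "s x \<in> A i" "s x = f i x" if "x \<in> A i" for i x
    using that memA[OF that] by (auto simp: s_def A_def)
  have pow: "(s ^^ k) x = (f i ^^ k) x \<and> (s ^^ k) x \<in> A i" if "x \<in> A i" for i x k
    using that by (induction k) (auto simp: sA memA)
  have inA: "x \<in> A (c x)" if "x < n" for x using that by (simp add: A_def)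
  have "inj_on s {..<n}"
  proof (rule inj_onI)
    fix x y assume xy: "x \<in> {..<n}" "y \<in> {..<n}" "s x = s y"
    hence "c x = c y" using sA(1)[OF inA[of x]] sA(1)[OF inA[of y]] by (auto simp: A_def)
    hence "f (c x) x = f (c x) y" using xy by (simp add: s_def)
    thus "x = y" using permutes_inj[OF f(1)] by (simp add: inj_eq)
  qed
  moreover have "s ` {..<n} \<subseteq> {..<n}" using sA(1)[OF inA] by (auto simp: A_def)
  ultimately have "bij_betw s {..<n} {..<n}" by (simp add: bij_betw_def endo_inj_surj)
  hence "s permutes {..<n}" by (rule bij_imp_permutes) (auto simp: s_def)
  moreover have "c x = c y \<longleftrightarrow> (\<exists>k. (s ^^ k) x = y)" if xy: "x < n" "y < n" for x y
  proof
    assume "c x = c y"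
    then obtain k where "(f (c x) ^^ k) x = y" using f(2)[of x "c x" y] xy by (auto simp: A_def)
    thus "\<exists>k. (s ^^ k) x = y" using pow[OF inA[OF xy(1)]] by metis
  next
    assume "\<exists>k. (s ^^ k) x = y"
    then obtain k where "(s ^^ k) x = y" by blast
    moreover have "(s ^^ k) x \<in> A (c x)" using pow[OF inA[OF xy(1)], of k] by blast
    ultimately have "y \<in> A (c x)" by simp
    thus "c x = c y" by (simp add: A_def)
  qed
  ultimately show ?thesis by (auto simp: cycle_colouring_def)
qed

text \<open>The orbit of r is its colour class, so m is the period of s at r.\<close>

lemma funpow_eq_iff_mod:
  assumes "cycle_colouring n s c" "r < n"
  defines "m \<equiv> card {x. x < n \<and> c x = c r}"
  shows "(s ^^ k) r = (s ^^ l) r \<longleftrightarrow> k mod m = l mod m"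
proof -
  have s: "s permutes {..<n}" and cyc: "\<And>x y. x < n \<Longrightarrow> y < n \<Longrightarrow> c x = c y \<longleftrightarrow> (\<exists>k. (s ^^ k) x = y)"
    using assms(1) by (auto simp: cycle_colouring_def)
  have perm: "permutation s" using s by (auto simp: permutation_permutes)
  have self: "r \<in> orbit s r" using perm by (rule permutation_self_in_orbit)
  have pn: "(s ^^ k) r < n" for k using permutes_in_image[OF permutes_funpow[OF s], of k r] assms(2) by simp
  have orb: "orbit s r = {x. x < n \<and> c x = c r}"
  proof (intro equalityI subsetI)
    fix x assume "x \<in> orbit s r"
    then obtain k where "x = (s ^^ k) r" unfolding orbit_altdef by blast
    hence "x < n" "c r = c x" using pn[of k] cyc[of r x] assms(2) by blast+
    thus "x \<in> {x. x < n \<and> c x = c r}" by simp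
  next
    fix x assume "x \<in> {x. x < n \<and> c x = c r}"
    hence "x < n" "c r = c x" by simp_all
    then obtain k where "x = (s ^^ k) r" using cyc[of r x] assms(2) by blast
    thus "x \<in> orbit s r" using orbit_altdef_self_in[OF self] by blast
  qed
  let ?d = "funpow_dist1 s r r"
  have "card (orbit s r) = card {0..<?d}"
    unfolding orbit_conv_funpow_dist1[OF self] by (rule card_image) (rule inj_on_funpow_dist1[OF self])
  hence d: "?d = m" using orb by (simp add: m_def)
  have "(s ^^ ?d) r = r" using funpow_dist1_prop[OF self] .
  hence md: "(s ^^ (k mod m)) r = (s ^^ k) r" for k unfolding d by (rule funpow_mod_eq)
  have mpos: "m > 0" using d by simp
  have "inj_on (\<lambda>n. (s ^^ n) r) {0..<m}" using inj_on_funpow_dist1[OF self] unfolding d .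
  hence "(s ^^ (k mod m)) r = (s ^^ (l mod m)) r \<longleftrightarrow> k mod m = l mod m"
    by (rule inj_on_eq_iff) (use mpos in simp_all)
  thus ?thesis by (simp only: md)
qed

text \<open>After choosing base points in cycles of equal colour, the point reached in d steps of s
  goes to the point reached in d steps of s'. Equal colour sizes are equal periods, so the choice of
  d does not matter.\<close>

lemma conjugate_if_same_colour_sizes:
  assumes s: "cycle_colouring n s c" and s': "cycle_colouring n s' c'"
    and c: "c \<in> colourings n a" and c': "c' \<in> colourings n a"
  shows "\<exists>g. g permutes {..<n} \<and> g \<circ> s = s' \<circ> g"
proof -
  have sp: "s permutes {..<n}" "s' permutes {..<n}" using s s' by (auto simp: cycle_colouring_def)
  have cyc: "c x = c y \<longleftrightarrow> (\<exists>k. (s ^^ k) x = y)" if "x < n" "y < n" for x y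
    using s that by (simp add: cycle_colouring_def)
  have cyc': "c' x = c' y \<longleftrightarrow> (\<exists>k. (s' ^^ k) x = y)" if "x < n" "y < n" for x y
    using s' that by (simp add: cycle_colouring_def)
  have cn: "c x < n" if "x < n" for x using c that by (auto simp: colourings_def)
  have sizes: "card {x. x < n \<and> c x = i} = a i" "card {x. x < n \<and> c' x = i} = a i" if "i < n" for i
    using c c' that by (auto simp: colourings_def)
  define r where "r i = (SOME x. x < n \<and> c x = i)" for i
  define r' where "r' i = (SOME x. x < n \<and> c' x = i)" for i
  have r: "r (c x) < n \<and> c (r (c x)) = c x" if "x < n" for x
    unfolding r_def by (rule someI[of _ x]) (use that in auto)
  have r': "r' (c x) < n \<and> c' (r' (c x)) = c x" if "x < n" for x
  proof -
    have "x \<in> {y. y < n \<and> c y = c x}" using that by simp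
    hence "card {y. y < n \<and> c y = c x} > 0" by (auto simp: card_gt_0_iff)
    hence "card {y. y < n \<and> c' y = c x} > 0" using sizes cn[OF that] by simp
    then obtain y where "y < n \<and> c' y = c x" by (auto simp: card_gt_0_iff)
    thus ?thesis unfolding r'_def by (rule someI)
  qed
  have ex: "\<exists>k. (s ^^ k) (r (c x)) = x" if "x < n" for x
    using cyc[OF conjunct1[OF r[OF that]] that] r[OF that] by blast
  define d where "d x = (SOME k. (s ^^ k) (r (c x)) = x)" for x
  have d: "(s ^^ d x) (r (c x)) = x" if "x < n" for x
    unfolding d_def using ex[OF that] by (rule someI_ex)
  define g where "g x = (if x < n then (s' ^^ d x) (r' (c x)) else x)" for x
  have cpow: "c ((s ^^ k) x) = c x \<and> (s ^^ k) x < n" if "x < n" for x k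
  proof -
    have "(s ^^ k) x < n" using permutes_in_image[OF permutes_funpow[OF sp(1)], of k x] that by simp
    moreover from this have "c x = c ((s ^^ k) x)" using cyc[OF that] by blast
    ultimately show ?thesis by simp
  qed
  have cpow': "c' ((s' ^^ k) x) = c' x \<and> (s' ^^ k) x < n" if "x < n" for x k
  proof -
    have "(s' ^^ k) x < n" using permutes_in_image[OF permutes_funpow[OF sp(2)], of k x] that by simp
    moreover from this have "c' x = c' ((s' ^^ k) x)" using cyc'[OF that] by blast
    ultimately show ?thesis by simp
  qed
  have same: "(s ^^ k) (r (c x)) = (s ^^ l) (r (c x)) \<longleftrightarrow> (s' ^^ k) (r' (c x)) = (s' ^^ l) (r' (c x))"
    if "x < n" for x k l
    using funpow_eq_iff_mod[OF s conjunct1[OF r[OF that]]] funpow_eq_iff_mod[OF s' conjunct1[OF r'[OF that]]]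
      r[OF that] r'[OF that] sizes cn[OF that] by simp
  have gn: "g x < n \<and> c' (g x) = c x" if "x < n" for x
    using cpow'[of "r' (c x)" "d x"] r'[OF that] that by (simp add: g_def)
  have "inj_on g {..<n}"
  proof (rule inj_onI)
    fix x y assume "x \<in> {..<n}" "y \<in> {..<n}" and g: "g x = g y"
    hence xy: "x < n" "y < n" by simp_all
    have cxy: "c y = c x" using gn[OF xy(1)] gn[OF xy(2)] unfolding g by simp
    have "(s' ^^ d x) (r' (c x)) = (s' ^^ d y) (r' (c x))" using g xy unfolding g_def cxy by simp
    hence "(s ^^ d x) (r (c x)) = (s ^^ d y) (r (c x))" using same[OF xy(1)] by blast
    thus "x = y" using d[OF xy(1)] d[OF xy(2)] unfolding cxy by argo
  qed
  moreover have "g ` {..<n} \<subseteq> {..<n}" using gn by auto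
  ultimately have "bij_betw g {..<n} {..<n}" by (simp add: bij_betw_def endo_inj_surj)
  hence "g permutes {..<n}" by (rule bij_imp_permutes) (auto simp: g_def)
  moreover have "g (s x) = s' (g x)" for x
  proof (cases "x < n")
    case True
    have sx: "s x < n" "c (s x) = c x" using cpow[OF True, of 1] by auto
    have "(s ^^ d (s x)) (r (c x)) = (s ^^ Suc (d x)) (r (c x))" using d[OF sx(1)] d[OF True] sx by simp
    hence "(s' ^^ d (s x)) (r' (c x)) = (s' ^^ Suc (d x)) (r' (c x))" using same[OF True] by blast
    thus ?thesis using True sx by (simp add: g_def)
  next
    case False
    thus ?thesis using permutes_not_in[OF sp(1), of x] permutes_not_in[OF sp(2), of x] by (simp add: g_def)
  qed
  ultimately show ?thesis by (intro exI[of _ g]) (auto simp: fun_eq_iff)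
qed

lemma ex_colouring:
  assumes "(\<Sum>i<n. a i) = n"
  shows "\<exists>c. c \<in> colourings n a"
proof -
  define xs where "xs = concat (map (\<lambda>i. replicate (a i) i) [0..<n])"
  have "length xs = (\<Sum>i\<leftarrow>[0..<n]. a i)" unfolding xs_def length_concat map_map
    by (rule arg_cong[where f = sum_list], rule map_cong) auto
  hence len: "length xs = n" using assms
    unfolding interv_sum_list_conv_sum_set_nat set_upt atLeast0LessThan by simp
  have setxs: "set xs \<subseteq> {..<n}" unfolding xs_def by auto
  define c where "c x = (if x < n then xs ! x else n)" for x
  have cin: "c x = xs ! x" if "x < n" for x using that by (simp add: c_def)
  have cout: "c x = n" if "x \<ge> n" for x using that by (simp add: c_def)
  have "card {x. x < n \<and> c x = i} = a i" if "i < n" for i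
  proof -
    have "{x. x < n \<and> c x = i} = {x. x < length xs \<and> xs ! x = i}"
      unfolding len using cin by (intro Collect_cong conj_cong refl) simp
    hence "card {x. x < n \<and> c x = i} = length (filter (\<lambda>y. y = i) xs)"
      by (simp only: length_filter_conv_card)
    also have "\<dots> = (\<Sum>j\<leftarrow>[0..<n]. if j = i then a i else 0)"
      unfolding xs_def filter_concat length_concat map_map
      by (rule arg_cong[where f = sum_list], rule map_cong) (auto simp: filter_replicate)
    also have "\<dots> = (\<Sum>j<n. if j = i then a i else 0)"
      unfolding interv_sum_list_conv_sum_set_nat set_upt atLeast0LessThan ..
    also have "\<dots> = a i" using that by simp
    finally show ?thesis .
  qed
  moreover have "c x < n" if "x < n" for x
  proof -
    have "xs ! x \<in> set xs" using that len by simp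
    thus ?thesis using setxs cin[OF that] by auto
  qed
  ultimately show ?thesis using cout unfolding colourings_def by blast
qed

text \<open>Colouring each point by the least element of its cycle gives the cycle type as a
  composition. Renaming the colours by a sorting permutation turns it into a partition.\<close>

lemma ex_cycle_partition:
  assumes s: "s permutes {..<n}"
  shows "\<exists>a\<in>partitions_of n. \<exists>c\<in>colourings n a. cycle_colouring n s c"
proof -
  have pn: "(s ^^ k) x < n \<longleftrightarrow> x < n" for k x using permutes_in_image[OF permutes_funpow[OF s], of k x] by simp
  have perm: "permutation s" using s by (auto simp: permutation_permutes)
  have fin: "finite (orbit s x)" for x by (rule finite_orbit[OF permutation_self_in_orbit[OF perm]])
  have self: "x \<in> orbit s x" for x by (rule permutation_self_in_orbit[OF perm])
  have orb: "y \<in> orbit s x \<longleftrightarrow> (\<exists>k. (s ^^ k) x = y)" for x y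
    unfolding orbit_altdef_permutation[OF perm] by auto
  define c0 where "c0 x = (if x < n then Min (orbit s x) else n)" for x
  have c0_mem: "c0 x \<in> orbit s x" if "x < n" for x
    using Min_in[OF fin] self[of x] that by (auto simp: c0_def)
  have c0n: "c0 x < n" if "x < n" for x
  proof -
    have "c0 x \<in> orbit s x" using that by (rule c0_mem)
    then obtain k where "(s ^^ k) x = c0 x" unfolding orb by blast
    thus ?thesis using pn[of k x] \<open>x < n\<close> by simp
  qed
  have c0_eq: "c0 x = c0 y \<longleftrightarrow> (\<exists>k. (s ^^ k) x = y)" if xy: "x < n" "y < n" for x y
  proof -
    have "c0 x = c0 y \<longleftrightarrow> y \<in> orbit s x"
    proof
      assume *: "c0 x = c0 y"
      have "orbit s (c0 x) = orbit s x" "orbit s (c0 y) = orbit s y"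
        using c0_mem xy orbit_cyclic_eq3[OF cyclic_on_orbit[OF s finite_lessThan]] by blast+
      thus "y \<in> orbit s x" using * self[of y] by simp
    next
      assume "y \<in> orbit s x"
      hence "orbit s y = orbit s x" by (rule orbit_cyclic_eq3[OF cyclic_on_orbit[OF s finite_lessThan]])
      thus "c0 x = c0 y" using xy by (simp add: c0_def)
    qed
    thus ?thesis by (simp add: orb)
  qed
  define a where "a i = (if i < n then card {x. x < n \<and> c0 x = i} else 0)" for i
  obtain p where p: "p permutes {..<n}" "antimono (a \<circ> p)"
    using sort_composition[of n a] by (auto simp: a_def)
  have ip: "inv p permutes {..<n}" using p(1) by (rule permutes_inv)
  have pnn: "p x < n \<longleftrightarrow> x < n" for x using permutes_in_image[OF p(1), of x] by simp
  have ipn: "inv p x < n \<longleftrightarrow> x < n" for x using permutes_in_image[OF ip, of x] by simp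
  have pinv: "inv p y = i \<longleftrightarrow> y = p i" for y i using permutes_inverses[OF p(1)] by metis
  have a0: "a (p i) = 0" if "i \<ge> n" for i using that pnn[of i] by (simp add: a_def)
  have a_in: "a i = card {x. x < n \<and> c0 x = i}" if "i < n" for i using that by (simp add: a_def)
  have c0_out: "c0 x = n" if "x \<ge> n" for x using that by (simp add: c0_def)
  have ip_n: "inv p n = n" using permutes_not_in[OF ip, of n] by simp
  have "(\<Sum>i<n. (a \<circ> p) i) = (\<Sum>i<n. a i)" using sum.permute[OF p(1), of a] by simp
  also have "\<dots> = (\<Sum>i<n. card {x\<in>{..<n}. c0 x = i})" by (intro sum.cong refl) (simp add: a_in)
  also have "\<dots> = (\<Sum>i<n. \<Sum>x\<in>{x\<in>{..<n}. c0 x = i}. 1)" by simp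
  also have "\<dots> = (\<Sum>x<n. 1)"
  proof (rule sum.group)
    show "c0 ` {..<n} \<subseteq> {..<n}" unfolding image_subset_iff using c0n by (simp only: lessThan_iff) blast
  qed simp_all
  finally have "(\<Sum>i<n. (a \<circ> p) i) = n" by simp
  hence "a \<circ> p \<in> partitions_of n" using p(2) a0 by (simp add: partitions_of_eq)
  moreover have "inv p \<circ> c0 \<in> colourings n (a \<circ> p)"
  proof -
    have "card {x. x < n \<and> (inv p \<circ> c0) x = i} = (a \<circ> p) i" if "i < n" for i
      using that by (simp add: pinv a_in pnn)
    thus ?thesis using c0n by (simp add: colourings_def ipn ip_n c0_out)
  qed
  moreover have "cycle_colouring n s (inv p \<circ> c0)"
    using s c0_eq permutes_inj[OF ip] by (auto simp: cycle_colouring_def inj_eq)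
  ultimately show ?thesis by blast
qed

section \<open>The trace on class functions\<close>

definition num_parts :: "nat \<Rightarrow> (nat \<Rightarrow> nat) \<Rightarrow> nat" where
  "num_parts n b = card {i. i < n \<and> b i \<noteq> 0}"

lemma num_parts_le: "num_parts n b \<le> n"
proof -
  have "num_parts n b \<le> card {..<n}" unfolding num_parts_def by (rule card_mono) auto
  thus ?thesis by simp
qed

text \<open>A decreasing sequence is determined by its conjugate, the sizes of the superlevel sets.
  If a i < b i, then at level b i the set of b contains the first i + 1 indices, that of a at most
  the first i.\<close>

lemma antimono_less_superlevel:
  fixes a b :: "nat \<Rightarrow> nat"
  assumes "antimono a" "antimono b" "finite {j. b j \<noteq> 0}"
    and "\<And>v. v \<ge> 1 \<Longrightarrow> card {j. v \<le> a j} = card {j. v \<le> b j}"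
  shows "b i \<le> a i"
proof (rule ccontr)
  assume "\<not> b i \<le> a i"
  hence less: "a i < b i" by simp
  have fin: "finite {j. b i \<le> b j}"
    using less by (intro finite_subset[OF _ assms(3)]) auto
  have "{..i} \<subseteq> {j. b i \<le> b j}" using antimonoD[OF assms(2)] by auto
  hence "card {..i} \<le> card {j. b i \<le> b j}" by (rule card_mono[OF fin])
  moreover have "{j. b i \<le> a j} \<subseteq> {..<i}"
  proof
    fix j assume "j \<in> {j. b i \<le> a j}"
    hence "a i < a j" using less by simp
    thus "j \<in> {..<i}" using antimonoD[OF assms(1), of i j] by (cases "j < i") auto
  qed
  hence "card {j. b i \<le> a j} \<le> card {..<i}" by (rule card_mono[rotated]) simp
  ultimately show False using assms(4)[of "b i"] less by simp
qed

lemma fixed_colouring_cycle: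
  assumes "c \<circ> s = c"
  shows "c ((s ^^ k) x) = c x"
proof (induction k)
  case (Suc k)
  thus ?case using fun_cong[OF assms, of "(s ^^ k) x"] by simp
qed simp

lemma colouring_image:
  assumes "c \<in> colourings n b"
  shows "c ` {..<n} = {i. i < n \<and> b i \<noteq> 0}"
proof (intro equalityI subsetI)
  fix i assume "i \<in> c ` {..<n}"
  then obtain x where x: "x < n" "i = c x" by auto
  hence i: "i < n" using assms by (simp add: colourings_def)
  have "x \<in> {x. x < n \<and> c x = i}" using x by simp
  hence "card {x. x < n \<and> c x = i} > 0" by (auto simp: card_gt_0_iff)
  thus "i \<in> {i. i < n \<and> b i \<noteq> 0}" using assms i by (simp add: colourings_def)
next
  fix i assume i: "i \<in> {i. i < n \<and> b i \<noteq> 0}"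
  hence "card {x. x < n \<and> c x = i} > 0" using assms by (simp add: colourings_def)
  then obtain x where "x < n" "c x = i" by (auto simp: card_gt_0_iff)
  thus "i \<in> c ` {..<n}" by auto
qed

text \<open>A colouring fixed by s is constant on cycles, hence descends to a map from the nonzero
  parts of b, which are the cycles, onto those of a. So a has at most as many parts; with equally
  many the map is a bijection that preserves sizes, and decreasing order forces a = b.\<close>

lemma young_char_triangular:
  assumes a: "a \<in> partitions_of n" and b: "b \<in> partitions_of n" and c: "c \<in> colourings n b"
    and s: "cycle_colouring n s c" and nz: "young_char n a s \<noteq> 0"
  shows "a = b \<or> num_parts n a < num_parts n b"
proof (rule disjCI)
  assume "\<not> num_parts n a < num_parts n b"
  hence le: "num_parts n b \<le> num_parts n a" by simp
  obtain e where e: "e \<in> colourings n a" "e \<circ> s = e"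
    using nz unfolding young_char_def fixed_colourings_def by (auto simp: card_eq_0_iff)
  let ?Ia = "{i. i < n \<and> a i \<noteq> 0}" and ?Ib = "{i. i < n \<and> b i \<noteq> 0}"
  have same: "e x = e y" if "x < n" "y < n" "c x = c y" for x y
  proof -
    have "\<exists>k. (s ^^ k) x = y" using s that unfolding cycle_colouring_def by blast
    then obtain k where "(s ^^ k) x = y" by blast
    thus ?thesis using fixed_colouring_cycle[OF e(2), of k x] by simp
  qed
  define phi where "phi i = e (SOME x. x < n \<and> c x = i)" for i
  have phi: "phi (c x) = e x" if "x < n" for x
  proof -
    have "(SOME y. y < n \<and> c y = c x) < n \<and> c (SOME y. y < n \<and> c y = c x) = c x"
      by (rule someI[of _ x]) (use that in simp)
    thus ?thesis unfolding phi_def using same that by blast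
  qed
  have "e ` {..<n} = phi ` (c ` {..<n})" unfolding image_image by (intro image_cong refl) (simp add: phi)
  hence img: "phi ` ?Ib = ?Ia" using colouring_image[OF c] colouring_image[OF e(1)] by simp
  have inj: "inj_on phi ?Ib"
  proof (rule eq_card_imp_inj_on)
    show "card (phi ` ?Ib) = card ?Ib"
      using le card_image_le[of ?Ib phi] img by (simp add: num_parts_def)
  qed simp
  have a_phi: "a (phi i) = b i" if i: "i \<in> ?Ib" for i
  proof -
    have "phi i \<in> ?Ia" using img i by blast
    hence "a (phi i) = card {x. x < n \<and> e x = phi i}" using e(1) by (simp add: colourings_def)
    also have "{x. x < n \<and> e x = phi i} = {x. x < n \<and> c x = i}"
    proof (intro Collect_cong conj_cong refl)
      fix x assume x: "x < n"
      have "c x \<in> ?Ib" using x colouring_image[OF c] by blast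
      thus "(e x = phi i) = (c x = i)" using inj_on_eq_iff[OF inj _ i, of "c x"] phi[OF x] by simp
    qed
    also have "card \<dots> = b i" using c i by (simp add: colourings_def)
    finally show ?thesis .
  qed
  have vanish: "a j = 0" "b j = 0" if "j \<ge> n" for j
    using partition_vanishes[OF a that] partition_vanishes[OF b that] by auto
  have level: "card {j. v \<le> a j} = card {j. v \<le> b j}" if "v \<ge> 1" for v
  proof -
    have A: "{j. v \<le> a j} = {j \<in> ?Ia. v \<le> a j}"
    proof -
      have "j < n \<and> a j \<noteq> 0" if "v \<le> a j" for j
        using that \<open>v \<ge> 1\<close> vanish(1)[of j] by (cases "j < n") auto
      thus ?thesis by blast
    qed
    have B: "{j. v \<le> b j} = {j \<in> ?Ib. v \<le> b j}"
    proof -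
      have "j < n \<and> b j \<noteq> 0" if "v \<le> b j" for j
        using that \<open>v \<ge> 1\<close> vanish(2)[of j] by (cases "j < n") auto
      thus ?thesis by blast
    qed
    have "phi ` {j \<in> ?Ib. v \<le> b j} = {j \<in> ?Ia. v \<le> a j}"
    proof (intro equalityI subsetI)
      fix j assume "j \<in> phi ` {j \<in> ?Ib. v \<le> b j}"
      then obtain i where i: "i \<in> ?Ib" "v \<le> b i" "j = phi i" by blast
      have "phi i \<in> ?Ia" using img i(1) by blast
      thus "j \<in> {j \<in> ?Ia. v \<le> a j}" using a_phi[OF i(1)] i by simp
    next
      fix j assume j: "j \<in> {j \<in> ?Ia. v \<le> a j}"
      then obtain i where i: "i \<in> ?Ib" "j = phi i" using img by blast
      thus "j \<in> phi ` {j \<in> ?Ib. v \<le> b j}" using a_phi[OF i(1)] j by auto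
    qed
    moreover have "inj_on phi {j \<in> ?Ib. v \<le> b j}" using inj by (rule inj_on_subset) auto
    ultimately have "card {j \<in> ?Ia. v \<le> a j} = card {j \<in> ?Ib. v \<le> b j}"
      using card_image[of phi "{j \<in> ?Ib. v \<le> b j}"] by simp
    thus ?thesis unfolding A B .
  qed
  have fin: "finite {j. a j \<noteq> 0}" "finite {j. b j \<noteq> 0}" "antimono a" "antimono b"
    using a b by (auto simp: partitions_of_def partitions_def)
  show "a = b"
  proof
    fix i
    have "b i \<le> a i" using fin level by (intro antimono_less_superlevel) auto
    moreover have "a i \<le> b i" using fin level by (intro antimono_less_superlevel) auto
    ultimately show "a i = b i" by simp
  qed
qed

lemma young_char_diagonal:
  assumes c: "c \<in> colourings n b" and s: "cycle_colouring n s c"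
  shows "young_char n b s \<noteq> 0"
proof -
  have sp: "s permutes {..<n}" using s by (simp add: cycle_colouring_def)
  have "c (s x) = c x" for x
  proof (cases "x < n")
    case True
    have "s x < n" using permutes_in_image[OF sp, of x] True by simp
    moreover have "(s ^^ 1) x = s x" by simp
    ultimately have "c x = c (s x)" using s True unfolding cycle_colouring_def by blast
    thus ?thesis by simp
  next
    case False
    thus ?thesis using permutes_not_in[OF sp, of x] by simp
  qed
  hence "c \<in> fixed_colourings n b s" using c by (auto simp: fixed_colourings_def)
  moreover have "finite (fixed_colourings n b s)"
    using finite_colourings by (auto simp: fixed_colourings_def)
  ultimately show ?thesis unfolding young_char_def by (auto simp: card_eq_0_iff)
qed

section \<open>Young characters as a basis of the class functions\<close>

definition class_fun :: "nat \<Rightarrow> ((nat \<Rightarrow> nat) \<Rightarrow> real) \<Rightarrow> bool" where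
  "class_fun n f \<longleftrightarrow> (\<forall>s g. s permutes {..<n} \<longrightarrow> g permutes {..<n} \<longrightarrow> f (g \<circ> s \<circ> inv g) = f s)"

lemma colourings_comp:
  assumes c: "c \<in> colourings n a" and g: "g permutes {..<n}"
  shows "c \<circ> g \<in> colourings n a"
proof -
  have gn: "g x < n \<longleftrightarrow> x < n" for x using permutes_in_image[OF g, of x] by simp
  have "card {x. x < n \<and> c (g x) = i} = card {x. x < n \<and> c x = i}" for i
  proof -
    have "g ` {x. x < n \<and> c (g x) = i} = {x. x < n \<and> c x = i}"
    proof (intro equalityI subsetI)
      fix y assume y: "y \<in> {x. x < n \<and> c x = i}"
      have "g (inv g y) = y" using permutes_inverses[OF g] by simp
      moreover from this have "inv g y < n" using y gn[of "inv g y"] by simp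
      ultimately show "y \<in> g ` {x. x < n \<and> c (g x) = i}" using y by (intro image_eqI[of _ _ "inv g y"]) auto
    qed (auto simp: gn)
    moreover have "card (g ` {x. x < n \<and> c (g x) = i}) = card {x. x < n \<and> c (g x) = i}"
      by (rule card_image) (rule permutes_inj_on[OF g])
    ultimately show ?thesis by simp
  qed
  moreover have "g x \<ge> n" if "x \<ge> n" for x using gn[of x] that by simp
  ultimately show ?thesis using c by (auto simp: colourings_def gn)
qed

lemma class_fun_young_char: "class_fun n (\<lambda>s. real (young_char n a s))"
  unfolding class_fun_def
proof (intro allI impI)
  fix s g :: "nat \<Rightarrow> nat" assume s: "s permutes {..<n}" and g: "g permutes {..<n}"
  have gi: "g \<circ> inv g = id" "inv g \<circ> g = id" using permutes_inv_o[OF g] by auto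
  have cancel: "c \<circ> inv g \<circ> g = c" "c \<circ> g \<circ> inv g = c" for c :: "nat \<Rightarrow> nat" by (simp_all add: comp_assoc gi)
  have "bij_betw (\<lambda>c. c \<circ> g) (fixed_colourings n a (g \<circ> s \<circ> inv g)) (fixed_colourings n a s)"
  proof (rule bij_betw_byWitness[where f' = "\<lambda>c. c \<circ> inv g"])
    show "(\<lambda>c. c \<circ> g) ` fixed_colourings n a (g \<circ> s \<circ> inv g) \<subseteq> fixed_colourings n a s"
    proof clarify
      fix c assume "c \<in> fixed_colourings n a (g \<circ> s \<circ> inv g)"
      hence c: "c \<in> colourings n a" "c \<circ> (g \<circ> s \<circ> inv g) = c" by (auto simp: fixed_colourings_def)
      have "c \<circ> g \<circ> s = c \<circ> (g \<circ> s \<circ> inv g) \<circ> g" by (simp add: comp_assoc gi)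
      thus "c \<circ> g \<in> fixed_colourings n a s"
        unfolding c(2) using colourings_comp[OF c(1) g] by (simp add: fixed_colourings_def)
    qed
    show "(\<lambda>c. c \<circ> inv g) ` fixed_colourings n a s \<subseteq> fixed_colourings n a (g \<circ> s \<circ> inv g)"
    proof clarify
      fix c assume "c \<in> fixed_colourings n a s"
      hence c: "c \<in> colourings n a" "c \<circ> s = c" by (auto simp: fixed_colourings_def)
      have "c \<circ> inv g \<circ> (g \<circ> s \<circ> inv g) = c \<circ> (inv g \<circ> g) \<circ> s \<circ> inv g" by (simp only: comp_assoc)
      also have "\<dots> = c \<circ> inv g" by (simp add: gi c(2))
      finally show "c \<circ> inv g \<in> fixed_colourings n a (g \<circ> s \<circ> inv g)"
        using colourings_comp[OF c(1) permutes_inv[OF g]] by (simp add: fixed_colourings_def)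
    qed
  qed (simp_all add: cancel)
  thus "real (young_char n a (g \<circ> s \<circ> inv g)) = real (young_char n a s)"
    unfolding young_char_def by (intro arg_cong[where f = real] bij_betw_same_card)
qed

lemma class_fun_conj_count: "class_fun n (conj_count n s)"
  unfolding class_fun_def
proof (intro allI impI)
  fix x h :: "nat \<Rightarrow> nat" assume x: "x permutes {..<n}" and h: "h permutes {..<n}"
  have hi: "h \<circ> inv h = id" "inv h \<circ> h = id" using permutes_inv_o[OF h] by auto
  have cancel: "h \<circ> (inv h \<circ> g) = g" "inv h \<circ> (h \<circ> g) = g" for g :: "nat \<Rightarrow> nat"
    unfolding comp_assoc[symmetric] hi by simp_all
  have ih: "inv h permutes {..<n}" using h by (rule permutes_inv)
  have conj: "k \<circ> g \<circ> s \<circ> inv (k \<circ> g) = k \<circ> (g \<circ> s \<circ> inv g) \<circ> inv k"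
    if "g permutes {..<n}" "k permutes {..<n}" for g k :: "nat \<Rightarrow> nat"
    unfolding o_inv_distrib[OF permutes_bij[OF that(2)] permutes_bij[OF that(1)]] comp_assoc ..
  let ?A = "\<lambda>y. {g. g permutes {..<n} \<and> g \<circ> s \<circ> inv g = y}"
  have into: "k \<circ> g \<in> ?A (k \<circ> y \<circ> inv k)" if "g \<in> ?A y" "k permutes {..<n}" for g k y
  proof -
    have g: "g permutes {..<n}" and y: "g \<circ> s \<circ> inv g = y" using that(1) by auto
    show ?thesis using conj[OF g that(2)] permutes_compose[OF g that(2)] unfolding y by blast
  qed
  have "bij_betw (\<lambda>g. h \<circ> g) (?A x) (?A (h \<circ> x \<circ> inv h))"
  proof (rule bij_betw_byWitness[where f' = "\<lambda>g. inv h \<circ> g"])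
    show "(\<lambda>g. h \<circ> g) ` ?A x \<subseteq> ?A (h \<circ> x \<circ> inv h)" unfolding image_subset_iff using into[OF _ h] by blast
    have "inv h \<circ> (h \<circ> x \<circ> inv h) \<circ> inv (inv h) = x"
      unfolding inv_inv_eq[OF permutes_bij[OF h]] by (simp add: comp_assoc hi cancel)
    hence "inv h \<circ> g \<in> ?A x" if "g \<in> ?A (h \<circ> x \<circ> inv h)" for g
      using into[OF that ih] by simp
    thus "(\<lambda>g. inv h \<circ> g) ` ?A (h \<circ> x \<circ> inv h) \<subseteq> ?A x"
      unfolding image_subset_iff by blast
  qed (simp_all add: cancel)
  thus "conj_count n s (h \<circ> x \<circ> inv h) = conj_count n s x"
    unfolding conj_count_def by (intro arg_cong[where f = real] bij_betw_same_card[symmetric])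
qed

text \<open>The function r picks one permutation of each cycle type. The table of the characters at
  these is triangular for the number of parts with nonzero diagonal, and the last clause says that
  these permutations meet every conjugacy class.\<close>

lemma ex_class_representatives:
  "\<exists>r. (\<forall>b\<in>partitions_of n. r b permutes {..<n} \<and> young_char n b (r b) \<noteq> 0) \<and>
     (\<forall>a\<in>partitions_of n. \<forall>b\<in>partitions_of n. young_char n a (r b) \<noteq> 0 \<longrightarrow>
       a = b \<or> num_parts n a < num_parts n b) \<and>
     (\<forall>f s. class_fun n f \<longrightarrow> s permutes {..<n} \<longrightarrow> (\<exists>b\<in>partitions_of n. f s = f (r b)))"
proof -
  have "\<exists>c s. c \<in> colourings n b \<and> cycle_colouring n s c" if b: "b \<in> partitions_of n" for b
  proof -
    have "(\<Sum>i<n. b i) = n" using b by (simp add: partitions_of_eq)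
    from ex_colouring[OF this] obtain c where "c \<in> colourings n b" by blast
    moreover obtain s where "cycle_colouring n s c" using ex_cycle_colouring_permutation by blast
    ultimately show ?thesis by blast
  qed
  then obtain c r where cr: "\<And>b. b \<in> partitions_of n \<Longrightarrow> c b \<in> colourings n b"
    "\<And>b. b \<in> partitions_of n \<Longrightarrow> cycle_colouring n (r b) (c b)" by metis
  have rp: "r b permutes {..<n}" if "b \<in> partitions_of n" for b
    using cr(2)[OF that] by (simp add: cycle_colouring_def)
  show ?thesis
  proof (intro exI[of _ r] conjI ballI allI impI)
    show "r b permutes {..<n}" if "b \<in> partitions_of n" for b using that by (rule rp)
    show "young_char n b (r b) \<noteq> 0" if "b \<in> partitions_of n" for b
      using cr(1)[OF that] cr(2)[OF that] by (rule young_char_diagonal)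
    show "a = b \<or> num_parts n a < num_parts n b"
      if "a \<in> partitions_of n" "b \<in> partitions_of n" "young_char n a (r b) \<noteq> 0" for a b
      using young_char_triangular[OF that(1,2) cr(1)[OF that(2)] cr(2)[OF that(2)] that(3)] .
  next
    fix f :: "(nat \<Rightarrow> nat) \<Rightarrow> real" and s
    assume f: "class_fun n f" and s: "s permutes {..<n}"
    obtain b c' where b: "b \<in> partitions_of n" "c' \<in> colourings n b" "cycle_colouring n s c'"
      using ex_cycle_partition[OF s] by blast
    obtain g where g: "g permutes {..<n}" "g \<circ> s = r b \<circ> g"
      using conjugate_if_same_colour_sizes[OF b(3) cr(2)[OF b(1)] b(2) cr(1)[OF b(1)]] by blast
    have "g \<circ> s \<circ> inv g = r b" unfolding g(2) by (simp add: comp_assoc permutes_inv_o(1)[OF g(1)])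
    moreover have "f (g \<circ> s \<circ> inv g) = f s" using f s g(1) unfolding class_fun_def by blast
    ultimately have "f s = f (r b)" by simp
    thus "\<exists>b\<in>partitions_of n. f s = f (r b)" using b(1) by blast
  qed
qed

lemma class_fun_sum:
  assumes "\<And>x. x \<in> A \<Longrightarrow> class_fun n (f x)"
  shows "class_fun n (\<lambda>s. \<Sum>x\<in>A. u x * f x s)"
  using assms unfolding class_fun_def by (intro allI impI sum.cong) auto

lemma class_fun_diff: "class_fun n f \<Longrightarrow> class_fun n g \<Longrightarrow> class_fun n (\<lambda>s. f s - g s)"
  unfolding class_fun_def by simp

text \<open>At the representative of type b only b itself and characters with fewer parts can be
  nonzero, and the coefficients of the latter vanish by induction.\<close>

lemma young_char_independent:
  assumes 0: "\<And>s. s permutes {..<n} \<Longrightarrow> (\<Sum>b\<in>partitions_of n. u b * real (young_char n b s)) = 0"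
    and "b \<in> partitions_of n"
  shows "u b = 0"
proof -
  obtain r where "(\<forall>b\<in>partitions_of n. r b permutes {..<n} \<and> young_char n b (r b) \<noteq> 0) \<and>
     (\<forall>a\<in>partitions_of n. \<forall>b\<in>partitions_of n. young_char n a (r b) \<noteq> 0 \<longrightarrow>
       a = b \<or> num_parts n a < num_parts n b) \<and>
     (\<forall>f s. class_fun n f \<longrightarrow> s permutes {..<n} \<longrightarrow> (\<exists>b\<in>partitions_of n. f s = f (r b)))"
    using ex_class_representatives[of n] ..
  hence r: "\<And>b. b \<in> partitions_of n \<Longrightarrow> r b permutes {..<n}"
    "\<And>b. b \<in> partitions_of n \<Longrightarrow> young_char n b (r b) \<noteq> 0"
    "\<And>a b. a \<in> partitions_of n \<Longrightarrow> b \<in> partitions_of n \<Longrightarrow> young_char n a (r b) \<noteq> 0 \<Longrightarrow>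
       a = b \<or> num_parts n a < num_parts n b"
    by simp_all
  show ?thesis using assms(2)
  proof (induction "num_parts n b" arbitrary: b rule: less_induct)
    case less
    have "u a * real (young_char n a (r b)) = 0" if a: "a \<in> partitions_of n - {b}" for a
    proof (cases "young_char n a (r b) = 0")
      case False
      hence "num_parts n a < num_parts n b" using r(3)[of a b] a less(2) by blast
      thus ?thesis using less(1) a by simp
    qed simp
    hence "(\<Sum>a\<in>partitions_of n - {b}. u a * real (young_char n a (r b))) = 0" by (rule sum.neutral[rule_format])
    hence "(\<Sum>a\<in>partitions_of n. u a * real (young_char n a (r b))) = u b * real (young_char n b (r b))"
      by (subst sum.remove[OF finite_partitions_of less(2)]) simp
    thus "u b = 0" using 0[OF r(1)[OF less(2)]] r(2)[OF less(2)] by simp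
  qed
qed

text \<open>Gaussian elimination in the same triangular table, by increasing number of
  parts.\<close>

lemma young_char_spanning:
  assumes "class_fun n f"
  shows "\<exists>u. \<forall>s. s permutes {..<n} \<longrightarrow> f s = (\<Sum>b\<in>partitions_of n. u b * real (young_char n b s))"
proof -
  obtain r where "(\<forall>b\<in>partitions_of n. r b permutes {..<n} \<and> young_char n b (r b) \<noteq> 0) \<and>
     (\<forall>a\<in>partitions_of n. \<forall>b\<in>partitions_of n. young_char n a (r b) \<noteq> 0 \<longrightarrow>
       a = b \<or> num_parts n a < num_parts n b) \<and>
     (\<forall>f s. class_fun n f \<longrightarrow> s permutes {..<n} \<longrightarrow> (\<exists>b\<in>partitions_of n. f s = f (r b)))"
    using ex_class_representatives[of n] ..
  hence r: "\<And>b. b \<in> partitions_of n \<Longrightarrow> r b permutes {..<n}"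
    "\<And>b. b \<in> partitions_of n \<Longrightarrow> young_char n b (r b) \<noteq> 0"
    "\<And>a b. a \<in> partitions_of n \<Longrightarrow> b \<in> partitions_of n \<Longrightarrow> young_char n a (r b) \<noteq> 0 \<Longrightarrow>
       a = b \<or> num_parts n a < num_parts n b"
    and rep: "\<And>f s. class_fun n f \<Longrightarrow> s permutes {..<n} \<Longrightarrow> \<exists>b\<in>partitions_of n. f s = f (r b)"
    by simp_all
  let ?P = "partitions_of n"
  \<comment> \<open>Here f already vanishes at all representatives with fewer than m parts; at
    \<open>m = Suc n\<close> these are all of them.\<close>
  have *: "m \<le> Suc n \<Longrightarrow> class_fun n f \<Longrightarrow> (\<And>b. b \<in> ?P \<Longrightarrow> num_parts n b < m \<Longrightarrow> f (r b) = 0) \<Longrightarrow>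
    \<exists>u. \<forall>s. s permutes {..<n} \<longrightarrow> f s = (\<Sum>b\<in>?P. u b * real (young_char n b s))" for m f
  proof (induction "Suc n - m" arbitrary: m f)
    case 0
    have "f s = 0" if s: "s permutes {..<n}" for s
    proof -
      obtain b where b: "b \<in> ?P" "f s = f (r b)" using rep[OF 0(3) s] by blast
      have "num_parts n b < m" using num_parts_le[of n b] 0(1) by simp
      thus ?thesis using 0(4)[OF b(1)] b(2) by simp
    qed
    thus ?case by (intro exI[of _ "\<lambda>_. 0"]) simp
  next
    case (Suc d)
    \<comment> \<open>Correcting the values at exactly m parts does not disturb those with fewer
      parts, where characters with m parts vanish.\<close>
    define v where "v b = (if num_parts n b = m then f (r b) / real (young_char n b (r b)) else 0)" for b
    define f' where "f' s = f s - (\<Sum>b\<in>?P. v b * real (young_char n b s))" for s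
    have "class_fun n f'" unfolding f'_def
      by (intro class_fun_diff class_fun_sum Suc class_fun_young_char)
    moreover have "f' (r c) = 0" if c: "c \<in> ?P" "num_parts n c < Suc m" for c
    proof -
      have "v b * real (young_char n b (r c)) = 0" if b: "b \<in> ?P - {c}" for b
      proof (cases "young_char n b (r c) = 0")
        case False
        hence "num_parts n b < num_parts n c" using r(3)[of b c] b c by blast
        thus ?thesis using c by (simp add: v_def)
      qed simp
      hence "(\<Sum>b\<in>?P - {c}. v b * real (young_char n b (r c))) = 0" by (rule sum.neutral[rule_format])
      hence "(\<Sum>b\<in>?P. v b * real (young_char n b (r c))) = v c * real (young_char n c (r c))"
        by (subst sum.remove[OF finite_partitions_of c(1)]) simp
      moreover have "v c * real (young_char n c (r c)) = f (r c)"
        using r(2)[OF c(1)] Suc(5)[OF c(1)] c(2) by (auto simp: v_def)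
      ultimately show ?thesis by (simp add: f'_def)
    qed
    moreover have "d = Suc n - Suc m" "Suc m \<le> Suc n" using Suc(2) by auto
    ultimately obtain u where u: "\<forall>s. s permutes {..<n} \<longrightarrow> f' s = (\<Sum>b\<in>?P. u b * real (young_char n b s))"
      using Suc(1)[of "Suc m" f'] by blast
    show ?case
      by (intro exI[of _ "\<lambda>b. u b + v b"]) (use u in \<open>simp add: f'_def distrib_right sum.distrib algebra_simps\<close>)
  qed
  show ?thesis by (rule *[of 0]) (use assms in auto)
qed

text \<open>For each g exactly one s satisfies the conjugation equation, and f takes the value f x
  there. There are n! choices of g.\<close>

lemma conj_count_average:
  assumes f: "class_fun n f" and x: "x permutes {..<n}"
  shows "(\<Sum>s | s permutes {..<n}. f s * conj_count n s x) = fact n * f x"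
proof -
  let ?P = "{s. s permutes {..<n}}"
  have fin: "finite ?P" by (rule finite_permutations) simp
  have cc: "conj_count n s x = (\<Sum>g\<in>?P. if g \<circ> s \<circ> inv g = x then 1 else 0)" for s
  proof -
    have "{g. g permutes {..<n} \<and> g \<circ> s \<circ> inv g = x} = ?P \<inter> {g. g \<circ> s \<circ> inv g = x}" by auto
    thus ?thesis unfolding conj_count_def by (simp add: sum.If_cases[OF fin])
  qed
  have "(\<Sum>s\<in>?P. f s * conj_count n s x) = (\<Sum>g\<in>?P. \<Sum>s\<in>?P. f s * (if g \<circ> s \<circ> inv g = x then 1 else 0))"
    unfolding cc sum_distrib_left by (rule sum.swap)
  also have "\<dots> = (\<Sum>g\<in>?P. f x)"
  proof (intro sum.cong refl)
    fix g assume "g \<in> ?P"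
    hence g: "g permutes {..<n}" by simp
    have gi: "g \<circ> inv g = id" "inv g \<circ> g = id" using permutes_inv_o[OF g] by auto
    let ?y = "inv g \<circ> x \<circ> g"
    have y: "?y permutes {..<n}" by (intro permutes_compose permutes_inv g x)
    have gy: "g \<circ> ?y \<circ> inv g = x"
    proof -
      have "g \<circ> ?y \<circ> inv g = (g \<circ> inv g) \<circ> x \<circ> (g \<circ> inv g)" by (simp only: comp_assoc)
      thus ?thesis by (simp add: gi)
    qed
    have uniq: "g \<circ> s \<circ> inv g = x \<longleftrightarrow> s = ?y" for s
    proof
      assume eq: "g \<circ> s \<circ> inv g = x"
      have "?y = (inv g \<circ> g) \<circ> s \<circ> (inv g \<circ> g)" unfolding eq[symmetric] by (simp only: comp_assoc)
      thus "s = ?y" by (simp add: gi)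
    qed (use gy in simp)
    have "(\<Sum>s\<in>?P. f s * (if g \<circ> s \<circ> inv g = x then 1 else 0)) = (\<Sum>s\<in>?P. if s = ?y then f s else 0)"
      unfolding uniq by (intro sum.cong) auto
    also have "\<dots> = f ?y" using y fin by simp
    also have "\<dots> = f (g \<circ> ?y \<circ> inv g)" using f y g unfolding class_fun_def by simp
    finally show "(\<Sum>s\<in>?P. f s * (if g \<circ> s \<circ> inv g = x then 1 else 0)) = f x" unfolding gy .
  qed
  also have "\<dots> = fact n * f x"
    using card_permutations[of "{..<n}" n] by simp
  finally show ?thesis .
qed

text \<open>
  By \<open>card_labelled_coverings\<close> the left-hand side is n! times the trace of the k-th power of \<open>transp_op n\<close> on
  class functions. In the basis of the characters \<open>young_char n b\<close> this operator is triangular.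
\<close>

theorem card_labelled_coverings_contents:
  "real (card (labelled_coverings n k)) = fact n * (\<Sum>a\<in>partitions_of n. total_content a ^ k)"
proof -
  let ?P = "{s. s permutes {..<n}}" and ?B = "partitions_of n"
  let ?y = "\<lambda>b s. real (young_char n b s)"
  have fin: "finite ?P" by (rule finite_permutations) simp
  have finB: "finite ?B" by (rule finite_partitions_of)
  have "\<forall>s. \<exists>u. \<forall>x. x permutes {..<n} \<longrightarrow> conj_count n s x = (\<Sum>b\<in>?B. u b * ?y b x)"
    using young_char_spanning[OF class_fun_conj_count] by blast
  from choice[OF this] obtain u where "\<forall>s x. x permutes {..<n} \<longrightarrow> conj_count n s x = (\<Sum>b\<in>?B. u s b * ?y b x)" ..
  hence u: "conj_count n s x = (\<Sum>b\<in>?B. u s b * ?y b x)" if "x permutes {..<n}" for s x using that by blast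
  \<comment> \<open>The coefficients of \<open>conj_count n s\<close>, as functions of s, are n!
    times the dual basis: by \<open>conj_count_average\<close> they reproduce n! times each
    character, and independence compares coefficients.\<close>
  have dual: "(\<Sum>s\<in>?P. u s b * ?y c s) = (if b = c then fact n else 0)" if b: "b \<in> ?B" and c: "c \<in> ?B" for b c
  proof -
    let ?w = "\<lambda>b. (\<Sum>s\<in>?P. u s b * ?y c s) - (if b = c then fact n else 0)"
    have "?w b = 0"
    proof (rule young_char_independent[OF _ b])
      fix x :: "nat \<Rightarrow> nat" assume x: "x permutes {..<n}"
      have "(\<Sum>b\<in>?B. (\<Sum>s\<in>?P. u s b * ?y c s) * ?y b x) = (\<Sum>s\<in>?P. ?y c s * (\<Sum>b\<in>?B. u s b * ?y b x))"
        unfolding sum_distrib_left sum_distrib_right by (subst sum.swap) (simp add: mult_ac)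
      also have "\<dots> = (\<Sum>s\<in>?P. ?y c s * conj_count n s x)" by (simp only: u[OF x])
      also have "\<dots> = fact n * ?y c x" by (rule conj_count_average[OF class_fun_young_char x])
      also have "\<dots> = (\<Sum>b\<in>?B. (if b = c then fact n else 0) * ?y b x)"
      proof -
        have "(\<Sum>b\<in>?B. (if b = c then fact n else 0) * ?y b x) = (\<Sum>b\<in>?B. if b = c then fact n * ?y b x else 0)"
          by (intro sum.cong) auto
        thus ?thesis using c finB by simp
      qed
      finally show "(\<Sum>b\<in>?B. ?w b * ?y b x) = 0" by (simp add: left_diff_distrib sum_subtractf)
    qed
    thus ?thesis by simp
  qed
  have "\<forall>b\<in>?B. \<exists>v. \<forall>s. s permutes {..<n} \<longrightarrow> (transp_op n ^^ k) (?y b) s = total_content b ^ k * ?y b s +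
      (\<Sum>c | c \<in> ?B \<and> square_sum n b < square_sum n c. v c * ?y c s)"
  proof
    fix b assume b: "b \<in> ?B"
    obtain g where g: "g \<in> char_span n (square_sum n b)"
      "\<And>s. s permutes {..<n} \<Longrightarrow> (transp_op n ^^ k) (?y b) s = total_content b ^ k * ?y b s + g s"
      using transp_op_power_young_char[OF b, of k] by blast
    from g(1) obtain v where "\<And>s. s permutes {..<n} \<Longrightarrow> g s = (\<Sum>c | c \<in> ?B \<and> square_sum n b < square_sum n c. v c * ?y c s)"
      unfolding char_span_def by blast
    thus "\<exists>v. \<forall>s. s permutes {..<n} \<longrightarrow> (transp_op n ^^ k) (?y b) s = total_content b ^ k * ?y b s +
      (\<Sum>c | c \<in> ?B \<and> square_sum n b < square_sum n c. v c * ?y c s)"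
      using g(2) by (intro exI[of _ v]) simp
  qed
  from bchoice[OF this] obtain v where v: "\<forall>b\<in>?B. \<forall>s. s permutes {..<n} \<longrightarrow> (transp_op n ^^ k) (?y b) s
      = total_content b ^ k * ?y b s + (\<Sum>c | c \<in> ?B \<and> square_sum n b < square_sum n c. v b c * ?y c s)" ..
  have lin: "(transp_op n ^^ k) (conj_count n s) s = (\<Sum>b\<in>?B. u s b * (transp_op n ^^ k) (?y b) s)"
    if s: "s permutes {..<n}" for s
  proof -
    have "(transp_op n ^^ k) (conj_count n s) s = (\<Sum>ts\<in>transp_words n k. \<Sum>b\<in>?B. u s b * ?y b (inv (foldr (\<circ>) ts id) \<circ> s))"
      unfolding transp_op_power
    proof (intro sum.cong refl u)
      fix ts assume "ts \<in> transp_words n k"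
      hence "foldr (\<circ>) ts id permutes {..<n}" using foldr_comp_permutes by (simp add: transp_words_def)
      thus "inv (foldr (\<circ>) ts id) \<circ> s permutes {..<n}" by (intro permutes_compose[OF s] permutes_inv)
    qed
    also have "\<dots> = (\<Sum>b\<in>?B. u s b * (transp_op n ^^ k) (?y b) s)"
      unfolding transp_op_power sum_distrib_left by (rule sum.swap)
    finally show ?thesis .
  qed
  have "real (card (labelled_coverings n k)) = (\<Sum>s\<in>?P. \<Sum>b\<in>?B. u s b * (transp_op n ^^ k) (?y b) s)"
    unfolding card_labelled_coverings(2) by (intro sum.cong refl lin) simp
  also have "\<dots> = (\<Sum>b\<in>?B. \<Sum>s\<in>?P. u s b * (total_content b ^ k * ?y b s +
      (\<Sum>c | c \<in> ?B \<and> square_sum n b < square_sum n c. v b c * ?y c s)))"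
  proof (subst sum.swap, intro sum.cong refl)
    fix b s assume "b \<in> ?B" "s \<in> ?P"
    with v show "u s b * (transp_op n ^^ k) (?y b) s = u s b * (total_content b ^ k * ?y b s +
      (\<Sum>c | c \<in> ?B \<and> square_sum n b < square_sum n c. v b c * ?y c s))"
      by simp
  qed
  also have "\<dots> = (\<Sum>b\<in>?B. total_content b ^ k * (\<Sum>s\<in>?P. u s b * ?y b s) +
      (\<Sum>c | c \<in> ?B \<and> square_sum n b < square_sum n c. v b c * (\<Sum>s\<in>?P. u s b * ?y c s)))"
  proof (intro sum.cong refl)
    fix b
    let ?C = "{c. c \<in> ?B \<and> square_sum n b < square_sum n c}"
    have "(\<Sum>s\<in>?P. u s b * (\<Sum>c\<in>?C. v b c * ?y c s)) = (\<Sum>c\<in>?C. v b c * (\<Sum>s\<in>?P. u s b * ?y c s))"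
      unfolding sum_distrib_left by (subst sum.swap) (simp add: mult_ac)
    thus "(\<Sum>s\<in>?P. u s b * (total_content b ^ k * ?y b s + (\<Sum>c\<in>?C. v b c * ?y c s)))
      = total_content b ^ k * (\<Sum>s\<in>?P. u s b * ?y b s) + (\<Sum>c\<in>?C. v b c * (\<Sum>s\<in>?P. u s b * ?y c s))"
      by (simp add: distrib_left sum.distrib sum_distrib_left mult_ac)
  qed
  also have "\<dots> = (\<Sum>b\<in>?B. total_content b ^ k * fact n)"
  proof (intro sum.cong refl)
    fix b assume b: "b \<in> ?B"
    let ?C = "{c. c \<in> ?B \<and> square_sum n b < square_sum n c}"
    \<comment> \<open>A strictly larger sum of squares excludes c = b, so duality removes the whole
      off-diagonal part.\<close>
    have "(\<Sum>c\<in>?C. v b c * (\<Sum>s\<in>?P. u s b * ?y c s)) = 0"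
    proof (intro sum.neutral ballI)
      fix c assume "c \<in> ?C"
      hence "c \<in> ?B" "b \<noteq> c" by auto
      thus "v b c * (\<Sum>s\<in>?P. u s b * ?y c s) = 0" using dual[OF b] by simp
    qed
    thus "total_content b ^ k * (\<Sum>s\<in>?P. u s b * ?y b s) + (\<Sum>c\<in>?C. v b c * (\<Sum>s\<in>?P. u s b * ?y c s))
      = total_content b ^ k * fact n" using dual[OF b b] by simp
  qed
  finally show ?thesis by (simp add: sum_distrib_right[symmetric])
qed

section \<open>Hurwitz numbers of the torus\<close>

lemma foldr_comp_Cons: "foldr (\<circ>) (f # fs) id = f \<circ> foldr (\<circ>) fs id"
  by simp

lemma labelled_coverings_odd:
  assumes "odd k"
  shows "labelled_coverings n k = {}"
proof (rule ccontr)
  assume "labelled_coverings n k \<noteq> {}"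
  then obtain s1 s2 ts where s: "s1 permutes {..<n}" "s2 permutes {..<n}" and ts: "ts \<in> transp_words n k"
    and eq: "s1 \<circ> s2 \<circ> inv s1 = inv (foldr (\<circ>) ts id) \<circ> s2"
    unfolding labelled_coverings_eq by blast
  have perm: "permutation p" if "p permutes {..<n}" for p
    using that by (auto simp: permutation_permutes)
  have sgn_ts: "sign (foldr (\<circ>) ts id) = (- 1) ^ length ts" if "set ts \<subseteq> transpositions n" for ts
    using that
  proof (induction ts)
    case (Cons tau ts)
    have tau: "tau \<in> transpositions n" and sub: "set ts \<subseteq> transpositions n" using Cons(2) by auto
    then obtain i j where "i \<noteq> j" "tau = Transposition.transpose i j" by (auto simp: transpositions_def)
    hence "sign tau = - 1" by (simp add: sign_swap_id)
    moreover have "sign (tau \<circ> foldr (\<circ>) ts id) = sign tau * sign (foldr (\<circ>) ts id)"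
      by (rule sign_compose) (intro perm transpositions_permutes tau foldr_comp_permutes sub)+
    ultimately show ?case
      unfolding foldr_comp_Cons Cons(1)[OF sub] length_Cons power_Suc by (simp only:)
  qed simp
  have sub: "set ts \<subseteq> transpositions n" "length ts = k" using ts by (auto simp: transp_words_def)
  let ?f = "foldr (\<circ>) ts id"
  have p: "permutation s1" "permutation s2" "permutation ?f"
    by (intro perm s foldr_comp_permutes sub)+
  note pi = p[THEN permutation_inverse]
  have "sign (s1 \<circ> s2 \<circ> inv s1) = sign s1 * sign s2 * sign s1"
    using p pi by (simp add: sign_compose permutation_compose sign_inverse)
  moreover have "sign (inv ?f \<circ> s2) = sign ?f * sign s2"
    using p pi by (simp add: sign_compose sign_inverse)
  ultimately have "sign s1 * sign s2 * sign s1 = (- 1) ^ k * sign s2"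
    unfolding eq using sgn_ts[OF sub(1)] sub(2) by simp
  thus False using assms by (auto simp: sign_def split: if_splits)
qed

text \<open>Usually seen by conjugating diagrams, which negates the content; here it is read off
  from the absence of coverings.\<close>

lemma sum_total_content_odd:
  assumes "odd k"
  shows "(\<Sum>a\<in>partitions_of n. total_content a ^ k) = 0"
  using card_labelled_coverings_contents[of n k] labelled_coverings_odd[OF assms, of n] by simp

section \<open>Isomorphism classes of coverings and their automorphisms\<close>

lemma relabel_comp:
  assumes "g permutes {..<n}" "h permutes {..<n}"
  shows "relabel g (relabel h X) = relabel (g \<circ> h) X"
proof -
  have inv: "inv (g \<circ> h) = inv h \<circ> inv g"
    using assms by (intro o_inv_distrib permutes_bij)
  have c: "g \<circ> (h \<circ> s \<circ> inv h) \<circ> inv g = g \<circ> h \<circ> s \<circ> (inv h \<circ> inv g)" for s :: "nat \<Rightarrow> nat"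
    by (simp only: comp_assoc)
  obtain s1 s2 ts where X: "X = (s1, s2, ts)" by (cases X)
  show ?thesis unfolding X relabel.simps inv map_map by (simp add: c comp_def[of _ "\<lambda>s. h \<circ> s \<circ> inv h"])
qed

lemma relabel_id: "relabel id X = X"
  by (cases X) simp

lemma relabel_labelled:
  assumes X: "X \<in> labelled_coverings n k" and g: "g permutes {..<n}"
  shows "relabel g X \<in> labelled_coverings n k"
proof -
  obtain s1 s2 ts where eX: "X = (s1, s2, ts)" by (cases X)
  have s: "s1 permutes {..<n}" "s2 permutes {..<n}" and ts: "length ts = k" "set ts \<subseteq> transpositions n"
    and eq: "s1 \<circ> s2 \<circ> inv s1 = inv (foldr (\<circ>) ts id) \<circ> s2"
    using X unfolding eX labelled_coverings_eq transp_words_def by auto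
  have gi: "g \<circ> inv g = id" "inv g \<circ> g = id" using permutes_inv_o[OF g] by auto
  have canc: "inv g \<circ> (g \<circ> u) = u" for u :: "nat \<Rightarrow> nat" unfolding comp_assoc[symmetric] gi by simp
  let ?c = "\<lambda>s. g \<circ> s \<circ> inv g"
  have cp: "?c s permutes {..<n}" if "s permutes {..<n}" for s
    by (intro permutes_compose permutes_inv g that)
  have cc: "?c s \<circ> ?c u = ?c (s \<circ> u)" for s u by (simp add: comp_assoc canc)
  have cinv: "inv (?c s) = ?c (inv s)" if "s permutes {..<n}" for s
    using permutes_bij[OF g] permutes_bij[OF that] permutes_bij[OF permutes_inv[OF g]]
    by (simp add: o_inv_distrib bij_comp inv_inv_eq comp_assoc)
  have cf: "foldr (\<circ>) (map ?c ts) id = ?c (foldr (\<circ>) ts id)" for ts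
  proof (induction ts)
    case Nil
    show ?case by (simp add: gi)
  next
    case (Cons s ts)
    have "foldr (\<circ>) (map ?c (s # ts)) id = ?c s \<circ> foldr (\<circ>) (map ?c ts) id"
      unfolding list.map foldr_comp_Cons ..
    also have "\<dots> = ?c s \<circ> ?c (foldr (\<circ>) ts id)" by (simp only: Cons)
    also have "\<dots> = ?c (s \<circ> foldr (\<circ>) ts id)" by (rule cc)
    finally show ?case unfolding foldr_comp_Cons .
  qed
  have ct: "?c s \<in> transpositions n" if tr: "s \<in> transpositions n" for s
  proof -
    obtain i j where ij: "i < n" "j < n" "i \<noteq> j" "s = Transposition.transpose i j"
      using tr by (auto simp: transpositions_def)
    have "?c s = Transposition.transpose (g i) (g j)"
    proof
      fix x
      have "g (inv g x) = x" using permutes_inverses[OF g] by simp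
      moreover have "inv g (g y) = y" for y using permutes_inverses[OF g] by simp
      ultimately show "?c s x = Transposition.transpose (g i) (g j) x"
        unfolding ij(4) by (auto simp: Transposition.transpose_def)
    qed
    moreover have "g i < n" "g j < n" using permutes_in_image[OF g] ij by auto
    moreover have "g i \<noteq> g j" using permutes_inj[OF g] ij by (simp add: inj_eq)
    ultimately show ?thesis unfolding transpositions_def by blast
  qed
  have f: "foldr (\<circ>) ts id permutes {..<n}" by (rule foldr_comp_permutes[OF ts(2)])
  have "?c s1 \<circ> ?c s2 \<circ> inv (?c s1) = inv (foldr (\<circ>) (map ?c ts) id) \<circ> ?c s2"
    unfolding cf cinv[OF s(1)] cinv[OF f] cc eq ..
  moreover have "set (map ?c ts) \<subseteq> transpositions n" using ct ts(2) by auto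
  ultimately show ?thesis
    unfolding eX labelled_coverings_eq transp_words_def relabel.simps using cp s ts(1) by simp
qed

lemma covering_class_eq:
  assumes "Y \<in> covering_class n X"
  shows "covering_class n Y = covering_class n X"
proof -
  obtain h where h: "h permutes {..<n}" "Y = relabel h X" using assms unfolding covering_class_def by blast
  have X: "X = relabel (inv h) Y"
    unfolding h(2) relabel_comp[OF permutes_inv[OF h(1)] h(1)] permutes_inv_o(2)[OF h(1)] relabel_id ..
  have sub: "covering_class n (relabel h X) \<subseteq> covering_class n X" if "h permutes {..<n}" for h X
  proof
    fix Z assume "Z \<in> covering_class n (relabel h X)"
    then obtain g where g: "g permutes {..<n}" "Z = relabel g (relabel h X)" unfolding covering_class_def by blast
    show "Z \<in> covering_class n X"
      unfolding g(2) relabel_comp[OF g(1) that] covering_class_def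
      using permutes_compose[OF that g(1)] by blast
  qed
  show ?thesis using sub[OF h(1), of X] sub[OF permutes_inv[OF h(1)], of Y] unfolding h(2)[symmetric] X[symmetric] by blast
qed

lemma self_in_covering_class: "X \<in> covering_class n X"
proof -
  have "X = relabel id X" by (simp add: relabel_id)
  thus ?thesis unfolding covering_class_def using permutes_id by blast
qed

text \<open>The relabellings that take X to \<open>relabel h X\<close> form the coset of the
  stabilizer of X by h.\<close>

lemma orbit_stabilizer:
  "finite (covering_class n X)" "card (covering_class n X) * card (covering_aut n X) = fact n"
proof -
  let ?P = "{g. g permutes {..<n}}"
  have fin: "finite ?P" by (rule finite_permutations) simp
  have img: "covering_class n X = (\<lambda>g. relabel g X) ` ?P" unfolding covering_class_def by blast
  show finc: "finite (covering_class n X)" unfolding img by (rule finite_imageI[OF fin])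
  have fibre: "card {g \<in> ?P. relabel g X = Y} = card (covering_aut n X)" if Y: "Y \<in> covering_class n X" for Y
  proof -
    obtain h where h: "h permutes {..<n}" "Y = relabel h X" using Y unfolding covering_class_def by blast
    have ih: "inv h permutes {..<n}" using h(1) by (rule permutes_inv)
    have hi: "h \<circ> inv h = id" "inv h \<circ> h = id" using permutes_inv_o[OF h(1)] by auto
    have cancel: "h \<circ> (inv h \<circ> g) = g" "inv h \<circ> (h \<circ> g) = g" for g :: "nat \<Rightarrow> nat"
      unfolding comp_assoc[symmetric] hi by simp_all
    have "bij_betw (\<lambda>g. h \<circ> g) (covering_aut n X) {g \<in> ?P. relabel g X = Y}"
    proof (rule bij_betw_byWitness[where f' = "\<lambda>g. inv h \<circ> g"])
      show "(\<lambda>g. h \<circ> g) ` covering_aut n X \<subseteq> {g \<in> ?P. relabel g X = Y}"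
      proof (rule image_subsetI)
        fix g assume "g \<in> covering_aut n X"
        hence g: "g permutes {..<n}" "relabel g X = X" unfolding covering_aut_def by auto
        show "h \<circ> g \<in> {g \<in> ?P. relabel g X = Y}"
          using relabel_comp[OF h(1) g(1), of X] permutes_compose[OF g(1) h(1)] unfolding g(2) h(2) by simp
      qed
      show "(\<lambda>g. inv h \<circ> g) ` {g \<in> ?P. relabel g X = Y} \<subseteq> covering_aut n X"
      proof (rule image_subsetI)
        fix g assume "g \<in> {g \<in> ?P. relabel g X = Y}"
        hence g: "g permutes {..<n}" "Y = relabel g X" by auto
        have "relabel (inv h \<circ> g) X = relabel (inv h) (relabel h X)"
          unfolding relabel_comp[OF ih g(1), symmetric] g(2)[symmetric] h(2) ..
        also have "\<dots> = X" unfolding relabel_comp[OF ih h(1)] hi relabel_id ..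
        finally show "inv h \<circ> g \<in> covering_aut n X"
          unfolding covering_aut_def using permutes_compose[OF g(1) ih] by simp
      qed
    qed (simp_all add: cancel)
    from bij_betw_same_card[OF this] show ?thesis by simp
  qed
  have "fact n = card ?P" using card_permutations[of "{..<n}" n] by simp
  also have "\<dots> = (\<Sum>g\<in>?P. 1)" by simp
  also have "\<dots> = (\<Sum>Y\<in>covering_class n X. \<Sum>g\<in>{g \<in> ?P. relabel g X = Y}. 1)"
    by (rule sum.group[symmetric, OF fin finc]) (simp add: img)
  also have "\<dots> = (\<Sum>Y\<in>covering_class n X. card (covering_aut n X))"
    by (intro sum.cong refl) (use fibre in simp)
  finally show "card (covering_class n X) * card (covering_aut n X) = fact n" by simp
qed

text \<open>By orbit-stabilizer the weight of a class is its size divided by n!, and the classes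
  partition the labelled coverings.\<close>

lemma hurwitz_space_props:
  "finite (hurwitz_space n k)"
  "(\<Sum>c\<in>hurwitz_space n k. 1 / real (aut_order (n, k, c))) = (\<Sum>a\<in>partitions_of n. total_content a ^ k)"
proof -
  let ?H = "hurwitz_space n k" and ?L = "labelled_coverings n k"
  have finL: "finite ?L" by (rule card_labelled_coverings(1))
  show finH: "finite ?H" unfolding hurwitz_space_def by (rule finite_imageI[OF finL])
  have aut: "1 / real (aut_order (n, k, c)) = real (card c) / fact n" if "c \<in> ?H" for c
  proof -
    obtain X where X: "c = covering_class n X" using \<open>c \<in> ?H\<close> unfolding hurwitz_space_def by blast
    \<comment> \<open>\<open>aut_order\<close> refers to an arbitrary member of the class. Every
      member generates the same class, so the orbit formula applies to the chosen one.\<close>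
    let ?Y = "SOME Y. Y \<in> c"
    have "?Y \<in> c" by (rule someI[of _ X]) (simp add: X self_in_covering_class)
    hence "covering_class n ?Y = c" unfolding X by (rule covering_class_eq)
    hence eq: "card c * card (covering_aut n ?Y) = fact n" using orbit_stabilizer(2)[of n ?Y] by simp
    have "real (card c) * real (card (covering_aut n ?Y)) = fact n"
      unfolding of_nat_mult[symmetric] eq by simp
    hence "real (card c) * real (card (covering_aut n ?Y)) \<noteq> 0" by simp
    hence "real (card c) \<noteq> 0" "real (card (covering_aut n ?Y)) \<noteq> 0" unfolding mult_eq_0_iff by blast+
    thus ?thesis using \<open>real (card c) * _ = fact n\<close> by (simp add: field_simps)
  qed
  have union: "\<Union>?H = ?L"
  proof (intro equalityI subsetI)
    fix Y assume "Y \<in> \<Union>?H"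
    then obtain X where X: "X \<in> ?L" "Y \<in> covering_class n X" unfolding hurwitz_space_def by blast
    then obtain g where "g permutes {..<n}" "Y = relabel g X" unfolding covering_class_def by blast
    thus "Y \<in> ?L" using relabel_labelled[OF X(1)] by simp
  next
    fix Y assume "Y \<in> ?L"
    thus "Y \<in> \<Union>?H" unfolding hurwitz_space_def using self_in_covering_class[of Y n] by blast
  qed
  have "card (\<Union>?H) = (\<Sum>c\<in>?H. card c)"
  proof (rule card_Union_disjoint)
    show "pairwise disjnt ?H"
    proof (rule pairwiseI)
      fix c d assume "c \<in> ?H" "d \<in> ?H" "c \<noteq> d"
      then obtain X Y where XY: "c = covering_class n X" "d = covering_class n Y" unfolding hurwitz_space_def by blast
      show "disjnt c d"
      proof (rule ccontr)
        assume "\<not> disjnt c d"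
        then obtain Z where "Z \<in> c" "Z \<in> d" unfolding disjnt_def by blast
        thus False using covering_class_eq[of Z n X] covering_class_eq[of Z n Y] \<open>c \<noteq> d\<close> unfolding XY by simp
      qed
    qed
    show "finite c" if "c \<in> ?H" for c using that orbit_stabilizer(1) unfolding hurwitz_space_def by blast
  qed
  hence "(\<Sum>c\<in>?H. real (card c)) = real (card ?L)" unfolding union by simp
  moreover have "(\<Sum>c\<in>?H. 1 / real (aut_order (n, k, c))) = (\<Sum>c\<in>?H. real (card c)) / fact n"
    unfolding sum_divide_distrib by (intro sum.cong refl aut)
  ultimately show "(\<Sum>c\<in>?H. 1 / real (aut_order (n, k, c))) = (\<Sum>a\<in>partitions_of n. total_content a ^ k)"
    using card_labelled_coverings_contents[of n k] by simp
qed

section \<open>Integrals over coverings as sums over partitions\<close>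

lemma countable_partitions: "countable partitions"
  unfolding UN_partitions_of[symmetric]
  by (rule countable_UN) (auto intro: countable_finite finite_partitions_of)

lemma integral_count_space_eq_infsum:
  fixes f :: "'a \<Rightarrow> real"
  assumes "f summable_on A"
  shows "integral\<^sup>L (count_space A) f = infsum f A"
proof -
  have "(\<lambda>x. norm (f x)) summable_on A" using assms by (rule summable_on_iff_abs_summable_on_real[THEN iffD1])
  thus ?thesis unfolding infsetsum_def[symmetric]
    by (intro infsetsum_infsum abs_summable_equivalent[THEN iffD1])
qed

lemma integral_point_measure_eq_infsum:
  fixes f w :: "'a \<Rightarrow> real"
  assumes "\<And>x. x \<in> A \<Longrightarrow> w x \<ge> 0" "(\<lambda>x. w x * f x) summable_on A"
  shows "integral\<^sup>L (point_measure A (\<lambda>x. ennreal (w x))) f = (\<Sum>\<^sub>\<infinity>x\<in>A. w x * f x)"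
proof -
  have "integral\<^sup>L (point_measure A (\<lambda>x. ennreal (w x))) f = integral\<^sup>L (count_space A) (\<lambda>x. w x *\<^sub>R f x)"
    unfolding point_measure_def by (intro integral_density) (use assms in \<open>auto intro!: AE_I2\<close>)
  also have "\<dots> = integral\<^sup>L (count_space A) (\<lambda>x. w x * f x)" by simp
  also have "\<dots> = (\<Sum>\<^sub>\<infinity>x\<in>A. w x * f x)" by (rule integral_count_space_eq_infsum[OF assms(2)])
  finally show ?thesis .
qed

lemma sigma_finite_point_measure:
  assumes "countable A"
  shows "sigma_finite_measure (point_measure A (\<lambda>x. ennreal (w x)))"
proof -
  interpret sigma_finite_measure "count_space A" by (rule sigma_finite_measure_count_space_countable[OF assms])
  show ?thesis unfolding point_measure_def
    by (subst sigma_finite_iff_density_finite) (auto intro!: AE_I2)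
qed

lemma pair_point_measure:
  assumes "countable A" "countable B" "\<And>x. x \<in> A \<Longrightarrow> v x \<ge> 0"
  shows "point_measure A (\<lambda>x. ennreal (v x)) \<Otimes>\<^sub>M point_measure B (\<lambda>x. ennreal (w x))
    = point_measure (A \<times> B) (\<lambda>z. ennreal (v (fst z) * w (snd z)))"
proof -
  have "point_measure A (\<lambda>x. ennreal (v x)) \<Otimes>\<^sub>M point_measure B (\<lambda>x. ennreal (w x))
    = density (count_space A \<Otimes>\<^sub>M count_space B) (\<lambda>(x, y). ennreal (v x) * ennreal (w y))"
    using sigma_finite_point_measure[OF assms(2)] sigma_finite_measure_count_space_countable[OF assms(2)]
    unfolding point_measure_def by (intro pair_measure_density) auto
  also have "\<dots> = density (count_space (A \<times> B)) (\<lambda>z. ennreal (v (fst z) * w (snd z)))"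
    unfolding pair_measure_countable[OF assms(1,2)]
    by (intro density_cong AE_I2) (use assms(3) in \<open>auto simp: ennreal_mult'\<close>)
  finally show ?thesis by (simp add: point_measure_def)
qed

lemma sigma_finite_countable_space:
  fixes f :: "'a \<Rightarrow> 'b :: countable"
  assumes "\<And>y. emeasure (distr M (count_space UNIV) f) {y} \<noteq> \<infinity>"
  shows "sigma_finite_measure (distr M (count_space UNIV) f)"
proof
  show "\<exists>A. countable A \<and> A \<subseteq> sets (distr M (count_space UNIV) f) \<and> \<Union> A = space (distr M (count_space UNIV) f)
      \<and> (\<forall>a\<in>A. emeasure (distr M (count_space UNIV) f) a \<noteq> \<infinity>)"
    using assms by (intro exI[of _ "range (\<lambda>y. {y})"]) auto
qed

text \<open>On the countable target every function is measurable. Sigma-finiteness of the image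
  identifies the product of the images with the image of the product.\<close>

lemma integral_pair_push:
  fixes f :: "'a \<Rightarrow> 'b :: countable" and F :: "'b \<times> 'b \<Rightarrow> real"
  assumes f: "f \<in> measurable M (count_space UNIV)"
    and sf: "sigma_finite_measure (distr M (count_space UNIV) f)"
  shows "(\<integral>z. F (f (fst z), f (snd z)) \<partial>(M \<Otimes>\<^sub>M M))
    = integral\<^sup>L (distr M (count_space UNIV) f \<Otimes>\<^sub>M distr M (count_space UNIV) f) F"
proof -
  let ?C = "count_space (UNIV :: 'b set)"
  have "?C \<Otimes>\<^sub>M ?C = count_space (UNIV \<times> UNIV)" by (rule pair_measure_countable) simp_all
  hence meas: "F \<in> borel_measurable (?C \<Otimes>\<^sub>M ?C)" by simp
  have fm: "(\<lambda>(x, y). (f x, f y)) \<in> measurable (M \<Otimes>\<^sub>M M) (?C \<Otimes>\<^sub>M ?C)"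
    using f by measurable
  show ?thesis unfolding pair_measure_distr[OF f f sf] integral_distr[OF fm meas]
    by (simp only: case_prod_beta)
qed

section \<open>The measure on partitions that replaces the one on coverings\<close>

definition content_weight :: "real \<Rightarrow> (nat \<Rightarrow> nat) \<times> nat \<Rightarrow> real" where
  "content_weight t x = q_of t ^ psize (fst x) * (t ^ snd x / fact (snd x)) * total_content (fst x) ^ snd x"

definition content_index :: "((nat \<Rightarrow> nat) \<times> nat) set" where
  "content_index = partitions \<times> {k. even k}"

lemma countable_content_index: "countable content_index"
  unfolding content_index_def by (intro countable_SIGMA countable_partitions) simp

text \<open>Contents can be negative; the even exponents in \<open>content_index\<close> are what
  makes this a measure.\<close>

lemma content_weight_nonneg:
  assumes "t > 0" "x \<in> content_index"
  shows "content_weight t x \<ge> 0"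
proof -
  have "total_content (fst x) ^ snd x \<ge> 0"
    using assms by (auto simp: content_index_def intro: zero_le_even_power)
  thus ?thesis using assms by (simp add: content_weight_def q_of_def)
qed

lemma measurable_rho: "f \<in> measurable (rho t) (count_space UNIV)"
  by (simp add: rho_def)

text \<open>Coverings and partitions are not matched one by one. The two measures only give the same
  mass to each fibre over degree and ramification number, and this is all that integrands in these
  two numbers see.\<close>

lemma distr_rho:
  assumes t: "t > 0"
  shows "distr (rho t) (count_space UNIV) (\<lambda>X. (cov_deg X, ramification_count X))
    = distr (point_measure content_index (\<lambda>x. ennreal (content_weight t x))) (count_space UNIV) (\<lambda>x. (psize (fst x), snd x))"
proof (rule measure_eqI_countable[of _ UNIV])
  fix y :: "nat \<times> nat"
  obtain n k where y: "y = (n, k)" by (cases y)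
  define w where "w = q_of t ^ n * (t ^ k / fact k)"
  have w: "w \<ge> 0" using t by (simp add: w_def q_of_def)
  let ?w = "\<lambda>X. ennreal (q_of t ^ cov_deg X * (t ^ ramification_count X / fact (ramification_count X)) * (1 / real (aut_order X)))"
  let ?A = "{X \<in> ramified_coverings. (cov_deg X, ramification_count X) = y}"
  let ?B = "{x \<in> content_index. (psize (fst x), snd x) = y}"
  have A: "?A = (if even k then (\<lambda>c. (n, k, c)) ` hurwitz_space n k else {})"
    by (auto simp: ramified_coverings_def y)
  have B: "?B = (if even k then (\<lambda>a. (a, k)) ` partitions_of n else {})"
    by (auto simp: content_index_def partitions_of_def y)
  have finA: "finite ?A" unfolding A using hurwitz_space_props(1) by simp
  have finB: "finite ?B" unfolding B using finite_partitions_of by simp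
  have "emeasure (distr (rho t) (count_space UNIV) (\<lambda>X. (cov_deg X, ramification_count X))) {y} = emeasure (rho t) ?A"
  proof -
    have "(\<lambda>X. (cov_deg X, ramification_count X)) -` {y} \<inter> space (rho t) = ?A"
      unfolding rho_def space_point_measure by blast
    thus ?thesis by (subst emeasure_distr) (simp_all only: measurable_rho sets_count_space Pow_UNIV UNIV_I)
  qed
  also have "\<dots> = (\<Sum>X\<in>?A. ?w X)"
    unfolding rho_def by (rule emeasure_point_measure_finite2[OF _ finA]) auto
  also have "\<dots> = (\<Sum>x\<in>?B. ennreal (content_weight t x))"
  proof (cases "even k")
    case True
    have "(\<Sum>X\<in>?A. ?w X) = (\<Sum>c\<in>hurwitz_space n k. ennreal (w * (1 / real (aut_order (n, k, c)))))"
      unfolding A if_P[OF True] by (subst sum.reindex) (auto simp: inj_on_def w_def simp del: aut_order.simps)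
    also have "\<dots> = ennreal (w * (\<Sum>c\<in>hurwitz_space n k. 1 / real (aut_order (n, k, c))))"
      unfolding sum_distrib_left using w by (intro sum_ennreal) simp
    also have "\<dots> = ennreal (\<Sum>a\<in>partitions_of n. w * total_content a ^ k)"
      unfolding hurwitz_space_props(2) sum_distrib_left ..
    also have "\<dots> = (\<Sum>a\<in>partitions_of n. ennreal (w * total_content a ^ k))"
      using w True by (intro sum_ennreal[symmetric] mult_nonneg_nonneg zero_le_even_power)
    also have "\<dots> = (\<Sum>x\<in>?B. ennreal (content_weight t x))"
      unfolding B if_P[OF True]
      by (subst sum.reindex) (auto simp: inj_on_def content_weight_def w_def partitions_of_def intro!: sum.cong)
    finally show ?thesis .
  next
    case False
    thus ?thesis unfolding A B by simp
  qed
  also have "\<dots> = emeasure (point_measure content_index (\<lambda>x. ennreal (content_weight t x))) ?B"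
    by (rule emeasure_point_measure_finite2[OF _ finB, symmetric]) auto
  also have "\<dots> = emeasure (distr (point_measure content_index (\<lambda>x. ennreal (content_weight t x))) (count_space UNIV)
      (\<lambda>x. (psize (fst x), snd x))) {y}"
  proof -
    have "(\<lambda>x. (psize (fst x), snd x)) -` {y} \<inter> space (point_measure content_index (\<lambda>x. ennreal (content_weight t x))) = ?B"
      unfolding space_point_measure by blast
    thus ?thesis by (subst emeasure_distr) (simp_all only: measurable_point_measure_eq1 space_count_space sets_count_space Pow_UNIV UNIV_I Pi_UNIV)
  qed
  finally show "emeasure (distr (rho t) (count_space UNIV) (\<lambda>X. (cov_deg X, ramification_count X))) {y}
    = emeasure (distr (point_measure content_index (\<lambda>x. ennreal (content_weight t x))) (count_space UNIV)
      (\<lambda>x. (psize (fst x), snd x))) {y}" .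
qed simp_all

lemma integral_rho:
  fixes F :: "nat \<times> nat \<Rightarrow> real"
  assumes t: "t > 0"
    and sm: "(\<lambda>x. content_weight t x * F (psize (fst x), snd x)) summable_on content_index"
  shows "(\<integral>X. F (cov_deg X, ramification_count X) \<partial>(rho t))
    = (\<Sum>\<^sub>\<infinity>x\<in>content_index. content_weight t x * F (psize (fst x), snd x))"
proof -
  let ?M = "point_measure content_index (\<lambda>x. ennreal (content_weight t x))"
  have "(\<integral>X. F (cov_deg X, ramification_count X) \<partial>(rho t))
    = integral\<^sup>L (distr (rho t) (count_space UNIV) (\<lambda>X. (cov_deg X, ramification_count X))) F"
    by (subst integral_distr) (auto simp: rho_def)
  also have "\<dots> = (\<integral>x. F (psize (fst x), snd x) \<partial>?M)"
    unfolding distr_rho[OF t] by (subst integral_distr) auto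
  also have "\<dots> = (\<Sum>\<^sub>\<infinity>x\<in>content_index. content_weight t x * F (psize (fst x), snd x))"
    by (rule integral_point_measure_eq_infsum) (use t sm content_weight_nonneg in auto)
  finally show ?thesis .
qed

lemma integral_rho_pair:
  fixes F :: "(nat \<times> nat) \<times> (nat \<times> nat) \<Rightarrow> real"
  assumes t: "t > 0"
    and sm: "(\<lambda>z. content_weight t (fst z) * content_weight t (snd z)
        * F ((psize (fst (fst z)), snd (fst z)), (psize (fst (snd z)), snd (snd z))))
      summable_on (content_index \<times> content_index)"
  shows "(\<integral>X. F ((cov_deg (fst X), ramification_count (fst X)), (cov_deg (snd X), ramification_count (snd X)))
      \<partial>(rho t \<Otimes>\<^sub>M rho t))
    = (\<Sum>\<^sub>\<infinity>z\<in>content_index \<times> content_index. content_weight t (fst z) * content_weight t (snd z)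
        * F ((psize (fst (fst z)), snd (fst z)), (psize (fst (snd z)), snd (snd z))))"
proof -
  let ?M = "point_measure content_index (\<lambda>x. ennreal (content_weight t x))"
  let ?C = "count_space (UNIV :: (nat \<times> nat) set)"
  define phi where "phi X = (cov_deg X, ramification_count X)" for X :: covering
  define psi where "psi x = (psize (fst x), snd x)" for x :: "(nat \<Rightarrow> nat) \<times> nat"
  have phi: "phi \<in> measurable (rho t) ?C" by (simp add: rho_def)
  have psi: "psi \<in> measurable ?M ?C" by simp
  have eq: "distr (rho t) ?C phi = distr ?M ?C psi"
    using distr_rho[OF t] unfolding phi_def psi_def .
  \<comment> \<open>A fibre consists of partitions of one size with one exponent, hence is finite.
    This supplies the sigma-finiteness needed for the product.\<close>
  have fin: "emeasure (distr ?M ?C psi) {y} \<noteq> \<infinity>" for y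
  proof -
    let ?B = "{x \<in> content_index. psi x = y}"
    have "?B \<subseteq> partitions_of (fst y) \<times> {snd y}"
    proof
      fix x assume "x \<in> ?B"
      hence x: "x \<in> content_index" and eq: "psi x = y" by blast+
      have "psize (fst x) = fst y" "snd x = snd y" unfolding eq[symmetric] psi_def by simp_all
      moreover have "fst x \<in> partitions" using x unfolding content_index_def mem_Times_iff by blast
      ultimately show "x \<in> partitions_of (fst y) \<times> {snd y}" unfolding mem_Times_iff partitions_of_def by blast
    qed
    hence finB: "finite ?B" by (rule finite_subset) (intro finite_cartesian_product finite_partitions_of finite.intros)
    have "psi -` {y} \<inter> space ?M = ?B" unfolding space_point_measure by blast
    hence "emeasure (distr ?M ?C psi) {y} = emeasure ?M ?B" by (subst emeasure_distr[OF psi]) simp_all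
    also have "\<dots> = (\<Sum>x\<in>?B. ennreal (content_weight t x))"
      by (rule emeasure_point_measure_finite2[OF _ finB]) blast
    also have "\<dots> = ennreal (\<Sum>x\<in>?B. content_weight t x)"
      by (rule sum_ennreal) (blast intro: content_weight_nonneg[OF t])
    finally show ?thesis by (simp only: infinity_ennreal_def ennreal_neq_top not_False_eq_True)
  qed
  have sf: "sigma_finite_measure (distr ?M ?C psi)" by (rule sigma_finite_countable_space[OF fin])
  have pm: "?M \<Otimes>\<^sub>M ?M = point_measure (content_index \<times> content_index)
      (\<lambda>z. ennreal (content_weight t (fst z) * content_weight t (snd z)))"
    by (rule pair_point_measure[OF countable_content_index countable_content_index content_weight_nonneg[OF t]])
  have "(\<integral>X. F (phi (fst X), phi (snd X)) \<partial>(rho t \<Otimes>\<^sub>M rho t))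
    = integral\<^sup>L (distr (rho t) ?C phi \<Otimes>\<^sub>M distr (rho t) ?C phi) F"
    using phi sf unfolding eq[symmetric] by (rule integral_pair_push)
  also have "\<dots> = (\<integral>z. F (psi (fst z), psi (snd z)) \<partial>(?M \<Otimes>\<^sub>M ?M))"
    unfolding eq using psi sf by (rule integral_pair_push[symmetric])
  also have "\<dots> = (\<Sum>\<^sub>\<infinity>z\<in>content_index \<times> content_index. content_weight t (fst z) * content_weight t (snd z)
        * F (psi (fst z), psi (snd z)))"
    unfolding pm
  proof (rule integral_point_measure_eq_infsum)
    fix z assume "z \<in> content_index \<times> content_index"
    hence "fst z \<in> content_index" "snd z \<in> content_index" by (simp_all only: mem_Times_iff)
    thus "content_weight t (fst z) * content_weight t (snd z) \<ge> 0"
      using content_weight_nonneg[OF t] mult_nonneg_nonneg by blast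
  next
    show "(\<lambda>z. content_weight t (fst z) * content_weight t (snd z) * F (psi (fst z), psi (snd z)))
      summable_on content_index \<times> content_index"
      unfolding psi_def by (rule sm)
  qed
  finally show ?thesis unfolding phi_def psi_def .
qed

section \<open>Summability over partitions\<close>

lemma sum_power_le_geometric:
  fixes x :: real
  assumes "0 \<le> x" "x < 1" "finite C"
  shows "(\<Sum>c\<in>C. x ^ c) \<le> 1 / (1 - x)"
proof -
  have "(\<Sum>c\<in>C. x ^ c) \<le> (\<Sum>c. x ^ c)"
    using assms by (intro sum_le_suminf summable_geometric) auto
  also have "\<dots> = 1 / (1 - x)" using assms by (intro suminf_geometric) simp
  finally show ?thesis .
qed

text \<open>Turns the product of the factors 1 / (1 - z^i) of the generating function of partitions
  into the exponential of a geometric sum, whose bound does not depend on the number of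
  factors.\<close>

lemma inverse_one_minus_le_exp:
  fixes y z :: real
  assumes "0 < y" "y \<le> z" "z < 1"
  shows "1 / (1 - y) \<le> exp (y / (1 - z))"
proof -
  have "1 / (1 - y) = 1 + y / (1 - y)" using assms by (simp add: field_simps)
  also have "\<dots> \<le> 1 + y / (1 - z)"
    using assms by (intro add_left_mono divide_left_mono mult_pos_pos) linarith+
  also have "\<dots> \<le> exp (y / (1 - z))" by (rule exp_ge_add_one_self)
  finally show ?thesis .
qed

text \<open>Subtracting the last of m + 1 rows from all of them leaves a partition with at most m
  rows and removes m + 1 times the length of that row: one factor of the generating function per
  step.\<close>

lemma sum_bounded_partitions_le:
  fixes z :: real
  assumes z: "0 < z" "z < 1"
  shows "finite F \<Longrightarrow> F \<subseteq> {a. antimono a \<and> (\<forall>i\<ge>m. a i = 0)} \<Longrightarrow>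
    (\<Sum>a\<in>F. z ^ psize a) \<le> exp (\<Sum>i<m. z ^ Suc i / (1 - z))"
proof (induction m arbitrary: F)
  case 0
  have "F \<subseteq> {\<lambda>_. 0}" using 0(2) by auto
  hence "(\<Sum>a\<in>F. z ^ psize a) \<le> (\<Sum>a\<in>{\<lambda>_. 0}. z ^ psize a)" using z by (intro sum_mono2) auto
  thus ?case by (simp add: psize_def)
next
  case (Suc m)
  define sub where "sub a = (\<lambda>i. if i < m then a i - a m else (0::nat))" for a
  define ext where "ext x = (\<lambda>i. if i \<le> m then snd x i + fst x else 0)" for x :: "nat \<times> (nat \<Rightarrow> nat)"
  let ?C = "(\<lambda>a. a m) ` F" and ?G = "sub ` F"
  have ext: "ext (a m, sub a) = a" if "a \<in> F" for a
  proof
    fix i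
    have a: "antimono a" "\<forall>i\<ge>Suc m. a i = 0" using that Suc(3) by auto
    have "a m \<le> a i" if "i < m" using antimonoD[OF a(1), of i m] that by simp
    thus "ext (a m, sub a) i = a i" using a(2) by (auto simp: ext_def sub_def not_le Suc_le_eq)
  qed
  have G: "?G \<subseteq> {a. antimono a \<and> (\<forall>i\<ge>m. a i = 0)}"
  proof clarify
    fix a assume "a \<in> F"
    hence a: "antimono a" using Suc(3) by auto
    have "antimono (sub a)"
    proof (rule antimonoI)
      fix i j :: nat assume "i \<le> j"
      thus "sub a j \<le> sub a i" using antimonoD[OF a \<open>i \<le> j\<close>] by (simp add: sub_def diff_le_mono)
    qed
    thus "antimono (sub a) \<and> (\<forall>i\<ge>m. sub a i = 0)" by (simp add: sub_def)
  qed
  have size: "psize (ext (c, b)) = Suc m * c + psize b" if "\<forall>i\<ge>m. b i = 0" for c b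
  proof -
    have "psize (ext (c, b)) = (\<Sum>i<Suc m. ext (c, b) i)" by (rule psize_eq) (simp add: ext_def)
    also have "\<dots> = (\<Sum>i<Suc m. b i + c)" by (intro sum.cong) (auto simp: ext_def)
    also have "\<dots> = Suc m * c + (\<Sum>i<Suc m. b i)" by (simp add: sum.distrib)
    also have "(\<Sum>i<Suc m. b i) = psize b" by (rule psize_eq[symmetric]) (use that in auto)
    finally show ?thesis .
  qed
  have "(\<Sum>a\<in>F. z ^ psize a) \<le> (\<Sum>a\<in>ext ` (?C \<times> ?G). z ^ psize a)"
  proof (rule sum_mono2)
    show "F \<subseteq> ext ` (?C \<times> ?G)"
    proof
      fix a assume a: "a \<in> F"
      thus "a \<in> ext ` (?C \<times> ?G)" by (intro image_eqI[where x = "(a m, sub a)"]) (auto simp: ext)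
    qed
  qed (use Suc z in auto)
  also have "\<dots> \<le> sum ((\<lambda>a. z ^ psize a) \<circ> ext) (?C \<times> ?G)"
    by (rule sum_image_le) (use Suc.prems z in simp_all)
  also have "\<dots> = (\<Sum>x\<in>?C \<times> ?G. z ^ psize (ext x))" by (simp add: o_def)
  also have "\<dots> = (\<Sum>x\<in>?C \<times> ?G. (z ^ Suc m) ^ fst x * z ^ psize (snd x))"
  proof (intro sum.cong refl)
    fix x assume "x \<in> ?C \<times> ?G"
    hence "snd x \<in> ?G" unfolding mem_Times_iff by (rule conjunct2)
    hence "snd x \<in> {a. antimono a \<and> (\<forall>i\<ge>m. a i = 0)}" by (rule subsetD[OF G])
    hence b0: "\<forall>i\<ge>m. snd x i = 0" by simp
    show "z ^ psize (ext x) = (z ^ Suc m) ^ fst x * z ^ psize (snd x)"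
      using size[OF b0, of "fst x"] unfolding prod.collapse by (simp only: power_add power_mult)
  qed
  also have "\<dots> = (\<Sum>c\<in>?C. (z ^ Suc m) ^ c) * (\<Sum>b\<in>?G. z ^ psize b)"
    unfolding sum_product sum.cartesian_product by (simp add: case_prod_beta)
  also have "\<dots> \<le> exp (z ^ Suc m / (1 - z)) * exp (\<Sum>i<m. z ^ Suc i / (1 - z))"
  proof (intro mult_mono)
    have y: "0 < z ^ Suc m" "z ^ Suc m \<le> z" "z ^ Suc m < 1"
      using z power_le_one[of z m] power_Suc_less_one[of z m] by (simp_all add: mult_left_le)
    have "(\<Sum>c\<in>?C. (z ^ Suc m) ^ c) \<le> 1 / (1 - z ^ Suc m)"
      by (rule sum_power_le_geometric[OF less_imp_le[OF y(1)] y(3) finite_imageI[OF Suc.prems(1)]])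
    also have "\<dots> \<le> exp (z ^ Suc m / (1 - z))" by (rule inverse_one_minus_le_exp[OF y(1,2) z(2)])
    finally show "(\<Sum>c\<in>?C. (z ^ Suc m) ^ c) \<le> exp (z ^ Suc m / (1 - z))" .
    show "(\<Sum>b\<in>?G. z ^ psize b) \<le> exp (\<Sum>i<m. z ^ Suc i / (1 - z))"
      by (rule Suc.IH[OF finite_imageI[OF Suc.prems(1)] G])
    show "0 \<le> exp (z ^ Suc m / (1 - z))" by (rule exp_ge_zero)
    show "0 \<le> (\<Sum>b\<in>?G. z ^ psize b)" by (intro sum_nonneg zero_le_power less_imp_le z)
  qed
  also have "\<dots> = exp (\<Sum>i<Suc m. z ^ Suc i / (1 - z))"
    unfolding sum.lessThan_Suc exp_add by (rule mult.commute)
  finally show ?case .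
qed

lemma summable_on_partitions:
  fixes z :: real
  assumes z: "0 < z" "z < 1"
  shows "(\<lambda>a. z ^ psize a) summable_on partitions"
proof (rule nonneg_bdd_above_summable_on)
  show "bdd_above (sum (\<lambda>a. z ^ psize a) ` {F. F \<subseteq> partitions \<and> finite F})"
  proof (rule bdd_aboveI2)
    fix F assume "F \<in> {F. F \<subseteq> partitions \<and> finite F}"
    hence F: "F \<subseteq> partitions" "finite F" by simp_all
    let ?U = "\<Union>a\<in>F. {i. a i \<noteq> 0}"
    have "finite ?U"
    proof (rule finite_UN_I[OF F(2)])
      fix a assume "a \<in> F"
      hence "a \<in> partitions" using F(1) by (rule rev_subsetD)
      thus "finite {i. a i \<noteq> 0}" by (simp add: partitions_def)
    qed
    hence "\<exists>m. \<forall>i\<in>?U. i < m" by (rule finite_nat_set_iff_bounded[THEN iffD1])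
    then obtain m where m: "\<forall>i\<in>?U. i < m" ..
    have "F \<subseteq> {a. antimono a \<and> (\<forall>i\<ge>m. a i = 0)}"
    proof
      fix a assume a: "a \<in> F"
      have "a i = 0" if "i \<ge> m" for i
      proof (rule ccontr)
        assume "a i \<noteq> 0"
        hence "i \<in> ?U" using a by (intro UN_I[of a]) simp_all
        hence "i < m" by (rule m[rule_format])
        thus False using that by simp
      qed
      moreover have "a \<in> partitions" using a F(1) by (rule rev_subsetD)
      ultimately show "a \<in> {a. antimono a \<and> (\<forall>i\<ge>m. a i = 0)}" by (simp add: partitions_def)
    qed
    from sum_bounded_partitions_le[OF z F(2) this]
    have "(\<Sum>a\<in>F. z ^ psize a) \<le> exp (\<Sum>i<m. z ^ Suc i / (1 - z))" .
    also have "(\<Sum>i<m. z ^ Suc i / (1 - z)) = z / (1 - z) * (\<Sum>i<m. z ^ i)"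
      by (simp add: sum_distrib_left)
    also have "\<dots> \<le> z / (1 - z) * (1 / (1 - z))"
      using z by (intro mult_left_mono sum_power_le_geometric) auto
    finally show "(\<Sum>a\<in>F. z ^ psize a) \<le> exp (z / (1 - z) * (1 / (1 - z)))" by simp
  qed
qed (use z in auto)

lemma power_div_fact_le_exp:
  fixes x :: real
  assumes "x \<ge> 0"
  shows "x ^ r / fact r \<le> exp x"
proof -
  have s: "(\<lambda>n. x ^ n /\<^sub>R fact n) sums exp x" by (rule exp_converges)
  have "(\<Sum>n\<in>{r}. x ^ n /\<^sub>R fact n) \<le> (\<Sum>n. x ^ n /\<^sub>R fact n)"
    using assms s by (intro sum_le_suminf) (auto simp: sums_iff)
  also have "\<dots> = exp x" using s by (simp add: sums_iff)
  finally show ?thesis by (simp add: divide_inverse mult.commute)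
qed

lemma polynomial_times_power_bounded:
  fixes s :: real
  assumes s: "0 < s" "s < 1"
  shows "\<exists>K>0. \<forall>n. (1 + real n) ^ r * s ^ n \<le> K"
proof -
  define e where "e = - ln s"
  have e: "e > 0" using s by (simp add: e_def)
  have "(1 + real n) ^ r * s ^ n \<le> fact r * exp e / e ^ r" for n
  proof -
    have "(e * (1 + real n)) ^ r / fact r \<le> exp (e * (1 + real n))"
      using e by (intro power_div_fact_le_exp) simp
    hence "e ^ r * (1 + real n) ^ r \<le> exp (e * (1 + real n)) * fact r"
      unfolding power_mult_distrib by (subst (asm) pos_divide_le_eq) simp_all
    hence "(1 + real n) ^ r \<le> fact r * exp (e * (1 + real n)) / e ^ r"
      using e by (subst pos_le_divide_eq) (simp_all add: mult.commute)
    hence "(1 + real n) ^ r * s ^ n \<le> fact r * exp (e * (1 + real n)) / e ^ r * s ^ n"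
      using s by (intro mult_right_mono) auto
    also have "\<dots> = fact r * (exp (e * (1 + real n)) * s ^ n) / e ^ r" by simp
    also have "exp (e * (1 + real n)) * s ^ n = exp e"
    proof -
      have "s = exp (- e)" using s by (simp add: e_def)
      hence "s ^ n = exp (real n * (- e))" by (simp only: exp_of_nat_mult)
      hence "exp (e * (1 + real n)) * s ^ n = exp (e * (1 + real n) + real n * (- e))" by (simp only: exp_add)
      also have "e * (1 + real n) + real n * (- e) = e" by (simp add: algebra_simps)
      finally show ?thesis .
    qed
    finally show ?thesis .
  qed
  moreover have "fact r * exp e / e ^ r > 0" using e by simp
  ultimately show ?thesis by blast
qed

text \<open>Of the two factors in z = s * s, one absorbs the polynomial and the other keeps the sum
  finite.\<close>

lemma summable_on_moments:
  fixes deg :: "'i \<Rightarrow> nat"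
  assumes sm: "\<And>z::real. 0 < z \<Longrightarrow> z < 1 \<Longrightarrow> (\<lambda>i. z ^ deg i) summable_on I"
    and z: "0 < z" "z < 1"
  shows "(\<lambda>i. z ^ deg i * (1 + real (deg i)) ^ r) summable_on I"
proof -
  define s where "s = sqrt z"
  have s: "0 < s" "s < 1" "z = s * s" using z by (auto simp: s_def)
  obtain K where K: "K > 0" "\<And>n. (1 + real n) ^ r * s ^ n \<le> K"
    using polynomial_times_power_bounded[OF s(1,2), of r] by blast
  have "(\<lambda>i. K * s ^ deg i) summable_on I" by (intro summable_on_cmult_right sm s)
  thus ?thesis
  proof (rule summable_on_comparison_test)
    fix i
    have "z ^ deg i * (1 + real (deg i)) ^ r = ((1 + real (deg i)) ^ r * s ^ deg i) * s ^ deg i"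
      by (simp add: s(3) power_mult_distrib)
    also have "\<dots> \<le> K * s ^ deg i" using s K(2)[of "deg i"] by (intro mult_right_mono) auto
    finally show "z ^ deg i * (1 + real (deg i)) ^ r \<le> K * s ^ deg i" .
    show "0 \<le> z ^ deg i * (1 + real (deg i)) ^ r" using z by simp
  qed
qed

text \<open>The point in the Lagrange remainder lies below max 0 x, so the bound is one-sided. A
  weight w then only has to dominate w and w * exp x, however negative x is.\<close>

lemma exp_taylor_bound:
  fixes x :: real
  shows "\<bar>exp x - (\<Sum>j<M. x ^ j / fact j)\<bar> \<le> \<bar>x\<bar> ^ M * max 1 (exp x)"
proof -
  have "\<exists>t. t \<le> max 0 x \<and> exp x = (\<Sum>j<M. x ^ j / fact j) + exp t / fact M * x ^ M"
  proof (cases "x \<ge> 0")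
    case True
    obtain t where "\<bar>t\<bar> \<le> \<bar>x\<bar>" "exp x = (\<Sum>j<M. x ^ j / fact j) + exp t / fact M * x ^ M"
      using Maclaurin_exp_le[of x M] by auto
    thus ?thesis using True by (intro exI[of _ t]) auto
  next
    case False
    show ?thesis
    proof (cases "M = 0")
      case True
      thus ?thesis using False by (intro exI[of _ x]) auto
    next
      case M: False
      \<comment> \<open>\<open>Maclaurin_exp_le\<close> bounds only the absolute value of the point;
        for negative x a negative point is wanted.\<close>
      have "\<exists>t. x < t \<and> t < 0 \<and> exp x = (\<Sum>m<M. exp 0 / fact m * x ^ m) + exp t / fact M * x ^ M"
        by (rule Maclaurin_minus[where diff = "\<lambda>_. exp"]) (use False M in \<open>auto intro: DERIV_exp\<close>)
      then obtain t where "x < t" "t < 0" "exp x = (\<Sum>m<M. exp 0 / fact m * x ^ m) + exp t / fact M * x ^ M" by blast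
      thus ?thesis by (intro exI[of _ t]) auto
    qed
  qed
  then obtain t where t: "t \<le> max 0 x" "exp x = (\<Sum>j<M. x ^ j / fact j) + exp t / fact M * x ^ M" by blast
  have "\<bar>exp x - (\<Sum>j<M. x ^ j / fact j)\<bar> = exp t / fact M * \<bar>x\<bar> ^ M"
    using t(2) by (simp add: abs_mult power_abs)
  also have "\<dots> \<le> exp t / 1 * \<bar>x\<bar> ^ M"
    using fact_ge_1[of M, where ?'a = real] by (intro mult_right_mono divide_left_mono) auto
  also have "exp t \<le> exp (max 0 x)" using t(1) by simp
  also have "exp (max 0 x) = max 1 (exp x)" by (auto simp: max_def)
  finally show ?thesis by (simp add: mult.commute mult_right_mono)
qed

section \<open>Taylor expansion of a family of exponentials\<close>

lemma infsum_diff_real: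
  fixes f g :: "'a \<Rightarrow> real"
  assumes "f summable_on A" "g summable_on A"
  shows "infsum f A - infsum g A = (\<Sum>\<^sub>\<infinity>x\<in>A. f x - g x)" "(\<lambda>x. f x - g x) summable_on A"
proof -
  have g: "(\<lambda>x. - g x) summable_on A" using assms(2) by (simp add: summable_on_uminus)
  show "infsum f A - infsum g A = (\<Sum>\<^sub>\<infinity>x\<in>A. f x - g x)"
    using infsum_add[OF assms(1) g] by (simp add: infsum_uminus)
  show "(\<lambda>x. f x - g x) summable_on A" using summable_on_add[OF assms(1) g] by simp
qed

text \<open>Equivalent to subexponential growth of the number of indices of a given degree. By
  \<open>summable_on_moments\<close> it yields all polynomial moments.\<close>

definition tame :: "('i \<Rightarrow> nat) \<Rightarrow> 'i set \<Rightarrow> bool" where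
  "tame deg I \<longleftrightarrow> (\<forall>z::real. 0 < z \<longrightarrow> z < 1 \<longrightarrow> (\<lambda>i. z ^ deg i) summable_on I)"

lemma tame_bound:
  fixes f :: "'i \<Rightarrow> real"
  assumes tame: "tame deg I" and z: "0 < z" "z < 1"
    and f: "\<And>i. i \<in> I \<Longrightarrow> \<bar>f i\<bar> \<le> e * (z ^ deg i * (1 + real (deg i)) ^ r)"
  shows "f summable_on I" "\<bar>infsum f I\<bar> \<le> e * (\<Sum>\<^sub>\<infinity>i\<in>I. z ^ deg i * (1 + real (deg i)) ^ r)"
proof -
  have sm: "(\<lambda>i. z ^ deg i * (1 + real (deg i)) ^ r) summable_on I"
    by (rule summable_on_moments[OF _ z]) (use tame in \<open>simp add: tame_def\<close>)
  hence sm': "(\<lambda>i. e * (z ^ deg i * (1 + real (deg i)) ^ r)) summable_on I" by (rule summable_on_cmult_right)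
  have abs: "(\<lambda>i. \<bar>f i\<bar>) summable_on I"
    by (rule summable_on_comparison_test[OF sm']) (use f in simp_all)
  hence nrm: "(\<lambda>i. norm (f i)) summable_on I" by simp
  show "f summable_on I" by (rule summable_on_iff_abs_summable_on_real[THEN iffD2, OF nrm])
  have "\<bar>infsum f I\<bar> \<le> (\<Sum>\<^sub>\<infinity>i\<in>I. \<bar>f i\<bar>)" using norm_infsum_bound[OF nrm] by simp
  also have "\<dots> \<le> (\<Sum>\<^sub>\<infinity>i\<in>I. e * (z ^ deg i * (1 + real (deg i)) ^ r))"
    by (rule infsum_mono[OF abs sm']) (rule f)
  also have "\<dots> = e * (\<Sum>\<^sub>\<infinity>i\<in>I. z ^ deg i * (1 + real (deg i)) ^ r)" by (rule infsum_cmult_right[OF sm])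
  finally show "\<bar>infsum f I\<bar> \<le> e * (\<Sum>\<^sub>\<infinity>i\<in>I. z ^ deg i * (1 + real (deg i)) ^ r)" .
qed

text \<open>I indexes the expansion and J N the trace at size N. On J N the hypotheses dominate both
  terms of the one-sided remainder. Outside J N the exponential may be huge but does not occur; only
  the polynomial must be small there, and the last hypothesis trades each factor 1/N for a factor 1
  + deg.\<close>

lemma taylor_family:
  fixes deg :: "'i \<Rightarrow> nat" and w x :: "nat \<Rightarrow> 'i \<Rightarrow> real"
  assumes tame: "tame deg I" and z: "0 < z" "z < 1" and B: "B \<ge> 0" and c: "c \<ge> 0"
    and J: "\<And>N. J N \<subseteq> I"
    and pos: "\<And>N. Adm N \<Longrightarrow> N \<ge> 1"
    and w: "\<And>N i. Adm N \<Longrightarrow> i \<in> I \<Longrightarrow> 0 \<le> w N i \<and> w N i \<le> z ^ deg i"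
    and x: "\<And>N i. Adm N \<Longrightarrow> i \<in> I \<Longrightarrow> \<bar>x N i\<bar> \<le> B * (1 + real (deg i)) ^ r / real N"
    and we: "\<And>N i. Adm N \<Longrightarrow> i \<in> J N \<Longrightarrow> w N i * exp (x N i) \<le> z ^ deg i"
    and out: "\<And>N i. Adm N \<Longrightarrow> i \<in> I - J N \<Longrightarrow> real N \<le> c * (1 + real (deg i))"
  shows "\<exists>C. \<forall>N. Adm N \<longrightarrow> \<bar>(\<Sum>\<^sub>\<infinity>i\<in>J N. w N i * exp (x N i))
      - (\<Sum>\<^sub>\<infinity>i\<in>I. w N i * (\<Sum>j<M. x N i ^ j / fact j))\<bar> \<le> C / real N ^ M"
proof -
  \<comment> \<open>The M-th power of x contributes r * M powers of 1 + deg, the trade against N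
    outside J N another M.\<close>
  define R where "R = r * M + M"
  \<comment> \<open>With 1 + B in place of B the bound on x before division by N is at least 1, so
    its M-th power dominates the lower ones. The two summands in the second factor serve the indices
    inside and outside J N.\<close>
  define C0 where "C0 = (1 + B) ^ M * (1 + real M * (1 + c) ^ M)"
  define S where "S = (\<Sum>\<^sub>\<infinity>i\<in>I. z ^ deg i * (1 + real (deg i)) ^ R)"
  define T where "T N i = (\<Sum>j<M. x N i ^ j / fact j)" for N i
  have main: "\<bar>(\<Sum>\<^sub>\<infinity>i\<in>J N. w N i * exp (x N i)) - (\<Sum>\<^sub>\<infinity>i\<in>I. w N i * T N i)\<bar> \<le> C0 * S / real N ^ M" if N: "Adm N" for N
  proof -
    have N1: "real N \<ge> 1" using pos[OF N] by simp
    define g where "g i = (if i \<in> J N then w N i * exp (x N i) else 0)" for i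
    have d1: "1 \<le> 1 + real (deg i)" for i by simp
    have xB: "\<bar>x N i\<bar> \<le> (1 + B) * (1 + real (deg i)) ^ r / real N" if "i \<in> I" for i
    proof -
      have "B * (1 + real (deg i)) ^ r / real N \<le> (1 + B) * (1 + real (deg i)) ^ r / real N"
        using N1 by (intro divide_right_mono mult_right_mono) auto
      thus ?thesis using x[OF N that] by linarith
    qed
    have xpow: "\<bar>x N i\<bar> ^ M \<le> (1 + B) ^ M * (1 + real (deg i)) ^ (r * M) / real N ^ M" if "i \<in> I" for i
    proof -
      have "\<bar>x N i\<bar> ^ M \<le> ((1 + B) * (1 + real (deg i)) ^ r / real N) ^ M"
        by (rule power_mono[OF xB[OF that]]) simp
      thus ?thesis by (simp only: power_divide power_mult_distrib power_mult)
    qed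
    have xj: "\<bar>x N i ^ j / fact j\<bar> \<le> (1 + B) ^ M * (1 + real (deg i)) ^ (r * M)" if i: "i \<in> I" and j: "j < M" for i j
    proof -
      let ?b = "(1 + B) * (1 + real (deg i)) ^ r"
      have b1: "1 \<le> ?b" using B by (intro mult_ge1_I one_le_power) auto
      have "\<bar>x N i\<bar> \<le> ?b / real N" by (rule xB[OF i])
      also have "\<dots> \<le> ?b / 1" using N1 b1 by (intro divide_left_mono) auto
      finally have xb: "\<bar>x N i\<bar> \<le> ?b" by simp
      have "\<bar>x N i ^ j / fact j\<bar> = \<bar>x N i\<bar> ^ j / fact j" by (simp add: abs_divide power_abs)
      also have "\<dots> \<le> \<bar>x N i\<bar> ^ j / 1"
        using fact_ge_1[of j, where ?'a = real] by (intro divide_left_mono) auto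
      also have "\<dots> \<le> ?b ^ j" using power_mono[OF xb, of j] by simp
      also have "\<dots> \<le> ?b ^ M" by (rule power_increasing[OF less_imp_le[OF j] b1])
      also have "\<dots> = (1 + B) ^ M * (1 + real (deg i)) ^ (r * M)" by (simp only: power_mult_distrib power_mult)
      finally show ?thesis .
    qed
    have Tb: "\<bar>T N i\<bar> \<le> real M * ((1 + B) ^ M * (1 + real (deg i)) ^ (r * M))" if "i \<in> I" for i
    proof -
      have "\<bar>T N i\<bar> \<le> (\<Sum>j<M. \<bar>x N i ^ j / fact j\<bar>)" unfolding T_def by (rule sum_abs)
      also have "\<dots> \<le> (\<Sum>j<M. (1 + B) ^ M * (1 + real (deg i)) ^ (r * M))"
        using xj[OF that] by (intro sum_mono) simp
      finally show ?thesis by simp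
    qed
    have powR: "(1 + real (deg i)) ^ (r * M) \<le> (1 + real (deg i)) ^ R" for i
      unfolding R_def by (rule power_increasing) auto
    have gT: "\<bar>g i - w N i * T N i\<bar> \<le> C0 / real N ^ M * (z ^ deg i * (1 + real (deg i)) ^ R)" if i: "i \<in> I" for i
    proof (cases "i \<in> J N")
      case True
      have w0: "w N i \<ge> 0" "w N i \<le> z ^ deg i" using w[OF N i] by auto
      have "\<bar>g i - w N i * T N i\<bar> = w N i * \<bar>exp (x N i) - T N i\<bar>"
        using True w0 by (simp add: g_def abs_mult flip: right_diff_distrib)
      also have "\<dots> \<le> w N i * (\<bar>x N i\<bar> ^ M * max 1 (exp (x N i)))"
        unfolding T_def by (rule mult_left_mono[OF exp_taylor_bound w0(1)])
      also have "\<dots> = \<bar>x N i\<bar> ^ M * (w N i * max 1 (exp (x N i)))" by simp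
      also have "\<dots> \<le> \<bar>x N i\<bar> ^ M * z ^ deg i"
        using we[OF N True] w0 by (intro mult_left_mono) (auto simp: max_def)
      also have "\<dots> \<le> ((1 + B) ^ M * (1 + real (deg i)) ^ (r * M) / real N ^ M) * z ^ deg i"
        using z by (intro mult_right_mono xpow[OF i]) auto
      also have "\<dots> = (1 + B) ^ M / real N ^ M * (z ^ deg i * (1 + real (deg i)) ^ (r * M))" by simp
      also have "\<dots> \<le> C0 / real N ^ M * (z ^ deg i * (1 + real (deg i)) ^ R)"
      proof (rule mult_mono)
        have "(1 + B) ^ M * 1 \<le> (1 + B) ^ M * (1 + real M * (1 + c) ^ M)"
          using B c by (intro mult_left_mono) auto
        hence "(1 + B) ^ M \<le> C0" by (simp add: C0_def)
        thus "(1 + B) ^ M / real N ^ M \<le> C0 / real N ^ M" by (rule divide_right_mono) simp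
        show "z ^ deg i * (1 + real (deg i)) ^ (r * M) \<le> z ^ deg i * (1 + real (deg i)) ^ R"
          by (rule mult_left_mono[OF powR]) (use z in simp)
        show "0 \<le> C0 / real N ^ M" unfolding C0_def using B c by simp
        show "0 \<le> z ^ deg i * (1 + real (deg i)) ^ (r * M)" using z by simp
      qed
      finally show ?thesis .
    next
      case False
      have w0: "w N i \<ge> 0" "w N i \<le> z ^ deg i" using w[OF N i] by auto
      have "real N \<le> c * (1 + real (deg i))" using out[OF N] i False by blast
      also have "\<dots> \<le> (1 + c) * (1 + real (deg i))" by (intro mult_right_mono) auto
      finally have "real N ^ M \<le> ((1 + c) * (1 + real (deg i))) ^ M" by (intro power_mono) auto
      hence Nb: "1 \<le> (1 + c) ^ M * (1 + real (deg i)) ^ M / real N ^ M"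
        using N1 by (subst pos_le_divide_eq) (simp_all add: power_mult_distrib)
      have "\<bar>g i - w N i * T N i\<bar> = w N i * \<bar>T N i\<bar>" using False w0 by (simp add: g_def abs_mult)
      also have "\<dots> \<le> z ^ deg i * (real M * ((1 + B) ^ M * (1 + real (deg i)) ^ (r * M)))"
        using w0 by (intro mult_mono Tb[OF i]) auto
      also have "\<dots> \<le> (z ^ deg i * (real M * ((1 + B) ^ M * (1 + real (deg i)) ^ (r * M))))
          * ((1 + c) ^ M * (1 + real (deg i)) ^ M / real N ^ M)"
        using mult_left_mono[OF Nb, of "z ^ deg i * (real M * ((1 + B) ^ M * (1 + real (deg i)) ^ (r * M)))"] z B by simp
      also have "\<dots> = ((1 + B) ^ M * (real M * (1 + c) ^ M)) / real N ^ M * (z ^ deg i * (1 + real (deg i)) ^ R)"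
        unfolding R_def power_add by simp
      also have "\<dots> \<le> C0 / real N ^ M * (z ^ deg i * (1 + real (deg i)) ^ R)"
        using z B unfolding C0_def by (intro mult_right_mono divide_right_mono mult_left_mono) auto
      finally show ?thesis .
    qed
    have sm1: "(\<lambda>i. g i - w N i * T N i) summable_on I" by (rule tame_bound(1)[OF tame z gT])
    have "\<bar>w N i * T N i\<bar> \<le> real M * (1 + B) ^ M * (z ^ deg i * (1 + real (deg i)) ^ (r * M))" if i: "i \<in> I" for i
    proof -
      have w0: "w N i \<ge> 0" "w N i \<le> z ^ deg i" using w[OF N i] by auto
      have "\<bar>w N i * T N i\<bar> = w N i * \<bar>T N i\<bar>" using w0 by (simp add: abs_mult)
      also have "\<dots> \<le> z ^ deg i * (real M * ((1 + B) ^ M * (1 + real (deg i)) ^ (r * M)))"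
        using w0 by (intro mult_mono Tb[OF i]) auto
      finally show ?thesis by (simp only: mult_ac)
    qed
    hence sm2: "(\<lambda>i. w N i * T N i) summable_on I" by (rule tame_bound(1)[OF tame z])
    have sm3: "g summable_on I" using summable_on_add[OF sm1 sm2] by simp
    have "(\<Sum>\<^sub>\<infinity>i\<in>J N. w N i * exp (x N i)) = infsum g I"
      by (rule infsum_cong_neutral) (use J[of N] in \<open>auto simp: g_def\<close>)
    hence "(\<Sum>\<^sub>\<infinity>i\<in>J N. w N i * exp (x N i)) - (\<Sum>\<^sub>\<infinity>i\<in>I. w N i * T N i) = (\<Sum>\<^sub>\<infinity>i\<in>I. g i - w N i * T N i)"
      using infsum_diff_real(1)[OF sm3 sm2] by simp
    moreover have "\<bar>\<Sum>\<^sub>\<infinity>i\<in>I. g i - w N i * T N i\<bar> \<le> C0 / real N ^ M * S"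
      unfolding S_def by (rule tame_bound(2)[OF tame z gT])
    ultimately show ?thesis by simp
  qed
  show ?thesis by (intro exI[of _ "C0 * S"] allI impI) (use main in \<open>simp add: T_def\<close>)
qed

section \<open>Highest weights and Casimir numbers\<close>

definition parts_le :: "nat \<Rightarrow> (nat \<Rightarrow> nat) set" where
  "parts_le r = {a. antimono a \<and> (\<forall>i\<ge>r. a i = 0)}"

lemma parts_le_subset: "parts_le r \<subseteq> partitions"
proof
  fix a assume a: "a \<in> parts_le r"
  have "{i. a i \<noteq> 0} \<subseteq> {..<r}"
  proof
    fix i assume "i \<in> {i. a i \<noteq> 0}"
    thus "i \<in> {..<r}" using a by (cases "i < r") (auto simp: parts_le_def)
  qed
  hence "finite {i. a i \<noteq> 0}" by (rule finite_subset) simp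
  thus "a \<in> partitions" using a by (simp add: parts_le_def partitions_def)
qed

lemma psize_gt_if_not_parts_le:
  assumes "a \<in> partitions" "a \<notin> parts_le r"
  shows "r < psize a"
proof (rule ccontr)
  assume "\<not> r < psize a"
  hence "a i = 0" if "i \<ge> r" for i
    using partition_vanishes[of a "psize a" i] assms(1) that by (simp add: partitions_of_def)
  thus False using assms by (simp add: parts_le_def partitions_def)
qed

lemma sum_odd_numbers: "(\<Sum>i<r. 2 * real i + 1) = (real r)\<^sup>2"
  by (induction r) (simp_all add: power2_eq_square algebra_simps)

text \<open>Chebyshev pairs the odd numbers, which increase and sum to r^2, with the decreasing
  rows; Cauchy-Schwarz bounds the sum of the squared rows from below. Types B, C and D drop the
  quadratic gain, types A' and A depend on it.\<close>

lemma total_content_lower_bound: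
  assumes a: "a \<in> parts_le r"
  shows "(real (psize a))\<^sup>2 - (real r)\<^sup>2 * real (psize a) \<le> 2 * real r * total_content a"
proof -
  have vanish: "\<And>i. i \<ge> r \<Longrightarrow> a i = 0" and mono: "antimono a" using a by (auto simp: parts_le_def)
  have sz: "real (psize a) = (\<Sum>i<r. real (a i))" using psize_eq[of r a] vanish by simp
  have "2 * total_content a = (\<Sum>i<r. real (a i) * (real (a i) - 1 - 2 * real i))"
    using total_content_eq[of r a] vanish by simp
  also have "\<dots> = (\<Sum>i<r. (real (a i))\<^sup>2) - (\<Sum>i<r. (2 * real i + 1) * real (a i))"
    unfolding sum_subtractf[symmetric] by (intro sum.cong) (auto simp: power2_eq_square algebra_simps)
  finally have K: "2 * total_content a = (\<Sum>i<r. (real (a i))\<^sup>2) - (\<Sum>i<r. (2 * real i + 1) * real (a i))" .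
  have "(\<Sum>i<r. real (a i))\<^sup>2 \<le> (\<Sum>i<r. (1::real)\<^sup>2) * (\<Sum>i<r. (real (a i))\<^sup>2)"
    using Cauchy_Schwarz_ineq_sum[of "\<lambda>_. 1" "\<lambda>i. real (a i)" "{..<r}"] by simp
  hence cs: "(real (psize a))\<^sup>2 \<le> real r * (\<Sum>i<r. (real (a i))\<^sup>2)" unfolding sz by simp
  have "real r * (\<Sum>i\<in>{0..<r}. (2 * real i + 1) * real (a i)) \<le> (\<Sum>i\<in>{0..<r}. 2 * real i + 1) * (\<Sum>i\<in>{0..<r}. real (a i))"
  proof (rule Chebyshev_sum_upper[of r "\<lambda>i. 2 * real i + 1" "\<lambda>i. real (a i)", simplified])
    fix i j assume "i \<le> j" "j < r"
    show "a j \<le> a i" by (rule antimonoD[OF mono \<open>i \<le> j\<close>])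
  qed
  hence ch: "real r * (\<Sum>i<r. (2 * real i + 1) * real (a i)) \<le> (real r)\<^sup>2 * real (psize a)"
    unfolding atLeast0LessThan sum_odd_numbers sz .
  have "2 * real r * total_content a = real r * (2 * total_content a)" by simp
  also have "\<dots> = real r * (\<Sum>i<r. (real (a i))\<^sup>2) - real r * (\<Sum>i<r. (2 * real i + 1) * real (a i))"
    unfolding K by (rule right_diff_distrib)
  finally show ?thesis using cs ch by linarith
qed

section \<open>Weights given by a single partition\<close>

lemma casimir_sum_eq:
  "casimir_sum s N l = (\<Sum>i<length l. real_of_int (l ! i) * (real_of_int (l ! i) + real N + real_of_int s - 2 - 2 * real i)) / real N"
proof -
  have "(\<Sum>i=1..length l. l ! (i - 1) * (l ! (i - 1) + int N + s - 2 * int i))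
    = (\<Sum>i<length l. l ! i * (l ! i + int N + s - 2 * int (Suc i)))"
    by (rule sum.reindex_bij_witness[of _ Suc "\<lambda>i. i - 1"]) auto
  also have "real_of_int \<dots> = (\<Sum>i<length l. real_of_int (l ! i) * (real_of_int (l ! i) + real N + real_of_int s - 2 - 2 * real i))"
    unfolding of_int_sum by (intro sum.cong refl) (simp add: algebra_simps)
  finally show ?thesis unfolding casimir_sum_def by (rule arg_cong[where f = "\<lambda>x. x / real N"])
qed

definition weight_of :: "nat \<Rightarrow> (nat \<Rightarrow> nat) \<Rightarrow> int list" where
  "weight_of r a = map (\<lambda>i. int (a i)) [0..<r]"

lemma length_weight_of: "length (weight_of r a) = r"
  by (simp add: weight_of_def)

lemma nth_weight_of: "i < r \<Longrightarrow> weight_of r a ! i = int (a i)"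
  by (simp add: weight_of_def)

lemma bij_weight_of:
  "bij_betw (weight_of r) (parts_le r) {l. length l = r \<and> sorted_wrt (\<ge>) l \<and> (\<forall>x\<in>set l. x \<ge> 0)}"
proof (rule bij_betw_byWitness[where f' = "\<lambda>l i. if i < r then nat (l ! i) else 0"])
  show "\<forall>a\<in>parts_le r. (\<lambda>i. if i < r then nat (weight_of r a ! i) else 0) = a"
    by (auto simp: parts_le_def nth_weight_of fun_eq_iff)
  show "\<forall>l\<in>{l. length l = r \<and> sorted_wrt (\<ge>) l \<and> (\<forall>x\<in>set l. x \<ge> 0)}.
      weight_of r (\<lambda>i. if i < r then nat (l ! i) else 0) = l"
    by (auto intro!: nth_equalityI simp: length_weight_of nth_weight_of)
  show "weight_of r ` parts_le r \<subseteq> {l. length l = r \<and> sorted_wrt (\<ge>) l \<and> (\<forall>x\<in>set l. x \<ge> 0)}"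
  proof (rule image_subsetI)
    fix a assume "a \<in> parts_le r"
    hence "a j \<le> a i" if "i < j" for i j using antimonoD[of a i j] that by (simp add: parts_le_def)
    thus "weight_of r a \<in> {l. length l = r \<and> sorted_wrt (\<ge>) l \<and> (\<forall>x\<in>set l. x \<ge> 0)}"
      by (simp add: weight_of_def sorted_wrt_iff_nth_less)
  qed
  show "(\<lambda>l i. if i < r then nat (l ! i) else 0) ` {l. length l = r \<and> sorted_wrt (\<ge>) l \<and> (\<forall>x\<in>set l. x \<ge> 0)} \<subseteq> parts_le r"
  proof
    fix a assume "a \<in> (\<lambda>l i. if i < r then nat (l ! i) else 0) ` {l. length l = r \<and> sorted_wrt (\<ge>) l \<and> (\<forall>x\<in>set l. x \<ge> 0)}"
    then obtain l where l: "length l = r" "sorted_wrt (\<ge>) l" "a = (\<lambda>i. if i < r then nat (l ! i) else 0)" by auto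
    have "antimono a"
    proof (rule antimonoI)
      fix i j :: nat assume "i \<le> j"
      thus "a j \<le> a i" using l unfolding sorted_wrt_iff_nth_less by (cases "i = j") (auto intro!: nat_mono)
    qed
    thus "a \<in> parts_le r" using l by (simp add: parts_le_def)
  qed
qed

lemma casimir_sum_weight_of:
  assumes a: "a \<in> parts_le r" and N: "N \<ge> 1"
  shows "casimir_sum s N (weight_of r a) = real (psize a) + (2 * total_content a + (real_of_int s - 1) * real (psize a)) / real N"
proof -
  have vanish: "\<And>i. i \<ge> r \<Longrightarrow> a i = 0" using a by (auto simp: parts_le_def)
  have sz: "real (psize a) = (\<Sum>i<r. real (a i))" using psize_eq[of r a] vanish by simp
  have K: "2 * total_content a = (\<Sum>i<r. real (a i) * (real (a i) - 1 - 2 * real i))"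
    using total_content_eq[of r a] vanish by simp
  have "(\<Sum>i<r. real_of_int (weight_of r a ! i) * (real_of_int (weight_of r a ! i) + real N + real_of_int s - 2 - 2 * real i))
    = (\<Sum>i<r. real (a i) * (real (a i) - 1 - 2 * real i) + (real N + real_of_int s - 1) * real (a i))"
    by (intro sum.cong refl) (simp add: nth_weight_of algebra_simps)
  also have "\<dots> = 2 * total_content a + (real N + real_of_int s - 1) * real (psize a)"
    unfolding K sz sum.distrib sum_distrib_left ..
  finally have "casimir_sum s N (weight_of r a) = (2 * total_content a + (real N + real_of_int s - 1) * real (psize a)) / real N"
    unfolding casimir_sum_eq length_weight_of by (rule arg_cong[where f = "\<lambda>x. x / real N"])
  also have "\<dots> = real (psize a) + (2 * total_content a + (real_of_int s - 1) * real (psize a)) / real N"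
    using N by (simp add: field_simps)
  finally show ?thesis .
qed

section \<open>The sign of the last entry in type D\<close>

definition flip_last :: "int list \<Rightarrow> int list" where
  "flip_last l = butlast l @ [- last l]"

text \<open>A weight with negative last entry is the flip of one with positive last entry. Last
  entry 0 is excluded from the flipped family, since such a weight is its own flip and would be
  counted twice.\<close>

lemma highest_weights_D:
  assumes "N \<ge> 1" "even N"
  defines "W \<equiv> {l. length l = N div 2 \<and> sorted_wrt (\<ge>) l \<and> (\<forall>x\<in>set l. x \<ge> (0::int))}"
  shows "highest_weights TypeD N = W \<union> flip_last ` {l \<in> W. last l > 0}"
    "W \<inter> flip_last ` {l \<in> W. last l > 0} = {}"
    "inj_on flip_last {l \<in> W. last l > 0}"
proof -
  have r: "N div 2 \<ge> 1" using assms(1,2) by presburger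
  have ne: "l \<noteq> []" if "length l = N div 2" for l :: "int list" using that r by (cases l) simp_all
  have W_len: "length l = N div 2" if "l \<in> W" for l using that by (simp add: W_def)
  have W_sorted: "sorted_wrt (\<ge>) l" if "l \<in> W" for l using that by (simp add: W_def)
  have W_ne: "l \<noteq> []" if "l \<in> W" for l by (rule ne[OF W_len[OF that]])
  have W_last: "last l \<ge> 0" if "l \<in> W" for l
    using that last_in_set[OF W_ne[OF that]] unfolding W_def by simp
  have W_I: "l \<in> W" if "length l = N div 2" "sorted_wrt (\<ge>) l" "last l \<ge> 0" for l
  proof -
    have l: "butlast l @ [last l] = l" by (rule append_butlast_last_id[OF ne[OF that(1)]])
    have "sorted_wrt (\<ge>) (butlast l @ [last l])" using that(2) unfolding l .
    hence ge: "\<forall>x\<in>set (butlast l). x \<ge> last l" by (simp add: sorted_wrt_append)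
    have l0: "last l \<ge> 0" by (rule that(3))
    have "x \<ge> 0" if x: "x \<in> set l" for x
    proof -
      have "x \<in> set (butlast l @ [last l])" unfolding l by (rule x)
      hence "x = last l \<or> x \<in> set (butlast l)" by simp
      hence "x \<ge> last l" using ge by blast
      thus ?thesis using l0 by simp
    qed
    thus ?thesis using that(1,2) by (simp add: W_def)
  qed
  have flip: "butlast (flip_last l) = butlast l" "last (flip_last l) = - last l" for l
    by (simp_all add: flip_last_def)
  have len_flip: "length (flip_last l) = length l" if "l \<noteq> []" for l using that by (simp add: flip_last_def)
  have flip_flip: "flip_last (flip_last l) = l" if "l \<noteq> []" for l
    using that by (simp add: flip_last_def)
  have abs_last: "butlast l @ [\<bar>last l\<bar>] = (if last l \<ge> 0 then l else flip_last l)" if "l \<noteq> []" for l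
    using append_butlast_last_id[OF that] by (simp add: flip_last_def)
  have HW: "l \<in> highest_weights TypeD N \<longleftrightarrow> length l = N div 2 \<and> sorted_wrt (\<ge>) (butlast l @ [\<bar>last l\<bar>])" for l
    by (simp add: highest_weights_def)
  show "highest_weights TypeD N = W \<union> flip_last ` {l \<in> W. last l > 0}"
  proof (intro equalityI subsetI)
    fix l assume "l \<in> highest_weights TypeD N"
    hence l: "length l = N div 2" "sorted_wrt (\<ge>) (butlast l @ [\<bar>last l\<bar>])" unfolding HW by simp_all
    have lne: "l \<noteq> []" by (rule ne[OF l(1)])
    show "l \<in> W \<union> flip_last ` {l \<in> W. last l > 0}"
    proof (cases "last l \<ge> 0")
      case True
      hence "l \<in> W" using l abs_last[OF lne] by (intro W_I) simp_all
      thus ?thesis ..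
    next
      case False
      hence "flip_last l \<in> W" using l abs_last[OF lne] len_flip[OF lne] by (intro W_I) (simp_all add: flip)
      moreover have "last (flip_last l) > 0" using False by (simp add: flip)
      ultimately have "flip_last l \<in> {l \<in> W. last l > 0}" by simp
      hence "flip_last (flip_last l) \<in> flip_last ` {l \<in> W. last l > 0}" by (rule imageI)
      thus ?thesis unfolding flip_flip[OF lne] ..
    qed
  next
    fix l assume "l \<in> W \<union> flip_last ` {l \<in> W. last l > 0}"
    thus "l \<in> highest_weights TypeD N"
    proof
      assume l: "l \<in> W"
      show ?thesis unfolding HW abs_last[OF W_ne[OF l]] using W_last[OF l] W_len[OF l] W_sorted[OF l] by simp
    next
      assume "l \<in> flip_last ` {l \<in> W. last l > 0}"
      then obtain l' where "l' \<in> {l \<in> W. last l > 0}" and eq: "l = flip_last l'" by (rule imageE)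
      hence l': "l' \<in> W" "last l' > 0" by simp_all
      have "butlast l @ [\<bar>last l\<bar>] = l'"
        unfolding eq flip using abs_last[OF W_ne[OF l'(1)]] l'(2) by simp
      thus ?thesis
        unfolding HW using W_len[OF l'(1)] W_sorted[OF l'(1)] len_flip[OF W_ne[OF l'(1)]] by (simp add: eq)
    qed
  qed
  show "W \<inter> flip_last ` {l \<in> W. last l > 0} = {}"
  proof (rule equals0I)
    fix l assume "l \<in> W \<inter> flip_last ` {l \<in> W. last l > 0}"
    hence l: "l \<in> W" "l \<in> flip_last ` {l \<in> W. last l > 0}" by simp_all
    from l(2) obtain l' where "l' \<in> {l \<in> W. last l > 0}" and eq: "l = flip_last l'" by (rule imageE)
    hence "last l' > 0" by simp
    thus False using W_last[OF l(1)] unfolding eq flip by simp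
  qed
  show "inj_on flip_last {l \<in> W. last l > 0}"
  proof (rule inj_onI)
    fix l m assume "l \<in> {l \<in> W. last l > 0}" "m \<in> {l \<in> W. last l > 0}" and eq: "flip_last l = flip_last m"
    hence ne': "l \<noteq> []" "m \<noteq> []" using W_ne by simp_all
    have "flip_last (flip_last l) = flip_last (flip_last m)" by (simp only: eq)
    thus "l = m" unfolding flip_flip[OF ne'(1)] flip_flip[OF ne'(2)] .
  qed
qed

text \<open>At the last index i = N/2, in 1-based numbering, the linear coefficient N - 2 i vanishes
  and only the square of the entry remains.\<close>

lemma casimir_flip_last:
  assumes "even N" "length l = N div 2" "l \<noteq> []"
  shows "casimir_sum 0 N (flip_last l) = casimir_sum 0 N l"
proof -
  have "length l > 0" using assms(3) by simp
  then obtain k where k: "length l = Suc k" using gr0_implies_Suc by blast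
  have len: "length (flip_last l) = Suc k" using k by (simp add: flip_last_def)
  have nth: "flip_last l ! i = (if i = k then - (l ! i) else l ! i)" if "i < Suc k" for i
    using that k assms(3) by (auto simp: flip_last_def nth_append nth_butlast last_conv_nth)
  have "N = 2 * (N div 2)" using assms(1) by simp
  hence "N = 2 * Suc k" using assms(2) k by simp
  hence Nr: "real N = 2 * real k + 2" by simp
  show ?thesis unfolding casimir_sum_eq len k
  proof (intro arg_cong[where f = "\<lambda>x. x / real N"] sum.cong refl)
    fix i assume "i \<in> {..<Suc k}"
    hence "flip_last l ! i = (if i = k then - (l ! i) else l ! i)" by (intro nth) simp
    thus "real_of_int (flip_last l ! i) * (real_of_int (flip_last l ! i) + real N + real_of_int 0 - 2 - 2 * real i)
      = real_of_int (l ! i) * (real_of_int (l ! i) + real N + real_of_int 0 - 2 - 2 * real i)"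
      using Nr by simp
  qed
qed

text \<open>
  The parts of b are subtracted starting from the end of the list. If a has at most u parts, b at most v
  parts and N = u + v + 1, then the entry with index u equals n.
\<close>

definition mixed_weight :: "nat \<Rightarrow> (nat \<Rightarrow> nat) \<Rightarrow> (nat \<Rightarrow> nat) \<Rightarrow> int \<Rightarrow> int list" where
  "mixed_weight N a b n = map (\<lambda>i. n + int (a i) - int (b (N - Suc i))) [0..<N]"

lemma length_mixed_weight: "length (mixed_weight N a b n) = N"
  by (simp add: mixed_weight_def)

lemma nth_mixed_weight: "i < N \<Longrightarrow> mixed_weight N a b n ! i = n + int (a i) - int (b (N - Suc i))"
  by (simp add: mixed_weight_def)

lemma bij_mixed_weight:
  assumes N: "N = Suc (u + v)"
  shows "bij_betw (\<lambda>(a, b, n). mixed_weight N a b n) (parts_le u \<times> parts_le v \<times> UNIV) (highest_weights TypeA' N)"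
proof -
  \<comment> \<open>The middle entry at index u is the reference: the rows of a are excesses over
    it, the rows of b deficits below it, read from the end.\<close>
  define inv where "inv l = ((\<lambda>i. if i < u then nat (l ! i - l ! u) else 0),
      (\<lambda>j. if j < v then nat (l ! u - l ! (N - Suc j)) else 0), l ! u)" for l :: "int list"
  have mono: "l ! j \<le> l ! i" if "l \<in> highest_weights TypeA' N" "i \<le> j" "j < N" for l i j
    using that by (cases "i = j") (auto simp: highest_weights_def sorted_wrt_iff_nth_less)
  have len: "length l = N" if "l \<in> highest_weights TypeA' N" for l
    using that by (simp add: highest_weights_def)
  have A: "a i = 0" if "a \<in> parts_le u" "i \<ge> u" for a i using that by (simp add: parts_le_def)
  have B: "b i = 0" if "b \<in> parts_le v" "i \<ge> v" for b i using that by (simp add: parts_le_def)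
  have dec: "a j \<le> a i" if "a \<in> parts_le m" "i \<le> j" for a m i j
    using antimonoD[of a i j] that by (simp add: parts_le_def)
  have 1: "mixed_weight N a b n \<in> highest_weights TypeA' N \<and> inv (mixed_weight N a b n) = (a, b, n)"
    if a: "a \<in> parts_le u" and b: "b \<in> parts_le v" for a b n
  proof
    have "mixed_weight N a b n ! i \<ge> mixed_weight N a b n ! j" if "i < j" "j < N" for i j
    proof -
      have "a j \<le> a i" using that by (intro dec[OF a]) simp
      moreover have "b (N - Suc i) \<le> b (N - Suc j)" using that by (intro dec[OF b]) simp
      ultimately show ?thesis using that by (simp add: nth_mixed_weight)
    qed
    thus "mixed_weight N a b n \<in> highest_weights TypeA' N"
      by (simp add: highest_weights_def length_mixed_weight sorted_wrt_iff_nth_less)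
    have lu: "mixed_weight N a b n ! u = n"
      using A[OF a, of u] B[OF b, of "N - Suc u"] N by (simp add: nth_mixed_weight)
    have "(if i < u then nat (mixed_weight N a b n ! i - n) else 0) = a i" for i
      using A[OF a, of i] B[OF b, of "N - Suc i"] N by (simp add: nth_mixed_weight)
    moreover have "(if j < v then nat (n - mixed_weight N a b n ! (N - Suc j)) else 0) = b j" for j
      using B[OF b, of j] A[OF a, of "N - Suc j"] N by (simp add: nth_mixed_weight)
    ultimately show "inv (mixed_weight N a b n) = (a, b, n)" unfolding inv_def lu by simp
  qed
  have 2: "fst (inv l) \<in> parts_le u \<and> fst (snd (inv l)) \<in> parts_le v
      \<and> mixed_weight N (fst (inv l)) (fst (snd (inv l))) (snd (snd (inv l))) = l" if l: "l \<in> highest_weights TypeA' N" for l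
  proof (intro conjI)
    have "antimono (fst (inv l))"
    proof (rule antimonoI)
      fix i j :: nat assume ij: "i \<le> j"
      have "l ! j \<le> l ! i" if "j < u" using that N by (intro mono[OF l ij]) simp
      thus "fst (inv l) j \<le> fst (inv l) i" using ij by (simp add: inv_def nat_mono)
    qed
    thus "fst (inv l) \<in> parts_le u" by (simp add: parts_le_def inv_def)
    have "antimono (fst (snd (inv l)))"
    proof (rule antimonoI)
      fix i j :: nat assume ij: "i \<le> j"
      show "fst (snd (inv l)) j \<le> fst (snd (inv l)) i"
      proof -
        have "l ! (N - Suc i) \<le> l ! (N - Suc j)" using ij N by (intro mono[OF l]) simp_all
        thus ?thesis using ij by (simp add: inv_def nat_mono)
      qed
    qed
    thus "fst (snd (inv l)) \<in> parts_le v" by (simp add: parts_le_def inv_def)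
    show "mixed_weight N (fst (inv l)) (fst (snd (inv l))) (snd (snd (inv l))) = l"
    proof (rule nth_equalityI)
      show "length (mixed_weight N (fst (inv l)) (fst (snd (inv l))) (snd (snd (inv l)))) = length l"
        by (simp add: length_mixed_weight len[OF l])
      fix i assume "i < length (mixed_weight N (fst (inv l)) (fst (snd (inv l))) (snd (snd (inv l))))"
      hence i: "i < N" by (simp add: length_mixed_weight)
      consider "i < u" | "i = u" | "i > u" by linarith
      thus "mixed_weight N (fst (inv l)) (fst (snd (inv l))) (snd (snd (inv l))) ! i = l ! i"
      proof cases
        case 1
        have "\<not> N - Suc i < v" using 1 N by simp
        thus ?thesis using 1 mono[OF l, of i u] N i by (simp add: nth_mixed_weight inv_def)
      next
        case 2
        have "\<not> N - Suc i < v" using 2 N by simp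
        thus ?thesis using 2 i by (simp add: nth_mixed_weight inv_def)
      next
        case 3
        have "N - Suc i < v" "N - Suc (N - Suc i) = i" using 3 N i by auto
        thus ?thesis using 3 mono[OF l, of u i] i by (simp add: nth_mixed_weight inv_def)
      qed
    qed
  qed
  show ?thesis
  proof (rule bij_betw_byWitness[where f' = inv])
    show "\<forall>x\<in>parts_le u \<times> parts_le v \<times> UNIV. inv ((\<lambda>(a, b, n). mixed_weight N a b n) x) = x"
      using 1 by (simp add: split_paired_all)
    show "\<forall>l\<in>highest_weights TypeA' N. (\<lambda>(a, b, n). mixed_weight N a b n) (inv l) = l"
      using 2 by (simp add: case_prod_beta)
    show "(\<lambda>(a, b, n). mixed_weight N a b n) ` (parts_le u \<times> parts_le v \<times> UNIV) \<subseteq> highest_weights TypeA' N"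
      using 1 by (simp add: image_subset_iff split_paired_all)
    show "inv ` highest_weights TypeA' N \<subseteq> parts_le u \<times> parts_le v \<times> UNIV"
      using 2 by (simp add: image_subset_iff mem_Times_iff)
  qed
qed

lemma last_mixed_weight:
  assumes N: "N = Suc (u + v)" and a: "a \<in> parts_le u"
  shows "last (mixed_weight N a b n) = n - int (b 0)"
proof -
  have ne: "mixed_weight N a b n \<noteq> []" using length_mixed_weight[of N a b n] N by auto
  have "last (mixed_weight N a b n) = mixed_weight N a b n ! (N - 1)"
    unfolding last_conv_nth[OF ne] length_mixed_weight ..
  also have "\<dots> = n - int (b 0)" using a N by (simp add: nth_mixed_weight parts_le_def)
  finally show ?thesis .
qed

lemma highest_weights_A_eq:
  assumes "N \<ge> 1"
  shows "highest_weights TypeA N = {l \<in> highest_weights TypeA' N. last l = 0}"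
proof -
  have "\<forall>x\<in>set l. x \<ge> 0" if l: "length l = N" "sorted_wrt (\<ge>) l" "last l = 0" for l :: "int list"
  proof
    fix x assume "x \<in> set l"
    then obtain i where i: "i < N" "x = l ! i" using l(1) by (auto simp: in_set_conv_nth)
    have "l \<noteq> []" using l(1) assms by auto
    hence "l ! (N - 1) = 0" using l by (simp add: last_conv_nth)
    moreover have "l ! (N - 1) \<le> l ! i"
      using l(1,2) i by (cases "i = N - 1") (auto simp: sorted_wrt_iff_nth_less)
    ultimately show "x \<ge> 0" using i by simp
  qed
  thus ?thesis by (auto simp: highest_weights_def)
qed

text \<open>The last entry is n - b 0, so the normalization of SU(N) weights forces n = b 0.\<close>

lemma bij_mixed_weight_A:
  assumes N: "N = Suc (u + v)"
  shows "bij_betw (\<lambda>(a, b). mixed_weight N a b (int (b 0))) (parts_le u \<times> parts_le v) (highest_weights TypeA N)"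
proof -
  let ?S = "{x \<in> parts_le u \<times> parts_le v \<times> UNIV. snd (snd x) = int (fst (snd x) 0)}"
  have "bij_betw (\<lambda>(a, b, n). mixed_weight N a b n) ?S (highest_weights TypeA N)"
  proof -
    have "bij_betw (\<lambda>(a, b, n). mixed_weight N a b n) ?S ((\<lambda>(a, b, n). mixed_weight N a b n) ` ?S)"
      by (rule bij_betw_subset[OF bij_mixed_weight[OF N] _ refl]) blast
    moreover have "(\<lambda>(a, b, n). mixed_weight N a b n) ` ?S = highest_weights TypeA N"
    proof (intro equalityI subsetI)
      fix l assume "l \<in> (\<lambda>(a, b, n). mixed_weight N a b n) ` ?S"
      then obtain a b where ab: "a \<in> parts_le u" "b \<in> parts_le v" "l = mixed_weight N a b (int (b 0))" by auto
      have "l \<in> highest_weights TypeA' N"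
        using bij_betwE[OF bij_mixed_weight[OF N]] ab by auto
      moreover have "last l = 0" unfolding ab(3) last_mixed_weight[OF N ab(1)] by simp
      ultimately show "l \<in> highest_weights TypeA N" using N by (simp add: highest_weights_A_eq)
    next
      fix l assume "l \<in> highest_weights TypeA N"
      hence l: "l \<in> highest_weights TypeA' N" "last l = 0" using N by (simp_all add: highest_weights_A_eq)
      have "l \<in> (\<lambda>(a, b, n). mixed_weight N a b n) ` (parts_le u \<times> parts_le v \<times> UNIV)"
        using l(1) bij_mixed_weight[OF N] by (simp add: bij_betw_def)
      then obtain a b n where abn: "a \<in> parts_le u" "b \<in> parts_le v" "l = mixed_weight N a b n" by auto
      have "n = int (b 0)" using l(2) unfolding abn(3) last_mixed_weight[OF N abn(1)] by simp
      thus "l \<in> (\<lambda>(a, b, n). mixed_weight N a b n) ` ?S"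
        using abn by (intro image_eqI[where x = "(a, b, n)"]) simp_all
    qed
    ultimately show ?thesis by simp
  qed
  moreover have "bij_betw (\<lambda>(a, b). (a, b, int (b 0))) (parts_le u \<times> parts_le v) ?S"
    by (rule bij_betw_byWitness[where f' = "\<lambda>(a, b, n). (a, b)"]) auto
  ultimately have "bij_betw ((\<lambda>(a, b, n). mixed_weight N a b n) \<circ> (\<lambda>(a, b). (a, b, int (b 0))))
      (parts_le u \<times> parts_le v) (highest_weights TypeA N)"
    by (rule bij_betw_trans[rotated])
  moreover have "(\<lambda>(a, b, n). mixed_weight N a b n) \<circ> (\<lambda>(a, b). (a, b, int (b 0)))
      = (\<lambda>(a, b). mixed_weight N a b (int (b 0)))" by (auto simp: fun_eq_iff)
  ultimately show ?thesis by simp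
qed

text \<open>The supports of a and of the reversed b are disjoint, so products of their entries
  disappear. The numbers N - 1 - 2 i sum to 0 and change sign under reversal, which turns the
  contribution of the negative entries into the content of b.\<close>

lemma mixed_weight_sums:
  assumes N: "N = Suc (u + v)" and a: "a \<in> parts_le u" and b: "b \<in> parts_le v"
  shows "real_of_int (sum_list (mixed_weight N a b n)) = real N * real_of_int n + (real (psize a) - real (psize b))"
    and "casimir_sum 1 N (mixed_weight N a b n) = (real_of_int n)\<^sup>2
      + 2 * real_of_int n * (real (psize a) - real (psize b)) / real N + real (psize a) + real (psize b)
      + (2 * total_content a + 2 * total_content b) / real N"
proof -
  have va: "a i = 0" if "i \<ge> N" for i using a that N by (simp add: parts_le_def)
  have vb: "b i = 0" if "i \<ge> N" for i using b that N by (simp add: parts_le_def)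
  have sa: "real (psize a) = (\<Sum>i<N. real (a i))" using psize_eq[of N a] va by simp
  have sb: "real (psize b) = (\<Sum>i<N. real (b i))" using psize_eq[of N b] vb by simp
  have Ka: "2 * total_content a = (\<Sum>i<N. real (a i) * (real (a i) - 1 - 2 * real i))"
    using total_content_eq[of N a] va by simp
  have Kb: "2 * total_content b = (\<Sum>i<N. real (b i) * (real (b i) - 1 - 2 * real i))"
    using total_content_eq[of N b] vb by simp
  have rev: "(\<Sum>i<N. g (N - Suc i)) = (\<Sum>i<N. g i)" for g :: "nat \<Rightarrow> real" by (rule sum.nat_diff_reindex)
  have "sum_list (mixed_weight N a b n) = (\<Sum>i<N. n + int (a i) - int (b (N - Suc i)))"
    unfolding mixed_weight_def interv_sum_list_conv_sum_set_nat set_upt atLeast0LessThan ..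
  hence "real_of_int (sum_list (mixed_weight N a b n)) = (\<Sum>i<N. real_of_int n + real (a i) - real (b (N - Suc i)))"
    by simp
  also have "\<dots> = real N * real_of_int n + ((\<Sum>i<N. real (a i)) - (\<Sum>i<N. real (b (N - Suc i))))"
    by (simp add: sum.distrib sum_subtractf)
  finally show "real_of_int (sum_list (mixed_weight N a b n)) = real N * real_of_int n + (real (psize a) - real (psize b))"
    unfolding rev[of "\<lambda>i. real (b i)"] sa sb .
  have e0: "(\<Sum>i<N. real N - 1 - 2 * real i) = 0"
  proof -
    have "(\<Sum>i<N. real N - 1 - 2 * real i) = (\<Sum>i<N. real N - (2 * real i + 1))" by (intro sum.cong) auto
    also have "\<dots> = real N * real N - (\<Sum>i<N. 2 * real i + 1)" by (simp add: sum_subtractf)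
    finally show ?thesis unfolding sum_odd_numbers by (simp add: power2_eq_square)
  qed
  have "(\<Sum>i<N. real_of_int (mixed_weight N a b n ! i) * (real_of_int (mixed_weight N a b n ! i) + real N + real_of_int 1 - 2 - 2 * real i))
    = (\<Sum>i<N. (real_of_int n)\<^sup>2 + real_of_int n * (real N - 1 - 2 * real i)
        + 2 * real_of_int n * (real (a i) - real (b (N - Suc i)))
        + (real (a i) * (real (a i) - 1 - 2 * real i) + real N * real (a i))
        + (real (b (N - Suc i)) * (real (b (N - Suc i)) - 1 - 2 * real (N - Suc i)) + real N * real (b (N - Suc i))))"
  proof (intro sum.cong refl)
    fix i assume "i \<in> {..<N}"
    hence i: "i < N" by simp
    have "a i = 0 \<or> b (N - Suc i) = 0" using a b N i by (cases "i < u") (auto simp: parts_le_def)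
    hence ab: "real (a i) * real (b (N - Suc i)) = 0" by auto
    have ri: "real (N - Suc i) = real N - 1 - real i" using i by (simp add: of_nat_diff)
    define A B n' where "A = real (a i)" "B = real (b (N - Suc i))" "n' = real_of_int n"
    have nth: "real_of_int (mixed_weight N a b n ! i) = n' + A - B" using i by (simp add: nth_mixed_weight A_B_n'_def)
    have "(n' + A - B) * (n' + A - B + real N + 1 - 2 - 2 * real i) = n'\<^sup>2 + n' * (real N - 1 - 2 * real i)
        + 2 * n' * (A - B) + (A * (A - 1 - 2 * real i) + real N * A)
        + (B * (B - 1 - 2 * (real N - 1 - real i)) + real N * B) - 2 * (A * B)"
      by (simp add: power2_eq_square algebra_simps)
    thus "real_of_int (mixed_weight N a b n ! i) * (real_of_int (mixed_weight N a b n ! i) + real N + real_of_int 1 - 2 - 2 * real i)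
      = (real_of_int n)\<^sup>2 + real_of_int n * (real N - 1 - 2 * real i)
        + 2 * real_of_int n * (real (a i) - real (b (N - Suc i)))
        + (real (a i) * (real (a i) - 1 - 2 * real i) + real N * real (a i))
        + (real (b (N - Suc i)) * (real (b (N - Suc i)) - 1 - 2 * real (N - Suc i)) + real N * real (b (N - Suc i)))"
      unfolding nth ri using ab by (simp add: A_B_n'_def)
  qed
  also have "\<dots> = real N * (real_of_int n)\<^sup>2 + real_of_int n * (\<Sum>i<N. real N - 1 - 2 * real i)
        + 2 * real_of_int n * ((\<Sum>i<N. real (a i)) - (\<Sum>i<N. real (b (N - Suc i))))
        + ((\<Sum>i<N. real (a i) * (real (a i) - 1 - 2 * real i)) + real N * (\<Sum>i<N. real (a i)))
        + ((\<Sum>i<N. real (b (N - Suc i)) * (real (b (N - Suc i)) - 1 - 2 * real (N - Suc i))) + real N * (\<Sum>i<N. real (b (N - Suc i))))"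
    by (simp only: sum.distrib sum_subtractf sum_distrib_left[symmetric] sum_constant card_lessThan)
  also have "\<dots> = real N * (real_of_int n)\<^sup>2 + 2 * real_of_int n * (real (psize a) - real (psize b))
      + (2 * total_content a + real N * real (psize a)) + (2 * total_content b + real N * real (psize b))"
    unfolding e0 rev[of "\<lambda>i. real (b i)"] rev[of "\<lambda>i. real (b i) * (real (b i) - 1 - 2 * real i)"] sa sb Ka Kb by simp
  finally have "casimir_sum 1 N (mixed_weight N a b n)
    = (real N * (real_of_int n)\<^sup>2 + 2 * real_of_int n * (real (psize a) - real (psize b))
      + (2 * total_content a + real N * real (psize a)) + (2 * total_content b + real N * real (psize b))) / real N"
    unfolding casimir_sum_eq length_mixed_weight by (rule arg_cong[where f = "\<lambda>x. x / real N"])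
  thus "casimir_sum 1 N (mixed_weight N a b n) = (real_of_int n)\<^sup>2
      + 2 * real_of_int n * (real (psize a) - real (psize b)) / real N + real (psize a) + real (psize b)
      + (2 * total_content a + 2 * total_content b) / real N"
    using N by (simp add: add_divide_distrib)
qed

section \<open>Sums that vanish by parity\<close>

lemma infsum_times_finite:
  fixes g :: "'a \<Rightarrow> 'k \<Rightarrow> real"
  assumes "finite K" "\<And>k. k \<in> K \<Longrightarrow> (\<lambda>a. g a k) summable_on A"
  shows "((\<lambda>x. g (fst x) (snd x)) has_sum (\<Sum>k\<in>K. \<Sum>\<^sub>\<infinity>a\<in>A. g a k)) (A \<times> K)"
proof -
  have "((\<lambda>x. g (fst x) (snd x)) has_sum (\<Sum>\<^sub>\<infinity>a\<in>A. g a k)) (A \<times> {k})" if "k \<in> K" for k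
  proof -
    have "bij_betw (\<lambda>a. (a, k)) A (A \<times> {k})" by (rule bij_betw_byWitness[where f' = fst]) auto
    hence "((\<lambda>x. g (fst x) (snd x)) has_sum (\<Sum>\<^sub>\<infinity>a\<in>A. g a k)) (A \<times> {k})
        \<longleftrightarrow> ((\<lambda>a. g (fst (a, k)) (snd (a, k))) has_sum (\<Sum>\<^sub>\<infinity>a\<in>A. g a k)) A"
      by (rule has_sum_reindex_bij_betw[symmetric])
    thus ?thesis using has_sum_infsum[OF assms(2)[OF that]] by simp
  qed
  hence "((\<lambda>x. g (fst x) (snd x)) has_sum (\<Sum>k\<in>K. \<Sum>\<^sub>\<infinity>a\<in>A. g a k)) (\<Union>k\<in>K. A \<times> {k})"
    by (rule sum_has_sum[OF assms(1)]) auto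
  moreover have "(\<Union>k\<in>K. A \<times> {k}) = A \<times> K" by auto
  ultimately show ?thesis by simp
qed

lemma has_sum_finite_sum:
  fixes g :: "'k \<Rightarrow> 'a \<Rightarrow> real"
  assumes "finite K" "\<And>k. k \<in> K \<Longrightarrow> g k summable_on A"
  shows "((\<lambda>a. \<Sum>k\<in>K. g k a) has_sum (\<Sum>k\<in>K. infsum (g k) A)) A"
  using assms
proof (induction K rule: finite_induct)
  case (insert k K)
  have "((\<lambda>a. g k a + (\<Sum>k\<in>K. g k a)) has_sum (infsum (g k) A + (\<Sum>k\<in>K. infsum (g k) A))) A"
    by (intro has_sum_add has_sum_infsum insert) simp_all
  thus ?case using insert by simp
qed simp

text \<open>Summing first over the partitions of one size gives finite inner sums, which vanish by
  \<open>sum_total_content_odd\<close>. The bijection phi only singles out one partition coordinate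
  of the index; y collects the remaining ones.\<close>

lemma infsum_odd_content:
  fixes f :: "'i \<Rightarrow> real" and g :: "'y \<Rightarrow> nat \<Rightarrow> real"
  assumes bij: "bij_betw phi (Y \<times> partitions) I" and sm: "f summable_on I" and odd: "odd j"
    and f: "\<And>y a. y \<in> Y \<Longrightarrow> a \<in> partitions \<Longrightarrow> f (phi (y, a)) = g y (psize a) * total_content a ^ j"
  shows "infsum f I = 0"
proof -
  let ?S = "SIGMA x:Y \<times> UNIV. partitions_of (snd x)"
  have bij2: "bij_betw (\<lambda>(x, a). (fst x, a)) ?S (Y \<times> partitions)"
    by (rule bij_betw_byWitness[where f' = "\<lambda>(y, a). ((y, psize a), a)"]) (auto simp: partitions_of_def)
  let ?h = "\<lambda>x a. g (fst x) (snd x) * total_content a ^ j"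
  have fh: "f (phi ((\<lambda>(x, a). (fst x, a)) z)) = (\<lambda>(x, a). ?h x a) z" if "z \<in> ?S" for z
  proof -
    obtain y n a where z: "z = ((y, n), a)" by (metis surj_pair)
    have "y \<in> Y" "a \<in> partitions" "psize a = n" using that unfolding z by (auto simp: partitions_of_def)
    thus ?thesis unfolding z using f by simp
  qed
  have "(\<lambda>x. f (phi x)) summable_on (Y \<times> partitions)"
    using sm summable_on_reindex_bij_betw[OF bij, of f] by simp
  hence "(\<lambda>z. f (phi ((\<lambda>(x, a). (fst x, a)) z))) summable_on ?S"
    using summable_on_reindex_bij_betw[OF bij2, of "\<lambda>x. f (phi x)"] by simp
  hence sm': "(\<lambda>(x, a). ?h x a) summable_on ?S"
    by (rule summable_on_cong[THEN iffD1, rotated]) (rule fh)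
  have "infsum f I = (\<Sum>\<^sub>\<infinity>x\<in>Y \<times> partitions. f (phi x))"
    using infsum_reindex_bij_betw[OF bij, of f] by simp
  also have "\<dots> = (\<Sum>\<^sub>\<infinity>z\<in>?S. f (phi ((\<lambda>(x, a). (fst x, a)) z)))"
    using infsum_reindex_bij_betw[OF bij2, of "\<lambda>x. f (phi x)"] by simp
  also have "\<dots> = (\<Sum>\<^sub>\<infinity>(x, a)\<in>?S. ?h x a)" by (rule infsum_cong) (rule fh)
  also have "\<dots> = (\<Sum>\<^sub>\<infinity>x\<in>Y \<times> UNIV. \<Sum>\<^sub>\<infinity>a\<in>partitions_of (snd x). ?h x a)"
    by (rule infsum_Sigma'_banach[OF sm', symmetric])
  also have "\<dots> = (\<Sum>\<^sub>\<infinity>x\<in>Y \<times> (UNIV :: nat set). 0)"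
  proof (rule infsum_cong)
    fix x :: "'y \<times> nat"
    have "(\<Sum>\<^sub>\<infinity>a\<in>partitions_of (snd x). ?h x a) = (\<Sum>a\<in>partitions_of (snd x). ?h x a)"
      by (rule infsum_finite[OF finite_partitions_of])
    also have "\<dots> = g (fst x) (snd x) * (\<Sum>a\<in>partitions_of (snd x). total_content a ^ j)"
      by (rule sum_distrib_left[symmetric])
    also have "\<dots> = 0" unfolding sum_total_content_odd[OF odd] by simp
    finally show "(\<Sum>\<^sub>\<infinity>a\<in>partitions_of (snd x). ?h x a) = 0" .
  qed
  also have "\<dots> = 0" by simp
  finally show ?thesis .
qed

lemma infsum_antisymmetric:
  fixes f :: "'i \<Rightarrow> real"
  assumes "bij_betw nu I I" "\<And>i. i \<in> I \<Longrightarrow> f (nu i) = - f i"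
  shows "infsum f I = 0"
proof -
  have "infsum f I = (\<Sum>\<^sub>\<infinity>i\<in>I. f (nu i))" by (rule infsum_reindex_bij_betw[OF assms(1), symmetric])
  also have "\<dots> = (\<Sum>\<^sub>\<infinity>i\<in>I. - f i)" by (rule infsum_cong) (rule assms(2))
  also have "\<dots> = - infsum f I" by (rule infsum_uminus)
  finally show ?thesis by simp
qed

section \<open>Index families of subexponential growth\<close>

lemma tame_partitions: "tame psize partitions"
  unfolding tame_def by (intro allI impI summable_on_partitions)

lemma tame_times:
  assumes "tame d I" "tame e J"
  shows "tame (\<lambda>x. d (fst x) + e (snd x)) (I \<times> J)"
  unfolding tame_def
proof (intro allI impI)
  fix z :: real assume z: "0 < z" "z < 1"
  have I: "(\<lambda>i. z ^ d i) summable_on I" and J: "(\<lambda>j. z ^ e j) summable_on J"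
    using assms z unfolding tame_def by blast+
  have "(\<lambda>(i, j). z ^ d i * z ^ e j) summable_on I \<times> J"
  proof (rule summable_on_SigmaI)
    fix i
    have "((\<lambda>j. z ^ d i * z ^ e j) has_sum (z ^ d i * infsum (\<lambda>j. z ^ e j) J)) J"
      by (rule has_sum_cmult_right) (rule has_sum_infsum[OF J])
    thus "((\<lambda>j. case (i, j) of (i, j) \<Rightarrow> z ^ d i * z ^ e j) has_sum (z ^ d i * infsum (\<lambda>j. z ^ e j) J)) J" by simp
  next
    show "(\<lambda>i. z ^ d i * infsum (\<lambda>j. z ^ e j) J) summable_on I" by (rule summable_on_cmult_left[OF I])
  next
    fix i j
    show "0 \<le> (case (i, j) of (i, j) \<Rightarrow> z ^ d i * z ^ e j)" using z by simp
  qed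
  thus "(\<lambda>x. z ^ (d (fst x) + e (snd x))) summable_on I \<times> J"
    by (simp add: power_add case_prod_unfold)
qed

lemma tame_int: "tame (\<lambda>n. nat \<bar>n\<bar>) (Z :: int set)"
  unfolding tame_def
proof (intro allI impI)
  fix z :: real assume z: "0 < z" "z < 1"
  have g: "(\<lambda>n::nat. z ^ n) summable_on UNIV"
    using z by (intro summable_nonneg_imp_summable_on summable_geometric) auto
  have "((\<lambda>n. z ^ n) \<circ> (\<lambda>n. nat n)) summable_on {0::int..}"
    by (subst summable_on_reindex[symmetric]) (auto simp: inj_on_def intro: summable_on_subset_banach[OF g])
  hence 1: "(\<lambda>n. z ^ nat \<bar>n\<bar>) summable_on {0::int..}"
    by (rule summable_on_cong[THEN iffD1, rotated]) simp
  have "((\<lambda>n. z ^ n) \<circ> (\<lambda>n. nat (- n))) summable_on {..<0::int}"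
    by (subst summable_on_reindex[symmetric]) (auto simp: inj_on_def intro: summable_on_subset_banach[OF g])
  hence 2: "(\<lambda>n. z ^ nat \<bar>n\<bar>) summable_on {..<0::int}"
    by (rule summable_on_cong[THEN iffD1, rotated]) simp
  have "(\<lambda>n. z ^ nat \<bar>n\<bar>) summable_on ({0..} \<union> {..<0::int})"
    by (rule summable_on_Un_disjoint[OF 1 2]) auto
  thus "(\<lambda>n. z ^ nat \<bar>n\<bar>) summable_on Z" by (rule summable_on_subset_banach) auto
qed

lemma tame_subset: "tame d I \<Longrightarrow> J \<subseteq> I \<Longrightarrow> tame d J"
  unfolding tame_def by (blast intro: summable_on_subset_banach)

section \<open>Types B, C and D\<close>

text \<open>
  The Casimir number of the weight given by a partition a is
  \<open>psize a + (2 * total_content a + bcd_shift T * psize a) / N\<close>; the last term produces the exponential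
  factors in the integrands of types B, C and D.
\<close>

definition bcd_shift :: "classical_type \<Rightarrow> real" where
  "bcd_shift T = (if T = TypeC then 1 else - 1)"

text \<open>The size correction stays unexpanded in the weight, as in the integrand. The Taylor
  expansion is then in the content alone, and its odd orders cancel.\<close>

definition bcd_weight :: "classical_type \<Rightarrow> real \<Rightarrow> nat \<Rightarrow> (nat \<Rightarrow> nat) \<Rightarrow> real" where
  "bcd_weight T t N a = q_of t ^ psize a * exp (- (t * bcd_shift T / (2 * real N)) * real (psize a))"

definition content_exponent :: "real \<Rightarrow> nat \<Rightarrow> (nat \<Rightarrow> nat) \<Rightarrow> real" where
  "content_exponent t N a = - t * total_content a / real N"

text \<open>The Casimir number will be at least a quarter of the size: at most a half is lost to the
  content and, for N \<ge> 4, a quarter to the shift. Times t/2 this is t/8.\<close>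

definition small_base :: "real \<Rightarrow> real" where
  "small_base t = exp (- t / 8)"

lemma small_base_power: "small_base t ^ n = exp (- t / 8 * real n)"
  unfolding small_base_def exp_of_nat_mult[symmetric] by (rule arg_cong[where f = exp], rule mult.commute)

lemma q_of_power: "q_of t ^ n = exp (- t / 2 * real n)"
  unfolding q_of_def exp_of_nat_mult[symmetric] by (rule arg_cong[where f = exp], rule mult.commute)

lemma small_base: "t > 0 \<Longrightarrow> 0 < small_base t" "t > 0 \<Longrightarrow> small_base t < 1"
  by (simp_all add: small_base_def)

lemma bcd_weight_eq: "bcd_weight T t N a = exp (- t / 2 * (real (psize a) + bcd_shift T * real (psize a) / real N))"
  unfolding bcd_weight_def q_of_power exp_add[symmetric]
  by (rule arg_cong[where f = exp]) (cases "N = 0", simp_all add: field_simps)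

lemma bcd_weight_exp_eq:
  "bcd_weight T t N a * exp (content_exponent t N a)
    = exp (- t / 2 * (real (psize a) + (2 * total_content a + bcd_shift T * real (psize a)) / real N))"
  unfolding bcd_weight_eq content_exponent_def exp_add[symmetric]
  by (rule arg_cong[where f = exp]) (cases "N = 0", simp_all add: field_simps)

lemma bcd_shift_bounds: "- 1 \<le> bcd_shift T" "bcd_shift T \<le> 1"
  by (simp_all add: bcd_shift_def)

lemma bcd_weight_bound:
  assumes t: "t > 0" and N: "N \<ge> 4"
  shows "0 \<le> bcd_weight T t N a" "bcd_weight T t N a \<le> small_base t ^ psize a"
proof -
  show "0 \<le> bcd_weight T t N a" unfolding bcd_weight_eq by simp
  have "real (psize a) / real N \<le> real (psize a) / 4" using N by (intro divide_left_mono) auto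
  moreover have "- (real (psize a) / real N) \<le> bcd_shift T * (real (psize a) / real N)"
    using mult_right_mono[OF bcd_shift_bounds(1)[of T], of "real (psize a) / real N"] by simp
  moreover have "bcd_shift T * real (psize a) / real N = bcd_shift T * (real (psize a) / real N)" by simp
  ultimately have "real (psize a) / 4 \<le> real (psize a) + bcd_shift T * real (psize a) / real N"
    using of_nat_0_le_iff[of "psize a"] by linarith
  hence "t / 2 * (real (psize a) / 4) \<le> t / 2 * (real (psize a) + bcd_shift T * real (psize a) / real N)"
    using t by (intro mult_left_mono) auto
  thus "bcd_weight T t N a \<le> small_base t ^ psize a"
    unfolding bcd_weight_eq small_base_power by simp
qed

lemma bcd_weight_exp_bound:
  assumes t: "t > 0" and N: "N \<ge> 4" and r: "2 * r \<le> N" "r \<ge> 1" and a: "a \<in> parts_le r"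
  shows "bcd_weight T t N a * exp (content_exponent t N a) \<le> small_base t ^ psize a"
proof -
  let ?s = "real (psize a)" and ?K = "total_content a"
  have "- ((real r)\<^sup>2 * ?s) \<le> (real (psize a))\<^sup>2 - (real r)\<^sup>2 * ?s" by simp
  also have "\<dots> \<le> 2 * real r * ?K" by (rule total_content_lower_bound[OF a])
  finally have "real r * (- (real r * ?s)) \<le> real r * (2 * ?K)" by (simp add: power2_eq_square mult_ac)
  hence K: "- (real r * ?s) \<le> 2 * ?K" by (rule mult_left_le_imp_le) (use r(2) in simp)
  have "real r * ?s \<le> real N / 2 * ?s" using r(1) by (intro mult_right_mono) auto
  hence K2: "- (real N / 2 * ?s) \<le> 2 * ?K" using K by linarith
  have "- ?s \<le> bcd_shift T * ?s" using mult_right_mono[OF bcd_shift_bounds(1)[of T], of ?s] by simp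
  hence "- (real N / 2 * ?s) - ?s \<le> 2 * ?K + bcd_shift T * ?s" using K2 by linarith
  hence "(- (real N / 2 * ?s) - ?s) / real N \<le> (2 * ?K + bcd_shift T * ?s) / real N"
    by (rule divide_right_mono) simp
  moreover have "(- (real N / 2 * ?s) - ?s) / real N = - ?s / 2 - ?s / real N" using N by (simp add: field_simps)
  moreover have "?s / real N \<le> ?s / 4" using N by (intro divide_left_mono) auto
  ultimately have "?s / 4 \<le> ?s + (2 * ?K + bcd_shift T * ?s) / real N" by linarith
  hence "t / 2 * (?s / 4) \<le> t / 2 * (?s + (2 * ?K + bcd_shift T * ?s) / real N)"
    using t by (intro mult_left_mono) auto
  thus ?thesis unfolding bcd_weight_exp_eq small_base_power by simp
qed

lemma content_exponent_bound:
  assumes t: "t > 0" and N: "N \<ge> 1" and a: "a \<in> partitions"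
  shows "\<bar>content_exponent t N a\<bar> \<le> t * (1 + real (psize a)) ^ 2 / real N"
proof -
  have "\<bar>content_exponent t N a\<bar> = t * \<bar>total_content a\<bar> / real N"
    using t by (simp add: content_exponent_def abs_mult abs_divide)
  also have "\<dots> \<le> t * (real (psize a))\<^sup>2 / real N"
    using t total_content_bound[OF a] by (intro divide_right_mono mult_left_mono) auto
  also have "\<dots> \<le> t * (1 + real (psize a)) ^ 2 / real N"
    using t by (intro divide_right_mono mult_left_mono power_mono) auto
  finally show ?thesis .
qed

lemma central_heat_trace_BC:
  assumes T: "T \<in> {TypeB, TypeC}" and N: "N \<ge> 4"
  shows "central_heat_trace T N t
    = (\<Sum>\<^sub>\<infinity>a\<in>parts_le (weight_length T N). bcd_weight T t N a * exp (content_exponent t N a))"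
proof -
  let ?r = "weight_length T N"
  have hw: "highest_weights T N = {l. length l = ?r \<and> sorted_wrt (\<ge>) l \<and> (\<forall>x\<in>set l. x \<ge> 0)}"
    using T by (auto simp: highest_weights_def)
  have "central_heat_trace T N t
      = (\<Sum>\<^sub>\<infinity>a\<in>parts_le ?r. exp (- (t / 2) * casimir T N (weight_of ?r a)))"
    unfolding central_heat_trace_def hw by (rule infsum_reindex_bij_betw[OF bij_weight_of, symmetric])
  also have "\<dots> = (\<Sum>\<^sub>\<infinity>a\<in>parts_le ?r. bcd_weight T t N a * exp (content_exponent t N a))"
  proof (rule infsum_cong)
    fix a assume a: "a \<in> parts_le ?r"
    have "casimir T N (weight_of ?r a) = real (psize a) + (2 * total_content a + bcd_shift T * real (psize a)) / real N"
      using T N casimir_sum_weight_of[OF a, of N 0] casimir_sum_weight_of[OF a, of N 2] by (auto simp: bcd_shift_def)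
    thus "exp (- (t / 2) * casimir T N (weight_of ?r a)) = bcd_weight T t N a * exp (content_exponent t N a)"
      unfolding bcd_weight_exp_eq by simp
  qed
  finally show ?thesis .
qed

text \<open>The weights with negative last entry repeat the summands of the partitions with exactly
  r rows.\<close>

lemma central_heat_trace_D:
  assumes t: "t > 0" and N: "N \<ge> 4" and adm: "even N"
  defines "r \<equiv> N div 2"
  defines "f \<equiv> (\<lambda>a. bcd_weight TypeD t N a * exp (content_exponent t N a))"
  shows "central_heat_trace TypeD N t = infsum f (parts_le r) + infsum f {a \<in> parts_le r. a (r - 1) > 0}"
proof -
  define W where "W = {l. length l = N div 2 \<and> sorted_wrt (\<ge>) l \<and> (\<forall>x\<in>set l. x \<ge> (0::int))}"
  define F where "F l = exp (- (t / 2) * casimir_sum 0 N l)" for l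
  have N1: "N \<ge> 1" using N by simp
  have r1: "r \<ge> 1" "2 * r \<le> N" using N unfolding r_def by auto
  note hw = highest_weights_D[OF N1 adm, folded W_def]
  have bij: "bij_betw (weight_of r) (parts_le r) W" using bij_weight_of[of r] unfolding W_def r_def .
  have Ff: "F (weight_of r a) = f a" if "a \<in> parts_le r" for a
    unfolding F_def f_def bcd_weight_exp_eq casimir_sum_weight_of[OF that N1] by (simp add: bcd_shift_def)
  have smf: "f summable_on parts_le r"
  proof (rule tame_bound(1)[OF tame_subset[OF tame_partitions parts_le_subset] small_base[OF t], where e = 1 and r = 0])
    fix a assume "a \<in> parts_le r"
    from bcd_weight_exp_bound[OF t N r1(2,1) this, of TypeD]
    show "\<bar>f a\<bar> \<le> 1 * (small_base t ^ psize a * (1 + real (psize a)) ^ 0)"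
      using bcd_weight_bound(1)[OF t N, of TypeD a] unfolding f_def by simp
  qed
  have smFW: "F summable_on W"
  proof -
    have "(\<lambda>a. F (weight_of r a)) summable_on parts_le r"
      by (rule summable_on_cong[THEN iffD2, rotated, OF smf]) (rule Ff)
    thus ?thesis using summable_on_reindex_bij_betw[OF bij, of F] by simp
  qed
  have FW: "infsum F W = infsum f (parts_le r)"
    unfolding infsum_reindex_bij_betw[OF bij, symmetric] by (rule infsum_cong) (rule Ff)
  let ?V = "{l \<in> W. last l > 0}"
  have Wl: "length l = N div 2" "l \<noteq> []" if "l \<in> W" for l
    using that r1 unfolding W_def r_def by auto
  have Fflip: "F (flip_last l) = F l" if "l \<in> W" for l
    unfolding F_def casimir_flip_last[OF adm Wl[OF that]] ..
  have bijf: "bij_betw flip_last ?V (flip_last ` ?V)" by (rule inj_on_imp_bij_betw[OF hw(3)])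
  have smFV: "F summable_on ?V" by (rule summable_on_subset_banach[OF smFW]) blast
  hence "(\<lambda>l. F (flip_last l)) summable_on ?V"
    by (rule summable_on_cong[THEN iffD1, rotated]) (simp add: Fflip)
  hence smFl: "F summable_on flip_last ` ?V" using summable_on_reindex_bij_betw[OF bijf, of F] by simp
  have "infsum F (flip_last ` ?V) = (\<Sum>\<^sub>\<infinity>l\<in>?V. F (flip_last l))"
    by (rule infsum_reindex_bij_betw[OF bijf, symmetric])
  also have "\<dots> = infsum F ?V" by (rule infsum_cong) (simp add: Fflip)
  also have "\<dots> = infsum f {a \<in> parts_le r. a (r - 1) > 0}"
  proof -
    have lastw: "last (weight_of r a) = int (a (r - 1))" for a
    proof -
      have "weight_of r a \<noteq> []" using length_weight_of[of r a] r1 by auto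
      thus ?thesis using r1 by (simp add: last_conv_nth length_weight_of nth_weight_of)
    qed
    have "bij_betw (weight_of r) {a \<in> parts_le r. a (r - 1) > 0} ?V"
    proof (rule bij_betw_subset[OF bij])
      show "weight_of r ` {a \<in> parts_le r. a (r - 1) > 0} = ?V"
      proof (intro equalityI subsetI)
        fix l assume "l \<in> ?V"
        hence l: "l \<in> weight_of r ` parts_le r" "last l > 0" using bij by (simp_all add: bij_betw_def)
        from l(1) obtain a where "l = weight_of r a" "a \<in> parts_le r" by (rule imageE)
        thus "l \<in> weight_of r ` {a \<in> parts_le r. a (r - 1) > 0}" using l(2) by (simp add: lastw)
      next
        fix l assume "l \<in> weight_of r ` {a \<in> parts_le r. a (r - 1) > 0}"
        then obtain a where "l = weight_of r a" "a \<in> {a \<in> parts_le r. a (r - 1) > 0}" by (rule imageE)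
        thus "l \<in> ?V" using bij_betwE[OF bij] by (simp add: lastw)
      qed
    qed blast
    from infsum_reindex_bij_betw[OF this, of F]
    have "infsum F ?V = (\<Sum>\<^sub>\<infinity>a\<in>{a \<in> parts_le r. a (r - 1) > 0}. F (weight_of r a))" by simp
    also have "\<dots> = infsum f {a \<in> parts_le r. a (r - 1) > 0}" by (rule infsum_cong) (simp add: Ff)
    finally show ?thesis .
  qed
  finally have "infsum F (flip_last ` ?V) = infsum f {a \<in> parts_le r. a (r - 1) > 0}" .
  moreover have "central_heat_trace TypeD N t = infsum F W + infsum F (flip_last ` ?V)"
    unfolding central_heat_trace_def hw(1) casimir.simps F_def[symmetric]
    by (rule infsum_Un_disjoint[OF smFW smFl hw(2)])
  ultimately show ?thesis unfolding FW by simp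
qed

text \<open>The integral produces the even orders up to p only. The odd orders of the Taylor
  polynomial can be added because they sum to 0: apart from the power of the content, the summand
  depends on the size alone.\<close>

lemma expansion1_eq:
  assumes t: "t > 0" and T: "T \<in> {TypeB, TypeC, TypeD}" and N: "N \<ge> 4"
  shows "expansion1 T p N t
    = (\<Sum>\<^sub>\<infinity>a\<in>partitions. bcd_weight T t N a * (\<Sum>j<p + 1. content_exponent t N a ^ j / fact j))"
proof -
  define g where "g j a = bcd_weight T t N a * (content_exponent t N a ^ j / fact j)" for j a
  have gb: "\<bar>g j a\<bar> \<le> t ^ j * (small_base t ^ psize a * (1 + real (psize a)) ^ (2 * j))" if a: "a \<in> partitions" for j a
  proof -
    have "\<bar>content_exponent t N a\<bar> \<le> t * (1 + real (psize a)) ^ 2 / real N"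
      using content_exponent_bound[OF t _ a, of N] N by simp
    also have "\<dots> \<le> t * (1 + real (psize a)) ^ 2 / 1" using t N by (intro divide_left_mono) auto
    finally have "\<bar>content_exponent t N a\<bar> ^ j \<le> (t * (1 + real (psize a)) ^ 2) ^ j" by (intro power_mono) auto
    hence x: "\<bar>content_exponent t N a\<bar> ^ j \<le> t ^ j * (1 + real (psize a)) ^ (2 * j)"
      by (simp only: power_mult_distrib power_mult)
    have "\<bar>content_exponent t N a ^ j / fact j\<bar> = \<bar>content_exponent t N a\<bar> ^ j / fact j"
      by (simp add: abs_divide power_abs)
    also have "\<dots> \<le> \<bar>content_exponent t N a\<bar> ^ j / 1"
      using fact_ge_1[of j, where ?'a = real] by (intro divide_left_mono) auto
    finally have "\<bar>content_exponent t N a ^ j / fact j\<bar> \<le> t ^ j * (1 + real (psize a)) ^ (2 * j)" using x by simp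
    hence "bcd_weight T t N a * \<bar>content_exponent t N a ^ j / fact j\<bar>
        \<le> small_base t ^ psize a * (t ^ j * (1 + real (psize a)) ^ (2 * j))"
      using bcd_weight_bound[OF t N, of T a] small_base[OF t] by (intro mult_mono) auto
    thus ?thesis using bcd_weight_bound(1)[OF t N, of T a] unfolding g_def abs_mult by (simp add: mult_ac)
  qed
  have smg: "g j summable_on partitions" for j
    by (rule tame_bound(1)[OF tame_partitions small_base[OF t] gb])
  define F :: "nat \<times> nat \<Rightarrow> real" where
    "F x = of_bool (snd x \<le> p) * exp (- (t * bcd_shift T / (2 * real N)) * real (fst x)) * real N powi (- int (snd x))" for x
  define h where "h x = content_weight t x * F (psize (fst x), snd x)" for x
  let ?E = "{k. even k \<and> k \<le> p}"
  have finE: "finite ?E" by (rule finite_subset[of _ "{..p}"]) auto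
  have hg: "h x = g (snd x) (fst x)" if "x \<in> partitions \<times> ?E" for x
  proof -
    obtain a k where x: "x = (a, k)" by (cases x)
    have k: "even k" "k \<le> p" using that unfolding x by auto
    have "real N powi (- int k) = 1 / real N ^ k" by (simp add: power_int_minus divide_inverse)
    moreover have "content_exponent t N a ^ k = t ^ k * total_content a ^ k / real N ^ k"
      using k(1) by (simp add: content_exponent_def power_divide power_mult_distrib)
    ultimately show ?thesis unfolding h_def F_def g_def bcd_weight_def content_weight_def x using k by (simp add: mult_ac)
  qed
  have h0: "h x = 0" if "x \<in> content_index - partitions \<times> ?E" for x
    using that unfolding h_def F_def content_index_def by auto
  have "((\<lambda>x. g (snd x) (fst x)) has_sum (\<Sum>k\<in>?E. \<Sum>\<^sub>\<infinity>a\<in>partitions. g k a)) (partitions \<times> ?E)"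
    using infsum_times_finite[OF finE, of "\<lambda>a k. g k a" partitions] smg by simp
  hence "(h has_sum (\<Sum>k\<in>?E. \<Sum>\<^sub>\<infinity>a\<in>partitions. g k a)) (partitions \<times> ?E)"
    by (rule has_sum_cong[THEN iffD2, rotated]) (rule hg)
  hence hs: "(h has_sum (\<Sum>k\<in>?E. \<Sum>\<^sub>\<infinity>a\<in>partitions. g k a)) content_index"
    by (rule has_sum_cong_neutral[THEN iffD1, rotated 3]) (use h0 in \<open>auto simp: content_index_def\<close>)
  have integrand: "of_bool (cov_euler X \<ge> - int p) * Phi1 T t N X * real N powi cov_euler X
      = F (cov_deg X, ramification_count X)" for X
    using T unfolding F_def cov_euler_def by (auto simp: Phi_BD_def Phi_C_def bcd_shift_def)
  have "expansion1 T p N t = (\<integral>X. F (cov_deg X, ramification_count X) \<partial>(rho t))"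
    unfolding expansion1_def integrand ..
  also have "\<dots> = infsum h content_index"
    unfolding h_def by (rule integral_rho[OF t]) (use hs in \<open>simp add: h_def[abs_def] has_sum_imp_summable\<close>)
  also have "\<dots> = (\<Sum>k\<in>?E. infsum (g k) partitions)" using infsumI[OF hs] by simp
  also have "\<dots> = (\<Sum>k<p + 1. infsum (g k) partitions)"
  proof (rule sum.mono_neutral_left)
    show "\<forall>k\<in>{..<p + 1} - ?E. infsum (g k) partitions = 0"
    proof
      fix k assume "k \<in> {..<p + 1} - ?E"
      hence odd: "odd k" by auto
      \<comment> \<open>There are no further coordinates, so the parameter set is a single
        point.\<close>
      have bij: "bij_betw snd ({()} \<times> partitions) partitions"
        by (rule bij_betw_byWitness[where f' = "\<lambda>a. ((), a)"]) auto
      show "infsum (g k) partitions = 0"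
      proof (rule infsum_odd_content[OF bij smg odd])
        fix y a
        show "g k (snd (y, a)) = (\<lambda>_ s. q_of t ^ s * exp (- (t * bcd_shift T / (2 * real N)) * real s)
            * ((- t / real N) ^ k / fact k)) y (psize a) * total_content a ^ k"
        proof -
          have x: "content_exponent t N a = (- t / real N) * total_content a" by (simp add: content_exponent_def)
          show ?thesis unfolding snd_conv g_def bcd_weight_def x power_mult_distrib by simp
        qed
      qed
    qed
  qed auto
  also have "\<dots> = (\<Sum>\<^sub>\<infinity>a\<in>partitions. \<Sum>k<p + 1. g k a)"
    by (rule infsumI[OF has_sum_finite_sum, symmetric]) (simp_all add: smg)
  also have "\<dots> = (\<Sum>\<^sub>\<infinity>a\<in>partitions. bcd_weight T t N a * (\<Sum>j<p + 1. content_exponent t N a ^ j / fact j))"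
    unfolding g_def sum_distrib_left ..
  finally show ?thesis .
qed

theorem expansion_BCD:
  assumes t: "t > 0" and T: "T \<in> {TypeB, TypeC, TypeD}"
  shows "\<exists>C. \<forall>N\<ge>4. admissible T N \<longrightarrow>
     \<bar>central_heat_trace T N t - expansion1 T p N t\<bar> \<le> C * real N powi (- int p - 1)"
proof -
  let ?Adm = "\<lambda>N. N \<ge> 4 \<and> admissible T N"
  let ?f = "\<lambda>N a. bcd_weight T t N a * exp (content_exponent t N a)"
  have r: "2 * weight_length T N \<le> N \<and> weight_length T N \<ge> 1 \<and> N \<le> 2 * weight_length T N + 1" if "?Adm N" for N
    using that T by auto
  have out: "real N \<le> 2 * (1 + real (psize a))" if "?Adm N" "weight_length T N \<le> psize a" for N a
  proof -
    have "N \<le> 2 * psize a + 1" using r[OF that(1)] that(2) by linarith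
    hence "real N \<le> real (2 * psize a + 1)" by (simp only: of_nat_le_iff)
    thus ?thesis by simp
  qed
  have "\<exists>C. \<forall>N. ?Adm N \<longrightarrow> \<bar>(\<Sum>\<^sub>\<infinity>a\<in>parts_le (weight_length T N). ?f N a)
      - (\<Sum>\<^sub>\<infinity>a\<in>partitions. bcd_weight T t N a * (\<Sum>j<p + 1. content_exponent t N a ^ j / fact j))\<bar> \<le> C / real N ^ (p + 1)"
  proof (rule taylor_family[OF tame_partitions small_base[OF t], where B = t and c = 2 and r = 2])
    show "parts_le (weight_length T N) \<subseteq> partitions" for N by (rule parts_le_subset)
    show "0 \<le> bcd_weight T t N a \<and> bcd_weight T t N a \<le> small_base t ^ psize a" if "?Adm N" for N a
      using bcd_weight_bound[OF t, of N T a] that by simp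
    show "\<bar>content_exponent t N a\<bar> \<le> t * (1 + real (psize a)) ^ 2 / real N" if "?Adm N" "a \<in> partitions" for N a
      using content_exponent_bound[OF t _ that(2), of N] that(1) by simp
    show "?f N a \<le> small_base t ^ psize a" if "?Adm N" "a \<in> parts_le (weight_length T N)" for N a
      using bcd_weight_exp_bound[OF t _ _ _ that(2), of N T] that(1) r[OF that(1)] by simp
    show "real N \<le> 2 * (1 + real (psize a))" if "?Adm N" "a \<in> partitions - parts_le (weight_length T N)" for N a
      by (rule out[OF that(1)]) (use that(2) psize_gt_if_not_parts_le[of a "weight_length T N"] in auto)
  qed (use t in auto)
  then obtain C1 where C1: "\<And>N. ?Adm N \<Longrightarrow> \<bar>(\<Sum>\<^sub>\<infinity>a\<in>parts_le (weight_length T N). ?f N a) - expansion1 T p N t\<bar> \<le> C1 / real N ^ (p + 1)"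
    using expansion1_eq[OF t T] by auto
  define S where "S = (\<Sum>\<^sub>\<infinity>a\<in>partitions. small_base t ^ psize a * (1 + real (psize a)) ^ (p + 1))"
  \<comment> \<open>The repeated summands of type D belong to partitions with r nonzero rows, hence
    of size at least r = N/2, and are of the order of the error.\<close>
  have extra: "\<bar>infsum (?f N) {a \<in> parts_le r. a (r - 1) > 0}\<bar> \<le> 2 ^ (p + 1) / real N ^ (p + 1) * S"
    if N: "?Adm N" and rN: "r = weight_length T N" for N r
  proof -
    let ?X = "{a \<in> parts_le r. a (r - 1) > 0}"
    have N4: "N \<ge> 4" using N by (rule conjunct1)
    have Npos: "real N ^ (p + 1) > 0" using N4 by (intro zero_less_power) simp
    have r1: "2 * r \<le> N" "r \<ge> 1" using r[OF N] unfolding rN by blast+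
    have sub: "?X \<subseteq> partitions" using parts_le_subset by blast
    have "infsum (?f N) ?X = infsum (\<lambda>a. if a \<in> ?X then ?f N a else 0) partitions"
    proof (rule infsum_cong_neutral)
      show "(if a \<in> ?X then ?f N a else 0) = 0" if "a \<in> partitions - ?X" for a
        using that by (intro if_not_P) blast
      show "?f N a = 0" if "a \<in> ?X - partitions" for a using that sub by blast
      show "?f N a = (if a \<in> ?X then ?f N a else 0)" if "a \<in> ?X \<inter> partitions" for a
        using that by (intro if_P[symmetric]) blast
    qed
    moreover have "\<bar>\<Sum>\<^sub>\<infinity>a\<in>partitions. if a \<in> ?X then ?f N a else 0\<bar> \<le> 2 ^ (p + 1) / real N ^ (p + 1) * S"
      unfolding S_def
    proof (rule tame_bound(2)[OF tame_partitions small_base[OF t]])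
      fix a :: "nat \<Rightarrow> nat"
      show "\<bar>if a \<in> ?X then ?f N a else 0\<bar>
          \<le> 2 ^ (p + 1) / real N ^ (p + 1) * (small_base t ^ psize a * (1 + real (psize a)) ^ (p + 1))"
      proof (cases "a \<in> ?X")
        case True
        hence a: "a \<in> parts_le r" "a (r - 1) > 0" by simp_all
        have "r \<le> psize a"
        proof -
          have mono: "antimono a" using a by (simp add: parts_le_def)
          have le: "a (r - 1) \<le> a i" if "i < r" for i by (rule antimonoD[OF mono]) (use that in simp)
          have ge: "a i \<ge> 1" if "i < r" for i using le[OF that] a(2) by linarith
          have "r = (\<Sum>i<r. 1)" by simp
          also have "\<dots> \<le> (\<Sum>i<r. a i)" by (rule sum_mono) (use ge in simp)
          also have "\<dots> = psize a" by (rule psize_eq[symmetric]) (use a in \<open>simp add: parts_le_def\<close>)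
          finally show ?thesis .
        qed
        hence "real N \<le> 2 * (1 + real (psize a))" unfolding rN by (rule out[OF N])
        hence "real N ^ (p + 1) \<le> (2 * (1 + real (psize a))) ^ (p + 1)" by (intro power_mono) auto
        hence one: "1 \<le> 2 ^ (p + 1) * (1 + real (psize a)) ^ (p + 1) / real N ^ (p + 1)"
          unfolding power_mult_distrib by (subst pos_le_divide_eq[OF Npos]) simp
        have f0: "0 \<le> ?f N a" by (intro mult_nonneg_nonneg bcd_weight_bound(1)[OF t N4]) simp
        have "?f N a \<le> small_base t ^ psize a" by (rule bcd_weight_exp_bound[OF t N4 r1 a(1)])
        also have "\<dots> \<le> small_base t ^ psize a * (2 ^ (p + 1) * (1 + real (psize a)) ^ (p + 1) / real N ^ (p + 1))"
          using mult_left_mono[OF one, of "small_base t ^ psize a"] small_base(1)[OF t] by simp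
        also have "\<dots> = 2 ^ (p + 1) / real N ^ (p + 1) * (small_base t ^ psize a * (1 + real (psize a)) ^ (p + 1))"
          by (simp only: times_divide_eq_left times_divide_eq_right mult_ac)
        finally show ?thesis unfolding if_P[OF True] abs_of_nonneg[OF f0] .
      next
        case False
        thus ?thesis unfolding if_not_P[OF False] using small_base(1)[OF t] by simp
      qed
    qed
    ultimately show ?thesis by simp
  qed
  have S0: "S \<ge> 0" unfolding S_def by (intro infsum_nonneg) (use small_base(1)[OF t] in simp)
  show ?thesis
  proof (intro exI[of _ "C1 + 2 ^ (p + 1) * S"] allI impI)
    fix N assume N4: "4 \<le> N" and adm: "admissible T N"
    hence N: "?Adm N" by simp
    have pw: "real N powi (- int p - 1) = 1 / real N ^ (p + 1)"
    proof -
      have "- int p - 1 = - int (p + 1)" by simp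
      thus ?thesis by (simp only: power_int_minus power_int_of_nat divide_inverse mult_1)
    qed
    let ?J = "\<Sum>\<^sub>\<infinity>a\<in>parts_le (weight_length T N). ?f N a"
    have "\<bar>central_heat_trace T N t - ?J\<bar> \<le> 2 ^ (p + 1) / real N ^ (p + 1) * S"
    proof (cases "T = TypeD")
      case True
      have wl: "weight_length T N = N div 2" unfolding True by (rule weight_length.simps)
      have ev: "even N" using adm unfolding True admissible.simps by (rule conjunct2)
      have "central_heat_trace T N t = ?J + infsum (?f N) {a \<in> parts_le (N div 2). a (N div 2 - 1) > 0}"
        unfolding wl unfolding True by (rule central_heat_trace_D[OF t N4 ev])
      hence "central_heat_trace T N t - ?J = infsum (?f N) {a \<in> parts_le (N div 2). a (N div 2 - 1) > 0}"
        by (rule HOL.trans[OF arg_cong[where f = "\<lambda>x. x - ?J"] add_diff_cancel_left'])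
      thus ?thesis using extra[OF N wl[symmetric]] by (simp only:)
    next
      case False
      hence "central_heat_trace T N t = ?J" using T by (intro central_heat_trace_BC[OF _ N4]) auto
      thus ?thesis using S0 by simp
    qed
    hence "\<bar>central_heat_trace T N t - expansion1 T p N t\<bar> \<le> 2 ^ (p + 1) / real N ^ (p + 1) * S + C1 / real N ^ (p + 1)"
      using C1[OF N] by linarith
    also have "\<dots> = (C1 + 2 ^ (p + 1) * S) * real N powi (- int p - 1)"
      unfolding pw by (simp add: add_divide_distrib)
    finally show "\<bar>central_heat_trace T N t - expansion1 T p N t\<bar> \<le> (C1 + 2 ^ (p + 1) * S) * real N powi (- int p - 1)" .
  qed
qed

section \<open>Types A' and A\<close>

lemma exp_term_add:
  fixes x y :: real
  shows "(x + y) ^ n / fact n = (\<Sum>i\<le>n. x ^ i / fact i * (y ^ (n - i) / fact (n - i)))"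
  using exp_series_add_commuting[of x y n] by (simp add: divide_inverse mult_ac)

text \<open>Separates the three exponents, so that the vanishing by parity can be applied to each of
  them.\<close>

lemma exp_taylor_trinomial:
  fixes a b c :: real
  shows "(\<Sum>m<M. (a + b + c) ^ m / fact m)
    = (\<Sum>(i, j, k)\<in>{(i, j, k). i + j + k < M}. a ^ i / fact i * (b ^ j / fact j) * (c ^ k / fact k))"
proof -
  let ?g = "\<lambda>i j k. a ^ i / fact i * (b ^ j / fact j) * (c ^ k / fact k)"
  have "(\<Sum>m<M. (a + b + c) ^ m / fact m) = (\<Sum>m<M. \<Sum>i\<le>m. \<Sum>j\<le>m - i. ?g i j (m - i - j))"
  proof (intro sum.cong refl)
    fix m
    have "(a + b + c) ^ m / fact m = (\<Sum>i\<le>m. a ^ i / fact i * ((b + c) ^ (m - i) / fact (m - i)))"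
      unfolding add.assoc by (rule exp_term_add)
    also have "\<dots> = (\<Sum>i\<le>m. \<Sum>j\<le>m - i. ?g i j (m - i - j))"
      unfolding exp_term_add[of b c] sum_distrib_left by (simp only: mult.assoc)
    finally show "(a + b + c) ^ m / fact m = (\<Sum>i\<le>m. \<Sum>j\<le>m - i. ?g i j (m - i - j))" .
  qed
  also have "\<dots> = (\<Sum>(m, i, j)\<in>(SIGMA m:{..<M}. SIGMA i:{..m}. {..m - i}). ?g i j (m - i - j))"
    by (simp add: sum.Sigma)
  also have "\<dots> = (\<Sum>(i, j, k)\<in>{(i, j, k). i + j + k < M}. ?g i j k)"
    by (rule sum.reindex_bij_witness[where i = "\<lambda>(i, j, k). (i + j + k, i, j)" and j = "\<lambda>(m, i, j). (i, j, m - i - j)"]) auto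
  finally show ?thesis .
qed

text \<open>For these types the Casimir number will be at least half of the degree, and t/2 times
  1/2 is t/4.\<close>

definition mid_base :: "real \<Rightarrow> real" where
  "mid_base t = exp (- t / 4)"

lemma mid_base_power: "mid_base t ^ n = exp (- t / 4 * real n)"
  unfolding mid_base_def exp_of_nat_mult[symmetric] by (rule arg_cong[where f = exp], rule mult.commute)

lemma mid_base: "t > 0 \<Longrightarrow> 0 < mid_base t" "t > 0 \<Longrightarrow> mid_base t < 1"
  by (simp_all add: mid_base_def)

type_synonym triple_index = "(nat \<Rightarrow> nat) \<times> (nat \<Rightarrow> nat) \<times> int"

text \<open>Nested in this way so that two applications of \<open>tame_times\<close> match it
  literally.\<close>

definition triple_deg :: "triple_index \<Rightarrow> nat" where
  "triple_deg = (\<lambda>x. psize (fst x) + (\<lambda>y. psize (fst y) + (\<lambda>n. nat \<bar>n\<bar>) (snd y)) (snd x))"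

lemma triple_deg_eq: "triple_deg (a, b, n) = psize a + (psize b + nat \<bar>n\<bar>)"
  by (simp add: triple_deg_def)

definition size_diff :: "triple_index \<Rightarrow> real" where
  "size_diff x = real (psize (fst x)) - real (psize (fst (snd x)))"

lemma tame_triple: "tame triple_deg (partitions \<times> partitions \<times> Z)"
  unfolding triple_deg_def by (intro tame_times tame_partitions tame_int)

text \<open>
  A common frame for U(N), with \<open>Z = UNIV\<close>, \<open>v n = q\<^sup>n\<^sup>2\<close>, \<open>y N n d = - t n d / N\<close>, and for SU(N), with
  \<open>Z = {0}\<close>, \<open>v n = 1\<close>, \<open>y N n d = t d\<^sup>2 / (2 N\<^sup>2)\<close>. Here d is the difference of the sizes of the two
  partitions and \<open>y = O(N\<^sup>-\<^sup>e)\<close>. \<open>KS h\<close> is the set of powers of y kept by the integrand at total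
  ramification h; the powers with \<open>bad k\<close> integrate to 0 by the symmetry n to -n.
\<close>

locale unitary_expansion =
  fixes t :: real and p :: nat and Z :: "int set" and v :: "int \<Rightarrow> real"
    and y :: "nat \<Rightarrow> int \<Rightarrow> real \<Rightarrow> real" and e :: nat and bad :: "nat \<Rightarrow> bool" and KS :: "nat \<Rightarrow> nat set"
  assumes t: "t > 0" and e: "e \<ge> 1"
    and v: "n \<in> Z \<Longrightarrow> 0 \<le> v n \<and> v n \<le> mid_base t ^ nat \<bar>n\<bar>"
    and y: "N \<ge> 1 \<Longrightarrow> n \<in> Z \<Longrightarrow> \<bar>y N n (real a - real b)\<bar> \<le> t * (1 + real (a + (b + nat \<bar>n\<bar>))) ^ 2 / real N ^ e"
    and bad: "bad k \<Longrightarrow> n \<in> Z \<Longrightarrow> - n \<in> Z \<and> v (- n) = v n \<and> y N (- n) d ^ k = - (y N n d ^ k)"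
    and KS_finite: "finite (KS h)"
    and KS: "even i \<Longrightarrow> even j \<Longrightarrow> \<not> bad k \<Longrightarrow> i + j + k < 2 * p + 2 \<Longrightarrow> \<not> (i + j \<le> 2 * p \<and> k \<in> KS (i + j))
      \<Longrightarrow> 2 * p + 2 \<le> i + j + e * k"
begin

abbreviation I :: "triple_index set" where
  "I \<equiv> partitions \<times> partitions \<times> Z"

definition W :: "triple_index \<Rightarrow> real" where
  "W x = q_of t ^ (psize (fst x) + psize (fst (snd x))) * v (snd (snd x))"

definition Y :: "nat \<Rightarrow> triple_index \<Rightarrow> real" where
  "Y N x = y N (snd (snd x)) (size_diff x)"

definition X :: "nat \<Rightarrow> triple_index \<Rightarrow> real" where
  "X N x = content_exponent t N (fst x) + content_exponent t N (fst (snd x)) + Y N x"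

definition g :: "nat \<Rightarrow> nat \<times> nat \<times> nat \<Rightarrow> triple_index \<Rightarrow> real" where
  "g N u x = W x * (content_exponent t N (fst x) ^ fst u / fact (fst u)
     * (content_exponent t N (fst (snd x)) ^ fst (snd u) / fact (fst (snd u))) * (Y N x ^ snd (snd u) / fact (snd (snd u))))"

text \<open>The two row bounds add up to N - 1, which leaves one place for the middle entry, and
  neither exceeds N/2.\<close>

definition box :: "nat \<Rightarrow> triple_index set" where
  "box N = parts_le ((N - 1) div 2) \<times> parts_le (N div 2) \<times> Z"

lemma W_bound:
  assumes "x \<in> I"
  shows "0 \<le> W x" "W x \<le> mid_base t ^ triple_deg x"
proof -
  obtain a b n where x: "x = (a, b, n)" by (metis surj_pair)
  have n: "n \<in> Z" using assms unfolding x by simp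
  have q: "0 \<le> q_of t" "q_of t \<le> mid_base t" using t by (simp_all add: q_of_def mid_base_def)
  have "q_of t ^ (psize a + psize b) \<le> mid_base t ^ (psize a + psize b)" by (rule power_mono[OF q(2,1)])
  hence "q_of t ^ (psize a + psize b) * v n \<le> mid_base t ^ (psize a + psize b) * mid_base t ^ nat \<bar>n\<bar>"
    using v[OF n] q mid_base(1)[OF t] by (intro mult_mono) auto
  thus "W x \<le> mid_base t ^ triple_deg x"
    unfolding W_def x triple_deg_eq by (simp add: power_add mult.assoc)
  show "0 \<le> W x" unfolding W_def x using v[OF n] q by simp
qed

lemma exponent_bounds:
  assumes x: "x \<in> I" and N: "N \<ge> 1"
  shows "\<bar>content_exponent t N (fst x)\<bar> \<le> t * (1 + real (triple_deg x)) ^ 2 / real N"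
    "\<bar>content_exponent t N (fst (snd x))\<bar> \<le> t * (1 + real (triple_deg x)) ^ 2 / real N"
    "\<bar>Y N x\<bar> \<le> t * (1 + real (triple_deg x)) ^ 2 / real N ^ e"
proof -
  obtain a b n where xx: "x = (a, b, n)" by (metis surj_pair)
  have ab: "a \<in> partitions" "b \<in> partitions" "n \<in> Z" using x unfolding xx by simp_all
  have mono: "t * (1 + real s) ^ 2 / real N \<le> t * (1 + real (triple_deg x)) ^ 2 / real N" if "s \<le> triple_deg x" for s
    using that t by (intro divide_right_mono mult_left_mono power_mono) auto
  show "\<bar>content_exponent t N (fst x)\<bar> \<le> t * (1 + real (triple_deg x)) ^ 2 / real N"
    using content_exponent_bound[OF t N ab(1)] mono[of "psize a"] by (simp add: xx triple_deg_eq)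
  show "\<bar>content_exponent t N (fst (snd x))\<bar> \<le> t * (1 + real (triple_deg x)) ^ 2 / real N"
    using content_exponent_bound[OF t N ab(2)] mono[of "psize b"] by (simp add: xx triple_deg_eq)
  show "\<bar>Y N x\<bar> \<le> t * (1 + real (triple_deg x)) ^ 2 / real N ^ e"
    using y[OF N ab(3), of "psize a" "psize b"] unfolding Y_def size_diff_def xx triple_deg_eq fst_conv snd_conv .
qed

lemma g_bound:
  assumes x: "x \<in> I" and N: "N \<ge> 1"
  shows "\<bar>g N (i, j, k) x\<bar> \<le> t ^ (i + j + k) / real N ^ (i + j + e * k)
    * (mid_base t ^ triple_deg x * (1 + real (triple_deg x)) ^ (2 * (i + j + k)))"
proof -
  let ?D = "(1 + real (triple_deg x)) ^ 2"
  have fact_le: "\<bar>s ^ m / fact m\<bar> \<le> r ^ m" if "\<bar>s\<bar> \<le> r" for s r :: real and m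
  proof -
    have "\<bar>s ^ m / fact m\<bar> = \<bar>s\<bar> ^ m / fact m" by (simp add: abs_divide power_abs)
    also have "\<dots> \<le> \<bar>s\<bar> ^ m / 1" using fact_ge_1[of m, where ?'a = real] by (intro divide_left_mono) auto
    also have "\<dots> \<le> r ^ m" using power_mono[OF that, of m] by simp
    finally show ?thesis .
  qed
  note b = exponent_bounds[OF x N, THEN fact_le]
  have pos: "0 \<le> t * ?D / real N" "0 \<le> t * ?D / real N ^ e" using t by simp_all
  have "\<bar>g N (i, j, k) x\<bar> = W x * (\<bar>content_exponent t N (fst x) ^ i / fact i\<bar>
      * \<bar>content_exponent t N (fst (snd x)) ^ j / fact j\<bar> * \<bar>Y N x ^ k / fact k\<bar>)"
    unfolding g_def fst_conv snd_conv abs_mult using W_bound(1)[OF x] by (simp only: abs_of_nonneg)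
  also have "\<dots> \<le> mid_base t ^ triple_deg x * ((t * ?D / real N) ^ i * (t * ?D / real N) ^ j * (t * ?D / real N ^ e) ^ k)"
    by (intro mult_mono b W_bound[OF x] mult_nonneg_nonneg zero_le_power pos abs_ge_zero less_imp_le[OF mid_base(1)[OF t]])
  also have "(t * ?D / real N) ^ i * (t * ?D / real N) ^ j * (t * ?D / real N ^ e) ^ k
      = t ^ (i + j + k) * ?D ^ (i + j + k) / real N ^ (i + j + e * k)"
    by (simp add: power_divide power_mult_distrib power_add power_mult)
  also have "?D ^ (i + j + k) = (1 + real (triple_deg x)) ^ (2 * (i + j + k))" by (rule power_mult[symmetric])
  finally show ?thesis by (simp only: times_divide_eq_left times_divide_eq_right mult_ac)
qed

lemma summable_g: "N \<ge> 1 \<Longrightarrow> g N u summable_on I"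
proof -
  assume N: "N \<ge> 1"
  obtain i j k where u: "u = (i, j, k)" by (metis surj_pair)
  show ?thesis unfolding u by (rule tame_bound(1)[OF tame_triple mid_base[OF t] g_bound[OF _ N]])
qed

text \<open>For odd i or j, all factors but the power of one content depend on that partition
  through its size only. For bad k the reflection of n changes the sign.\<close>

lemma infsum_g_zero:
  assumes N: "N \<ge> 1" and u: "odd i \<or> odd j \<or> bad k"
  shows "infsum (g N (i, j, k)) I = 0"
proof -
  have ce: "content_exponent t N a ^ m = (- t / real N) ^ m * total_content a ^ m" for a m
    unfolding power_mult_distrib[symmetric] content_exponent_def by simp
  consider "odd i" | "odd j" | "bad k" using u by blast
  thus ?thesis
  proof cases
    case 1
    have bij: "bij_betw (\<lambda>(y, a). (a, y)) ((partitions \<times> Z) \<times> partitions) I"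
      by (rule bij_betw_byWitness[where f' = "\<lambda>(a, y). (y, a)"]) auto
    show ?thesis
    proof (rule infsum_odd_content[OF bij summable_g[OF N] 1])
      fix y' a
      show "g N (i, j, k) ((\<lambda>(y, a). (a, y)) (y', a))
        = (\<lambda>y' s. q_of t ^ (s + psize (fst y')) * v (snd y') * ((- t / real N) ^ i / fact i
          * (content_exponent t N (fst y') ^ j / fact j)
          * (y N (snd y') (real s - real (psize (fst y'))) ^ k / fact k))) y' (psize a) * total_content a ^ i"
        unfolding g_def W_def Y_def size_diff_def prod.case fst_conv snd_conv ce[of a i] by simp
    qed
  next
    case 2
    have bij: "bij_betw (\<lambda>(y, b). (fst y, b, snd y)) ((partitions \<times> Z) \<times> partitions) I"
      by (rule bij_betw_byWitness[where f' = "\<lambda>(a, b, n). ((a, n), b)"]) auto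
    show ?thesis
    proof (rule infsum_odd_content[OF bij summable_g[OF N] 2])
      fix y' b
      show "g N (i, j, k) ((\<lambda>(y, b). (fst y, b, snd y)) (y', b))
        = (\<lambda>y' s. q_of t ^ (psize (fst y') + s) * v (snd y') * (content_exponent t N (fst y') ^ i / fact i
          * ((- t / real N) ^ j / fact j)
          * (y N (snd y') (real (psize (fst y')) - real s) ^ k / fact k))) y' (psize b) * total_content b ^ j"
        unfolding g_def W_def Y_def size_diff_def prod.case fst_conv snd_conv ce[of b j] by simp
    qed
  next
    case 3
    have Zneg: "- n \<in> Z" if "n \<in> Z" for n using bad[OF 3 that] by blast
    have bij: "bij_betw (\<lambda>(a, b, n). (a, b, - n)) I I"
      by (rule bij_betw_byWitness[where f' = "\<lambda>(a, b, n). (a, b, - n)"]) (auto simp: Zneg)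
    show ?thesis
    proof (rule infsum_antisymmetric[OF bij])
      fix x assume "x \<in> I"
      moreover obtain a b n where x: "x = (a, b, n)" by (metis surj_pair)
      ultimately have n: "n \<in> Z" by simp
      have "v (- n) = v n" "y N (- n) d ^ k = - (y N n d ^ k)" for d using bad[OF 3 n] by blast+
      thus "g N (i, j, k) ((\<lambda>(a, b, n). (a, b, - n)) x) = - g N (i, j, k) x"
        unfolding x g_def W_def Y_def size_diff_def prod.case fst_conv snd_conv by simp
    qed
  qed
qed

text \<open>
  S indexes the monomials of the Taylor polynomial of degree 2p + 1, E those of the expansion over pairs of
  coverings. Up to monomials with integral 0, they differ only by monomials of order at least 2p + 2 in 1/N.
\<close>

definition S :: "(nat \<times> nat \<times> nat) set" where
  "S = {(i, j, k). i + j + k < 2 * p + 2}"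

definition E0 :: "(nat \<times> nat) set" where
  "E0 = {(i, j). even i \<and> even j \<and> i + j \<le> 2 * p}"

definition E :: "(nat \<times> nat \<times> nat) set" where
  "E = (\<lambda>((i, j), k). (i, j, k)) ` (SIGMA u:E0. KS (fst u + snd u))"

lemma finite_S: "finite S"
  by (rule finite_subset[of _ "{..2 * p + 2} \<times> {..2 * p + 2} \<times> {..2 * p + 2}"]) (auto simp: S_def)

lemma finite_E0: "finite E0"
  by (rule finite_subset[of _ "{..2 * p} \<times> {..2 * p}"]) (auto simp: E0_def)

lemma finite_E: "finite E"
  unfolding E_def by (intro finite_imageI finite_SigmaI finite_E0 KS_finite)

lemma sum_E:
  fixes f :: "nat \<times> nat \<times> nat \<Rightarrow> real"
  shows "sum f E = (\<Sum>u\<in>E0. \<Sum>k\<in>KS (fst u + snd u). f (fst u, snd u, k))"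
proof -
  have "inj_on (\<lambda>((i, j), k). (i, j, k)) (SIGMA u:E0. KS (fst u + snd u))" by (auto simp: inj_on_def)
  hence "sum f E = (\<Sum>z\<in>(SIGMA u:E0. KS (fst u + snd u)). f ((\<lambda>((i, j), k). (i, j, k)) z))"
    unfolding E_def by (rule sum.reindex[unfolded o_def])
  also have "\<dots> = (\<Sum>(u, k)\<in>(SIGMA u:E0. KS (fst u + snd u)). f (fst u, snd u, k))"
    by (intro sum.cong) auto
  also have "\<dots> = (\<Sum>u\<in>E0. \<Sum>k\<in>KS (fst u + snd u). f (fst u, snd u, k))"
    by (rule sum.Sigma[symmetric]) (auto simp: finite_E0 KS_finite)
  finally show ?thesis .
qed

definition moment :: "nat \<times> nat \<times> nat \<Rightarrow> real" where
  "moment u = t ^ (fst u + fst (snd u) + snd (snd u))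
     * (\<Sum>\<^sub>\<infinity>x\<in>I. mid_base t ^ triple_deg x * (1 + real (triple_deg x)) ^ (2 * (fst u + fst (snd u) + snd (snd u))))"

lemma moment_nonneg: "moment u \<ge> 0"
  unfolding moment_def by (intro mult_nonneg_nonneg infsum_nonneg zero_le_power) (use t mid_base(1)[OF t] in auto)

lemma infsum_g_small:
  assumes N: "N \<ge> 1" and u: "u \<in> (S - E) \<union> (E - S)"
  shows "\<bar>infsum (g N u) I\<bar> \<le> moment u / real N ^ (2 * p + 2)"
proof -
  obtain i j k where uu: "u = (i, j, k)" by (metis surj_pair)
  show ?thesis
  proof (cases "odd i \<or> odd j \<or> bad k")
    case True
    have "infsum (g N u) I = 0" unfolding uu by (rule infsum_g_zero[OF N True])
    thus ?thesis using moment_nonneg by simp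
  next
    case False
    hence ev: "even i" "even j" "\<not> bad k" by simp_all
    have memE: "u \<in> E \<longleftrightarrow> i + j \<le> 2 * p \<and> k \<in> KS (i + j)"
      using ev unfolding uu E_def E0_def by (auto simp: image_iff)
    have memS: "u \<in> S \<longleftrightarrow> i + j + k < 2 * p + 2" unfolding uu S_def by simp
    \<comment> \<open>In S but outside E the locale assumption \<open>KS\<close> applies. Outside S
      the degree i + j + k is already at least 2p + 2, and e \<ge> 1 makes the order no
      smaller.\<close>
    have order: "2 * p + 2 \<le> i + j + e * k"
    proof (cases "u \<in> S")
      case True
      thus ?thesis using u memE memS by (intro KS[OF ev]) auto
    next
      case False
      have "k \<le> e * k" using e by simp
      thus ?thesis using False memS by linarith
    qed
    have "\<bar>infsum (g N u) I\<bar> \<le> t ^ (i + j + k) / real N ^ (i + j + e * k)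
        * (\<Sum>\<^sub>\<infinity>x\<in>I. mid_base t ^ triple_deg x * (1 + real (triple_deg x)) ^ (2 * (i + j + k)))"
      unfolding uu by (rule tame_bound(2)[OF tame_triple mid_base[OF t] g_bound[OF _ N]])
    also have "\<dots> = moment u / real N ^ (i + j + e * k)" unfolding moment_def uu fst_conv snd_conv by simp
    also have "\<dots> \<le> moment u / real N ^ (2 * p + 2)"
      using N by (intro divide_left_mono moment_nonneg power_increasing[OF order] mult_pos_pos zero_less_power) auto
    finally show ?thesis .
  qed
qed

lemma expansion_error:
  assumes we: "\<And>N x. N \<ge> 3 \<Longrightarrow> x \<in> box N \<Longrightarrow> W x * exp (X N x) \<le> mid_base t ^ triple_deg x"
  shows "\<exists>C. \<forall>N\<ge>3. \<bar>(\<Sum>\<^sub>\<infinity>x\<in>box N. W x * exp (X N x)) - (\<Sum>u\<in>E. infsum (g N u) I)\<bar> \<le> C / real N ^ (2 * p + 2)"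
proof -
  have "\<exists>C. \<forall>N. 3 \<le> N \<longrightarrow> \<bar>(\<Sum>\<^sub>\<infinity>x\<in>box N. W x * exp (X N x))
      - (\<Sum>\<^sub>\<infinity>x\<in>I. W x * (\<Sum>m<2 * p + 2. X N x ^ m / fact m))\<bar> \<le> C / real N ^ (2 * p + 2)"
  \<comment> \<open>B = 3 t, since X is a sum of three exponents bounded by t (1 + deg)^2 / N each;
    c = 2, since a partition outside the row bounds has size at least N/2.\<close>
  proof (rule taylor_family[OF tame_triple mid_base[OF t], where B = "3 * t" and c = 2 and r = 2])
    show "box N \<subseteq> I" for N unfolding box_def using parts_le_subset by blast
    show "0 \<le> W x \<and> W x \<le> mid_base t ^ triple_deg x" if "x \<in> I" for x using W_bound[OF that] by simp
    show "\<bar>X N x\<bar> \<le> 3 * t * (1 + real (triple_deg x)) ^ 2 / real N" if N: "3 \<le> N" and x: "x \<in> I" for N x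
    proof -
      let ?b = "t * (1 + real (triple_deg x)) ^ 2"
      have N1: "N \<ge> 1" using N by simp
      have "real N ^ 1 \<le> real N ^ e" using N1 e by (intro power_increasing) auto
      hence "?b / real N ^ e \<le> ?b / real N ^ 1" using N1 t by (intro divide_left_mono mult_pos_pos zero_less_power) auto
      hence "\<bar>Y N x\<bar> \<le> ?b / real N" using exponent_bounds(3)[OF x N1] by simp
      moreover have "\<bar>X N x\<bar> \<le> \<bar>content_exponent t N (fst x)\<bar> + \<bar>content_exponent t N (fst (snd x))\<bar> + \<bar>Y N x\<bar>"
        unfolding X_def by linarith
      ultimately have "\<bar>X N x\<bar> \<le> ?b / real N + ?b / real N + ?b / real N"
        using exponent_bounds(1,2)[OF x N1] by linarith
      thus ?thesis by simp
    qed
    show "W x * exp (X N x) \<le> mid_base t ^ triple_deg x" if "3 \<le> N" "x \<in> box N" for N x using we that .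
    show "real N \<le> 2 * (1 + real (triple_deg x))" if N: "3 \<le> N" and x: "x \<in> I - box N" for N x
    proof -
      obtain a b n where xx: "x = (a, b, n)" by (metis surj_pair)
      have "a \<in> partitions" "b \<in> partitions" "a \<notin> parts_le ((N - 1) div 2) \<or> b \<notin> parts_le (N div 2)"
        using x unfolding xx box_def by auto
      hence "(N - 1) div 2 < psize a \<or> N div 2 < psize b" using psize_gt_if_not_parts_le by blast
      moreover have "N \<le> 2 * ((N - 1) div 2) + 2" "N \<le> 2 * (N div 2) + 1" by simp_all
      ultimately have "N \<le> 2 * (1 + triple_deg x)" unfolding xx triple_deg_eq by auto
      hence "real N \<le> real (2 * (1 + triple_deg x))" by (simp only: of_nat_le_iff)
      thus ?thesis by simp
    qed
  qed (use t in auto)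
  then obtain C where C: "\<And>N. 3 \<le> N \<Longrightarrow> \<bar>(\<Sum>\<^sub>\<infinity>x\<in>box N. W x * exp (X N x))
      - (\<Sum>\<^sub>\<infinity>x\<in>I. W x * (\<Sum>m<2 * p + 2. X N x ^ m / fact m))\<bar> \<le> C / real N ^ (2 * p + 2)" by blast
  define D where "D = (\<Sum>u\<in>(S - E) \<union> (E - S). moment u)"
  show ?thesis
  proof (intro exI[of _ "C + D"] allI impI)
    fix N :: nat assume N: "3 \<le> N"
    hence N1: "N \<ge> 1" by simp
    let ?A = "\<lambda>u. infsum (g N u) I"
    have "(\<Sum>\<^sub>\<infinity>x\<in>I. W x * (\<Sum>m<2 * p + 2. X N x ^ m / fact m)) = (\<Sum>\<^sub>\<infinity>x\<in>I. \<Sum>u\<in>S. g N u x)"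
    proof (rule infsum_cong)
      fix x
      show "W x * (\<Sum>m<2 * p + 2. X N x ^ m / fact m) = (\<Sum>u\<in>S. g N u x)"
        unfolding X_def exp_taylor_trinomial S_def sum_distrib_left g_def
        by (intro sum.cong) auto
    qed
    also have "\<dots> = (\<Sum>u\<in>S. ?A u)"
      by (rule infsumI[OF has_sum_finite_sum[OF finite_S]]) (rule summable_g[OF N1])
    finally have T: "(\<Sum>\<^sub>\<infinity>x\<in>I. W x * (\<Sum>m<2 * p + 2. X N x ^ m / fact m)) = sum ?A S" .
    have "sum ?A S - sum ?A E = sum ?A (S - E) - sum ?A (E - S)"
      using sum.Int_Diff[OF finite_S, of ?A E] sum.Int_Diff[OF finite_E, of ?A S] by (simp add: Int_commute)
    hence "\<bar>sum ?A S - sum ?A E\<bar> \<le> \<bar>sum ?A (S - E)\<bar> + \<bar>sum ?A (E - S)\<bar>" by linarith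
    also have "\<dots> \<le> (\<Sum>u\<in>S - E. \<bar>?A u\<bar>) + (\<Sum>u\<in>E - S. \<bar>?A u\<bar>)" by (intro add_mono sum_abs)
    also have "\<dots> = (\<Sum>u\<in>(S - E) \<union> (E - S). \<bar>?A u\<bar>)"
      by (rule sum.union_disjoint[symmetric]) (use finite_S finite_E in auto)
    also have "\<dots> \<le> (\<Sum>u\<in>(S - E) \<union> (E - S). moment u / real N ^ (2 * p + 2))"
      by (intro sum_mono infsum_g_small[OF N1])
    also have "\<dots> = D / real N ^ (2 * p + 2)" unfolding D_def by (rule sum_divide_distrib[symmetric])
    finally have "\<bar>sum ?A S - sum ?A E\<bar> \<le> D / real N ^ (2 * p + 2)" .
    hence "\<bar>(\<Sum>\<^sub>\<infinity>x\<in>box N. W x * exp (X N x)) - sum ?A E\<bar> \<le> C / real N ^ (2 * p + 2) + D / real N ^ (2 * p + 2)"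
      using C[OF N] unfolding T by linarith
    thus "\<bar>(\<Sum>\<^sub>\<infinity>x\<in>box N. W x * exp (X N x)) - sum ?A E\<bar> \<le> (C + D) / real N ^ (2 * p + 2)"
      by (simp only: add_divide_distrib)
  qed
qed

end

text \<open>\<open>total_content_lower_bound\<close> divided by r N, with r \<le> N/2 used in both
  terms. Half of the size survives, and the quadratic term remains available to absorb the coupling
  of two partitions.\<close>

lemma parts_le_half_bound:
  assumes a: "a \<in> parts_le r" and r: "2 * r \<le> N" and N: "N \<ge> 1"
  shows "real (psize a) / 2 + 2 * (real (psize a))\<^sup>2 / (real N)\<^sup>2 \<le> real (psize a) + 2 * total_content a / real N"
proof (cases "r = 0")
  case True
  hence v: "\<And>i. i \<ge> 0 \<Longrightarrow> a i = 0" using a by (simp add: parts_le_def)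
  have "psize a = 0" "total_content a = 0" using psize_eq[of 0 a] total_content_eq[of 0 a] v by simp_all
  thus ?thesis by simp
next
  case False
  let ?s = "real (psize a)" and ?K = "total_content a"
  have rp: "real r > 0" using False by simp
  have Np: "real N > 0" using N by simp
  have "?s\<^sup>2 - (real r)\<^sup>2 * ?s \<le> real r * (2 * ?K)" using total_content_lower_bound[OF a] by (simp add: mult_ac)
  hence "(?s\<^sup>2 - (real r)\<^sup>2 * ?s) / real r \<le> 2 * ?K" by (subst pos_divide_le_eq[OF rp]) (simp add: mult.commute)
  moreover have "(?s\<^sup>2 - (real r)\<^sup>2 * ?s) / real r = ?s\<^sup>2 / real r - real r * ?s"
    using rp by (simp add: diff_divide_distrib power2_eq_square)
  moreover have "?s\<^sup>2 / (real N / 2) \<le> ?s\<^sup>2 / real r" using r rp Np by (intro divide_left_mono) auto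
  moreover have "real r * ?s \<le> real N / 2 * ?s" using r by (intro mult_right_mono) auto
  ultimately have "?s\<^sup>2 / (real N / 2) - real N / 2 * ?s \<le> 2 * ?K" by linarith
  hence "(?s\<^sup>2 / (real N / 2) - real N / 2 * ?s) / real N \<le> 2 * ?K / real N" using Np by (intro divide_right_mono) auto
  moreover have "(?s\<^sup>2 / (real N / 2) - real N / 2 * ?s) / real N = 2 * ?s\<^sup>2 / (real N)\<^sup>2 - ?s / 2"
    using Np by (simp add: diff_divide_distrib power2_eq_square)
  ultimately show ?thesis by linarith
qed

section \<open>The integral over pairs of coverings as a sum over monomials\<close>

context unitary_expansion
begin

text \<open>The common form of the integrands of types A' and A, seen as a function of the total
  ramification h and the difference d of the degrees.\<close>

definition phi :: "nat \<Rightarrow> nat \<Rightarrow> real \<Rightarrow> real" where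
  "phi N h d = (\<Sum>k\<in>KS h. \<Sum>\<^sub>\<infinity>n\<in>Z. v n * (y N n d ^ k / fact k))"

definition base_term :: "nat \<Rightarrow> nat \<times> nat \<Rightarrow> (nat \<Rightarrow> nat) \<times> (nat \<Rightarrow> nat) \<Rightarrow> real" where
  "base_term N u x = q_of t ^ (psize (fst x) + psize (snd x)) * (content_exponent t N (fst x) ^ fst u / fact (fst u)
     * (content_exponent t N (snd x) ^ snd u / fact (snd u)))"

text \<open>Fubini: the sum over n hidden in \<open>phi\<close> is merged with the sum over the two
  partitions.\<close>

lemma has_sum_base_term:
  assumes N: "N \<ge> 1"
  shows "((\<lambda>x. base_term N u x * phi N (fst u + snd u) (real (psize (fst x)) - real (psize (snd x))))
    has_sum (\<Sum>k\<in>KS (fst u + snd u). infsum (g N (fst u, snd u, k)) I)) (partitions \<times> partitions)"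
proof -
  let ?G = "\<lambda>k x. base_term N u x * (\<Sum>\<^sub>\<infinity>n\<in>Z. v n * (y N n (real (psize (fst x)) - real (psize (snd x))) ^ k / fact k))"
  have bij: "bij_betw (\<lambda>(x, n). (fst x, snd x, n)) ((partitions \<times> partitions) \<times> Z) I"
    by (rule bij_betw_byWitness[where f' = "\<lambda>(a, b, n). ((a, b), n)"]) auto
  have G: "?G k summable_on (partitions \<times> partitions) \<and> infsum (?G k) (partitions \<times> partitions) = infsum (g N (fst u, snd u, k)) I" for k
  proof -
    let ?g = "g N (fst u, snd u, k)"
    let ?h = "\<lambda>x n. base_term N u x * (v n * (y N n (real (psize (fst x)) - real (psize (snd x))) ^ k / fact k))"
    have gh: "?g ((\<lambda>(x, n). (fst x, snd x, n)) z) = (\<lambda>(x, n). ?h x n) z" for z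
      unfolding g_def W_def Y_def size_diff_def base_term_def case_prod_beta fst_conv snd_conv by (simp only: mult_ac)
    have sm: "(\<lambda>(x, n). ?h x n) summable_on (partitions \<times> partitions) \<times> Z"
      using summable_on_reindex_bij_betw[OF bij, of ?g] summable_g[OF N] unfolding gh by blast
    have hG: "infsum (?h x) Z = ?G k x" for x by (rule infsum_cmult_right')
    have "infsum ?g I = infsum (\<lambda>(x, n). ?h x n) ((partitions \<times> partitions) \<times> Z)"
      unfolding infsum_reindex_bij_betw[OF bij, symmetric] gh ..
    also have "\<dots> = infsum (?G k) (partitions \<times> partitions)"
      using infsum_Sigma'_banach[OF sm] unfolding hG by simp
    finally show ?thesis using summable_on_Sigma_banach[OF sm] unfolding hG by simp
  qed
  have "((\<lambda>x. \<Sum>k\<in>KS (fst u + snd u). ?G k x) has_sum (\<Sum>k\<in>KS (fst u + snd u). infsum (?G k) (partitions \<times> partitions)))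
      (partitions \<times> partitions)"
    by (rule has_sum_finite_sum[OF KS_finite]) (use G in blast)
  thus ?thesis using G unfolding phi_def sum_distrib_left by simp
qed

text \<open>The indicator and the evenness of ramification numbers leave exactly the exponents in
  \<open>E0\<close>; for each of them \<open>phi\<close> opens up into the sum over
  \<open>KS\<close>.\<close>

lemma expansion2_eq:
  assumes N: "N \<ge> 1"
    and Phi: "\<And>X1 X2. Phi2 T (2 * p) t N X1 X2
      = phi N (ramification_count X1 + ramification_count X2) (real (cov_deg X1) - real (cov_deg X2))"
  shows "expansion2 T p N t = (\<Sum>u\<in>E. infsum (g N u) I)"
proof -
  define F :: "(nat \<times> nat) \<times> (nat \<times> nat) \<Rightarrow> real" where
    "F z = of_bool (snd (fst z) + snd (snd z) \<le> 2 * p)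
      * phi N (snd (fst z) + snd (snd z)) (real (fst (fst z)) - real (fst (snd z)))
      * real N powi (- int (snd (fst z) + snd (snd z)))" for z
  define h where "h z = content_weight t (fst z) * content_weight t (snd z)
        * F ((psize (fst (fst z)), snd (fst z)), (psize (fst (snd z)), snd (snd z)))" for z
  define G where "G x u = base_term N u x * phi N (fst u + snd u) (real (psize (fst x)) - real (psize (snd x)))" for x u
  let ?tau = "\<lambda>((a, b), (i, j)). ((a, i), (b, j))"
  let ?PP = "partitions \<times> partitions"
  have G_sum: "((\<lambda>x. G x u) has_sum (\<Sum>k\<in>KS (fst u + snd u). infsum (g N (fst u, snd u, k)) I)) ?PP" for u
    unfolding G_def by (rule has_sum_base_term[OF N])
  have "((\<lambda>z. G (fst z) (snd z)) has_sum (\<Sum>u\<in>E0. infsum (\<lambda>x. G x u) ?PP)) (?PP \<times> E0)"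
    by (rule infsum_times_finite[OF finite_E0]) (rule has_sum_imp_summable[OF G_sum])
  moreover have "(\<Sum>u\<in>E0. infsum (\<lambda>x. G x u) ?PP) = (\<Sum>u\<in>E. infsum (g N u) I)"
    unfolding sum_E by (intro sum.cong refl infsumI G_sum)
  ultimately have hsG: "((\<lambda>z. G (fst z) (snd z)) has_sum (\<Sum>u\<in>E. infsum (g N u) I)) (?PP \<times> E0)" by simp
  have hG: "h (?tau z) = G (fst z) (snd z)" if "z \<in> ?PP \<times> E0" for z
  proof -
    obtain a b i j where z: "z = ((a, b), (i, j))" by (metis surj_pair)
    have ij: "even i" "even j" "i + j \<le> 2 * p" using that unfolding z E0_def by auto
    have pw: "real N powi (- int (i + j)) = 1 / (real N ^ i * real N ^ j)"
      by (simp only: power_int_minus power_int_of_nat power_add divide_inverse mult_1)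
    \<comment> \<open>Even powers remove the sign of \<open>content_exponent\<close>, which the
      weights of the measure do not carry.\<close>
    have ce: "content_exponent t N c ^ m = t ^ m * total_content c ^ m / real N ^ m" if "even m" for c m
      using that by (simp add: content_exponent_def power_divide power_mult_distrib)
    have "h (?tau z) = (q_of t ^ psize a * (t ^ i / fact i) * total_content a ^ i) * (q_of t ^ psize b * (t ^ j / fact j) * total_content b ^ j)
        * (phi N (i + j) (real (psize a) - real (psize b)) * (1 / (real N ^ i * real N ^ j)))"
      unfolding z h_def F_def content_weight_def prod.case fst_conv snd_conv pw using ij(3) by simp
    also have "\<dots> = G (fst z) (snd z)"
      unfolding z G_def base_term_def fst_conv snd_conv ce[OF ij(1)] ce[OF ij(2)] by (simp add: power_add mult_ac)
    finally show ?thesis .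
  qed
  have bij: "bij_betw ?tau (?PP \<times> E0) (?tau ` (?PP \<times> E0))"
    by (rule inj_on_imp_bij_betw) (auto simp: inj_on_def)
  have "((\<lambda>z. h (?tau z)) has_sum (\<Sum>u\<in>E. infsum (g N u) I)) (?PP \<times> E0)"
    by (rule has_sum_cong[THEN iffD2, OF _ hsG]) (rule hG)
  hence "(h has_sum (\<Sum>u\<in>E. infsum (g N u) I)) (?tau ` (?PP \<times> E0))"
    by (rule has_sum_reindex_bij_betw[OF bij, THEN iffD1])
  moreover have "(h has_sum s) (?tau ` (?PP \<times> E0)) \<longleftrightarrow> (h has_sum s) (content_index \<times> content_index)" for s
  proof (rule has_sum_cong_neutral)
    fix z assume z: "z \<in> content_index \<times> content_index - ?tau ` (?PP \<times> E0)"
    obtain a i b j where zz: "z = ((a, i), (b, j))" by (metis surj_pair)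
    have mem: "a \<in> partitions" "b \<in> partitions" "even i" "even j" using z unfolding zz content_index_def by auto
    have "\<not> i + j \<le> 2 * p"
    proof
      assume "i + j \<le> 2 * p"
      hence "((a, b), (i, j)) \<in> ?PP \<times> E0" using mem by (simp add: E0_def)
      hence "?tau ((a, b), (i, j)) \<in> ?tau ` (?PP \<times> E0)" by (rule imageI)
      thus False using z unfolding zz by simp
    qed
    thus "h z = 0" unfolding h_def F_def zz by simp
  next
    fix z assume "z \<in> ?tau ` (?PP \<times> E0) - content_index \<times> content_index"
    thus "h z = 0" unfolding content_index_def E0_def by auto
  qed simp
  ultimately have hs: "(h has_sum (\<Sum>u\<in>E. infsum (g N u) I)) (content_index \<times> content_index)" by blast
  have integrand: "of_bool (cov_euler (fst X) + cov_euler (snd X) \<ge> - 2 * int p)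
            * Phi2 T (2 * p) t N (fst X) (snd X) * real N powi (cov_euler (fst X) + cov_euler (snd X))
      = F ((cov_deg (fst X), ramification_count (fst X)), (cov_deg (snd X), ramification_count (snd X)))" for X
  proof -
    have c: "cov_euler (fst X) + cov_euler (snd X) = - int (ramification_count (fst X) + ramification_count (snd X))"
      by (simp add: cov_euler_def)
    have "(- int (ramification_count (fst X) + ramification_count (snd X)) \<ge> - 2 * int p)
        \<longleftrightarrow> ramification_count (fst X) + ramification_count (snd X) \<le> 2 * p" by linarith
    thus ?thesis unfolding c Phi F_def fst_conv snd_conv by simp
  qed
  have "expansion2 T p N t = infsum h (content_index \<times> content_index)"
    unfolding expansion2_def integrand h_def
    by (rule integral_rho_pair[OF t]) (rule has_sum_imp_summable[OF hs[unfolded h_def]])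
  thus ?thesis using infsumI[OF hs] by simp
qed

end

section \<open>The estimates for U(N) and SU(N)\<close>

lemma powi_order: "real N powi (- 2 * int p - 2) = 1 / real N ^ (2 * p + 2)"
proof -
  have "- 2 * int p - 2 = - int (2 * p + 2)" by simp
  thus ?thesis by (simp only: power_int_minus power_int_of_nat divide_inverse mult_1)
qed

lemma even_sum_le:
  fixes i j p :: nat
  assumes "even i" "even j" "i + j < 2 * p + 2"
  shows "i + j \<le> 2 * p"
proof -
  have "even (i + j)" using assms by simp
  thus ?thesis using assms(3) by presburger
qed

lemma index_range_eq:
  "index_range s X1 X2 = {k. 2 * k + (ramification_count X1 + ramification_count X2) \<le> 2 * s}"
proof -
  have "real k \<le> real s + real_of_int (cov_euler X1) / 2 + real_of_int (cov_euler X2) / 2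
      \<longleftrightarrow> 2 * k + (ramification_count X1 + ramification_count X2) \<le> 2 * s" for k
  proof -
    have "real k \<le> real s + real_of_int (cov_euler X1) / 2 + real_of_int (cov_euler X2) / 2
      \<longleftrightarrow> real (2 * k + (ramification_count X1 + ramification_count X2)) \<le> real (2 * s)"
      by (simp add: cov_euler_def) linarith
    thus ?thesis by (simp only: of_nat_le_iff)
  qed
  thus ?thesis unfolding index_range_def by simp
qed

theorem expansion_A':
  assumes t: "t > 0" and p: "p \<ge> 1"
  shows "\<exists>C. \<forall>N\<ge>3. \<bar>central_heat_trace TypeA' N t - expansion2 TypeA' p N t\<bar> \<le> C * real N powi (- 2 * int p - 2)"
proof -
  define v where "v n = q_of t powi (n\<^sup>2)" for n :: int
  define y where "y N n d = - (real_of_int n * t * d) / real N" for N :: nat and n :: int and d :: real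
  \<comment> \<open>With s = 2p the index range is 2 k + h \<le> 4 p, and the integrand contains the
    even powers 2 k of y.\<close>
  define KS where "KS h = (\<lambda>k. 2 * k) ` {k. 2 * k + h \<le> 2 * (2 * p)}" for h :: nat
  have v_exp: "v n = exp (- t / 2 * (real_of_int n)\<^sup>2)" for n
  proof -
    have "v n = q_of t powi (int (nat (n\<^sup>2)))" unfolding v_def by simp
    also have "\<dots> = q_of t ^ nat (n\<^sup>2)" by (rule power_int_of_nat)
    also have "\<dots> = exp (- t / 2 * real (nat (n\<^sup>2)))" by (rule q_of_power)
    also have "real (nat (n\<^sup>2)) = (real_of_int n)\<^sup>2" by simp
    finally show ?thesis .
  qed
  have absn: "real (nat \<bar>n\<bar>) = \<bar>real_of_int n\<bar>" for n by simp
  have nsq: "\<bar>real_of_int n\<bar> \<le> (real_of_int n)\<^sup>2" for n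
  proof (cases "n = 0")
    case False
    hence "1 \<le> \<bar>real_of_int n\<bar>" by linarith
    hence "\<bar>real_of_int n\<bar> * 1 \<le> \<bar>real_of_int n\<bar> * \<bar>real_of_int n\<bar>" by (intro mult_left_mono) auto
    thus ?thesis by (simp add: power2_eq_square)
  qed simp
  interpret unitary_expansion t p UNIV v y 1 odd KS
  proof
    fix n :: int
    have "t / 4 * \<bar>real_of_int n\<bar> \<le> t / 2 * (real_of_int n)\<^sup>2" using t nsq[of n] by (intro mult_mono) auto
    thus "0 \<le> v n \<and> v n \<le> mid_base t ^ nat \<bar>n\<bar>" unfolding v_exp mid_base_power absn by simp
  next
    fix N :: nat and n :: int and a b :: nat
    assume N: "N \<ge> 1"
    let ?s = "1 + real (a + (b + nat \<bar>n\<bar>))"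
    have "\<bar>real_of_int n\<bar> * \<bar>real a - real b\<bar> \<le> ?s * ?s" by (intro mult_mono) auto
    hence "t * (\<bar>real_of_int n\<bar> * \<bar>real a - real b\<bar>) / real N ^ 1 \<le> t * ?s ^ 2 / real N ^ 1"
      using t unfolding power2_eq_square by (intro divide_right_mono mult_left_mono) auto
    thus "\<bar>y N n (real a - real b)\<bar> \<le> t * ?s ^ 2 / real N ^ 1" using t by (simp add: y_def abs_mult mult_ac)
  next
    fix k N :: nat and n :: int and d :: real
    assume "odd k"
    thus "- n \<in> UNIV \<and> v (- n) = v n \<and> y N (- n) d ^ k = - (y N n d ^ k)"
      unfolding v_exp y_def by (simp add: power_minus_odd)
  next
    fix h
    have "finite {k. 2 * k + h \<le> 2 * (2 * p)}" by (rule finite_subset[of _ "{..2 * p}"]) auto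
    thus "finite (KS h)" unfolding KS_def by (rule finite_imageI)
  next
    fix i j k
    assume *: "even i" "even j" "\<not> odd k" "i + j + k < 2 * p + 2" "\<not> (i + j \<le> 2 * p \<and> k \<in> KS (i + j))"
    have "i + j \<le> 2 * p" using *(4) by (intro even_sum_le *) simp
    moreover have "k \<in> KS (i + j)"
    proof -
      obtain l where l: "k = 2 * l" using *(3) by auto
      \<comment> \<open>The degree is at most 2p + 1 \<le> 4p because p \<ge> 1, so \<open>E\<close>
        misses no monomial of \<open>S\<close> with even exponents.\<close>
      have "2 * l + (i + j) \<le> 2 * (2 * p)" using *(4) p unfolding l by linarith
      thus ?thesis unfolding KS_def l by blast
    qed
    ultimately show "2 * p + 2 \<le> i + j + 1 * k" using *(5) by blast
  qed (use t in simp_all)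
  have cas: "W (a, b, n) * exp (X N (a, b, n)) = exp (- t / 2 * ((real_of_int n)\<^sup>2
      + 2 * real_of_int n * (real (psize a) - real (psize b)) / real N + real (psize a) + real (psize b)
      + (2 * total_content a + 2 * total_content b) / real N))" for N a b n
    unfolding W_def X_def Y_def size_diff_def fst_conv snd_conv q_of_power v_exp y_def content_exponent_def exp_add[symmetric]
    by (rule arg_cong[where f = exp]) (cases "N = 0", simp_all add: field_simps)
  have we: "W x * exp (X N x) \<le> mid_base t ^ triple_deg x" if N: "N \<ge> 3" and x: "x \<in> box N" for N x
  proof -
    obtain a b n where xx: "x = (a, b, n)" by (metis surj_pair)
    have ab: "a \<in> parts_le ((N - 1) div 2)" "b \<in> parts_le (N div 2)" using x unfolding xx box_def by simp_all
    let ?a = "real (psize a)" and ?b = "real (psize b)" and ?n = "real_of_int n"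
    have Np: "real N > 0" using N by simp
    have A: "?a / 2 + 2 * ?a\<^sup>2 / (real N)\<^sup>2 \<le> ?a + 2 * total_content a / real N"
      by (rule parts_le_half_bound[OF ab(1)]) (use N in auto)
    have B: "?b / 2 + 2 * ?b\<^sup>2 / (real N)\<^sup>2 \<le> ?b + 2 * total_content b / real N"
      by (rule parts_le_half_bound[OF ab(2)]) (use N in auto)
    \<comment> \<open>Completing the square with d = ?a - ?b: the coupling costs half of n^2 and 2
      d^2 / N^2. The latter is paid by the quadratic terms of A and B, and the other half of n^2
      dominates |n| / 2.\<close>
    have "0 \<le> 2 * (?n / 2 + (?a - ?b) / real N)\<^sup>2" by simp
    also have "\<dots> = ?n\<^sup>2 / 2 + 2 * ?n * (?a - ?b) / real N + 2 * (?a - ?b)\<^sup>2 / (real N)\<^sup>2"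
      using Np by (simp add: power2_eq_square field_simps)
    finally have C: "- (?n\<^sup>2 / 2) - 2 * (?a - ?b)\<^sup>2 / (real N)\<^sup>2 \<le> 2 * ?n * (?a - ?b) / real N" by linarith
    have "(?a - ?b)\<^sup>2 \<le> ?a\<^sup>2 + ?b\<^sup>2" by (simp add: power2_diff)
    hence "2 * (?a - ?b)\<^sup>2 / (real N)\<^sup>2 \<le> (2 * ?a\<^sup>2 + 2 * ?b\<^sup>2) / (real N)\<^sup>2" by (intro divide_right_mono) auto
    hence D: "2 * (?a - ?b)\<^sup>2 / (real N)\<^sup>2 \<le> 2 * ?a\<^sup>2 / (real N)\<^sup>2 + 2 * ?b\<^sup>2 / (real N)\<^sup>2" by (simp only: add_divide_distrib)
    have "(?a + (?b + \<bar>?n\<bar>)) / 2 \<le> ?n\<^sup>2 + 2 * ?n * (?a - ?b) / real N + ?a + ?b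
        + (2 * total_content a + 2 * total_content b) / real N"
      using A B C D nsq[of n] unfolding add_divide_distrib by linarith
    hence "t / 2 * ((?a + (?b + \<bar>?n\<bar>)) / 2) \<le> t / 2 * (?n\<^sup>2 + 2 * ?n * (?a - ?b) / real N + ?a + ?b
        + (2 * total_content a + 2 * total_content b) / real N)"
      using t by (intro mult_left_mono) auto
    thus ?thesis unfolding xx cas mid_base_power triple_deg_eq of_nat_add absn by simp
  qed
  obtain C where C: "\<forall>N\<ge>3. \<bar>(\<Sum>\<^sub>\<infinity>x\<in>box N. W x * exp (X N x)) - (\<Sum>u\<in>E. infsum (g N u) I)\<bar> \<le> C / real N ^ (2 * p + 2)"
    using expansion_error[OF we] by blast
  show ?thesis
  proof (intro exI[of _ C] allI impI)
    fix N :: nat assume N: "3 \<le> N"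
    have NN: "N = Suc ((N - 1) div 2 + N div 2)" using N by presburger
    have bij: "bij_betw (\<lambda>(a, b, n). mixed_weight N a b n) (box N) (highest_weights TypeA' N)"
      unfolding box_def by (rule bij_mixed_weight[OF NN])
    have "central_heat_trace TypeA' N t
        = (\<Sum>\<^sub>\<infinity>x\<in>box N. exp (- (t / 2) * casimir TypeA' N ((\<lambda>(a, b, n). mixed_weight N a b n) x)))"
      unfolding central_heat_trace_def by (rule infsum_reindex_bij_betw[OF bij, symmetric])
    also have "\<dots> = (\<Sum>\<^sub>\<infinity>x\<in>box N. W x * exp (X N x))"
    proof (rule infsum_cong)
      fix x assume x: "x \<in> box N"
      obtain a b n where xx: "x = (a, b, n)" by (metis surj_pair)
      have ab: "a \<in> parts_le ((N - 1) div 2)" "b \<in> parts_le (N div 2)" using x unfolding xx box_def by simp_all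
      show "exp (- (t / 2) * casimir TypeA' N ((\<lambda>(a, b, n). mixed_weight N a b n) x)) = W x * exp (X N x)"
        unfolding xx cas prod.case casimir.simps mixed_weight_sums(2)[OF NN ab] by simp
    qed
    finally have trace: "central_heat_trace TypeA' N t = (\<Sum>\<^sub>\<infinity>x\<in>box N. W x * exp (X N x))" .
    have "expansion2 TypeA' p N t = (\<Sum>u\<in>E. infsum (g N u) I)"
    proof (rule expansion2_eq)
      show "N \<ge> 1" using N by simp
      fix X1 X2
      let ?h = "ramification_count X1 + ramification_count X2" and ?d = "real (cov_deg X1) - real (cov_deg X2)"
      have "phi N ?h ?d = (\<Sum>k\<in>{k. 2 * k + ?h \<le> 2 * (2 * p)}. \<Sum>\<^sub>\<infinity>n. v n * (y N n ?d ^ (2 * k) / fact (2 * k)))"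
        unfolding phi_def KS_def by (subst sum.reindex) (auto simp: inj_on_def)
      also have "\<dots> = Phi_A' (2 * p) t N X1 X2"
        unfolding Phi_A'_def index_range_eq
      proof (intro sum.cong refl infsum_cong)
        fix k and n :: int
        have "y N n ?d ^ (2 * k) = (real_of_int n * t * ?d) ^ (2 * k) / real N ^ (2 * k)"
          by (simp add: y_def power_divide power_minus_even)
        thus "v n * (y N n ?d ^ (2 * k) / fact (2 * k)) = q_of t powi n\<^sup>2 * ((real_of_int n * t * ?d) ^ (2 * k) / (real N ^ (2 * k) * fact (2 * k)))"
          unfolding v_def by simp
      qed
      finally show "Phi2 TypeA' (2 * p) t N X1 X2 = phi N ?h ?d" by simp
    qed
    thus "\<bar>central_heat_trace TypeA' N t - expansion2 TypeA' p N t\<bar> \<le> C * real N powi (- 2 * int p - 2)"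
      using C N unfolding trace powi_order by simp
  qed
qed

theorem expansion_A:
  assumes t: "t > 0" and p: "p \<ge> 1"
  shows "\<exists>C. \<forall>N\<ge>3. \<bar>central_heat_trace TypeA N t - expansion2 TypeA p N t\<bar> \<le> C * real N powi (- 2 * int p - 2)"
proof -
  define v where "v = (\<lambda>n :: int. 1 :: real)"
  define y where "y N n d = t * d\<^sup>2 / (2 * (real N)\<^sup>2)" for N :: nat and n :: int and d :: real
  \<comment> \<open>No doubling here: y is itself quadratic in d / N, which is also why e =
    2.\<close>
  define KS where "KS h = {k. 2 * k + h \<le> 2 * (2 * p)}" for h :: nat
  interpret unitary_expansion t p "{0}" v y 2 "\<lambda>_. False" KS
  proof
    fix n :: int assume "n \<in> {0}"
    thus "0 \<le> v n \<and> v n \<le> mid_base t ^ nat \<bar>n\<bar>" by (simp add: v_def)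
  next
    fix N :: nat and n :: int and a b :: nat
    assume N: "N \<ge> 1"
    let ?s = "1 + real (a + (b + nat \<bar>n\<bar>))"
    have "(real a - real b)\<^sup>2 \<le> ?s\<^sup>2" by (rule power2_le_iff_abs_le[THEN iffD2]) auto
    hence "t * (real a - real b)\<^sup>2 / (real N)\<^sup>2 \<le> t * ?s\<^sup>2 / (real N)\<^sup>2"
      using t by (intro divide_right_mono mult_left_mono) auto
    moreover have "t * (real a - real b)\<^sup>2 / (2 * (real N)\<^sup>2) \<le> t * (real a - real b)\<^sup>2 / (real N)\<^sup>2"
      using t N by (intro divide_left_mono) auto
    ultimately show "\<bar>y N n (real a - real b)\<bar> \<le> t * ?s ^ 2 / real N ^ 2" using t unfolding y_def by simp
  next
    fix h
    show "finite (KS h)" unfolding KS_def by (rule finite_subset[of _ "{..2 * p}"]) auto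
  next
    fix i j k
    assume *: "even i" "even j" "i + j + k < 2 * p + 2" "\<not> (i + j \<le> 2 * p \<and> k \<in> KS (i + j))"
    have "i + j \<le> 2 * p" using *(3) by (intro even_sum_le *) simp
    hence "\<not> 2 * k + (i + j) \<le> 2 * (2 * p)" using *(4) unfolding KS_def by simp
    thus "2 * p + 2 \<le> i + j + 2 * k" using p by linarith
  qed (use t in simp_all)
  have cas: "W (a, b, 0) * exp (X N (a, b, 0)) = exp (- t / 2 * (real (psize a) + real (psize b)
      + (2 * total_content a + 2 * total_content b) / real N - (real (psize a) - real (psize b))\<^sup>2 / (real N)\<^sup>2))" for N a b
    unfolding W_def X_def Y_def size_diff_def fst_conv snd_conv
    unfolding q_of_power v_def y_def content_exponent_def exp_add[symmetric] mult_1_right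
    by (rule arg_cong[where f = exp]) (cases "N = 0", simp_all add: field_simps)
  have we: "W x * exp (X N x) \<le> mid_base t ^ triple_deg x" if N: "N \<ge> 3" and x: "x \<in> box N" for N x
  proof -
    obtain a b n where "x = (a, b, n)" by (metis surj_pair)
    hence xx: "x = (a, b, 0)" and ab: "a \<in> parts_le ((N - 1) div 2)" "b \<in> parts_le (N div 2)"
      using x unfolding box_def by auto
    let ?a = "real (psize a)" and ?b = "real (psize b)"
    have A: "?a / 2 + 2 * ?a\<^sup>2 / (real N)\<^sup>2 \<le> ?a + 2 * total_content a / real N"
      by (rule parts_le_half_bound[OF ab(1)]) (use N in auto)
    have B: "?b / 2 + 2 * ?b\<^sup>2 / (real N)\<^sup>2 \<le> ?b + 2 * total_content b / real N"
      by (rule parts_le_half_bound[OF ab(2)]) (use N in auto)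
    \<comment> \<open>The square of the difference that the Casimir number loses is covered by the
      quadratic terms of A and B.\<close>
    have "0 \<le> (?a + ?b)\<^sup>2" by simp
    hence "(?a - ?b)\<^sup>2 \<le> 2 * ?a\<^sup>2 + 2 * ?b\<^sup>2" unfolding power2_diff power2_sum by linarith
    hence "(?a - ?b)\<^sup>2 / (real N)\<^sup>2 \<le> (2 * ?a\<^sup>2 + 2 * ?b\<^sup>2) / (real N)\<^sup>2" by (intro divide_right_mono) auto
    hence D: "(?a - ?b)\<^sup>2 / (real N)\<^sup>2 \<le> 2 * ?a\<^sup>2 / (real N)\<^sup>2 + 2 * ?b\<^sup>2 / (real N)\<^sup>2" by (simp only: add_divide_distrib)
    have "(?a + ?b) / 2 \<le> ?a + ?b + (2 * total_content a + 2 * total_content b) / real N - (?a - ?b)\<^sup>2 / (real N)\<^sup>2"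
      using A B D unfolding add_divide_distrib by linarith
    hence "t / 2 * ((?a + ?b) / 2) \<le> t / 2 * (?a + ?b + (2 * total_content a + 2 * total_content b) / real N - (?a - ?b)\<^sup>2 / (real N)\<^sup>2)"
      using t by (intro mult_left_mono) auto
    thus ?thesis unfolding xx cas mid_base_power triple_deg_eq by simp
  qed
  obtain C where C: "\<forall>N\<ge>3. \<bar>(\<Sum>\<^sub>\<infinity>x\<in>box N. W x * exp (X N x)) - (\<Sum>u\<in>E. infsum (g N u) I)\<bar> \<le> C / real N ^ (2 * p + 2)"
    using expansion_error[OF we] by blast
  show ?thesis
  proof (intro exI[of _ C] allI impI)
    fix N :: nat assume N: "3 \<le> N"
    have NN: "N = Suc ((N - 1) div 2 + N div 2)" using N by presburger
    let ?B = "parts_le ((N - 1) div 2) \<times> parts_le (N div 2)"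
    have bij: "bij_betw (\<lambda>(a, b). mixed_weight N a b (int (b 0))) ?B (highest_weights TypeA N)"
      by (rule bij_mixed_weight_A[OF NN])
    have bij0: "bij_betw (\<lambda>(a, b). (a, b, 0)) ?B (box N)"
      unfolding box_def by (rule bij_betw_byWitness[where f' = "\<lambda>(a, b, n). (a, b)"]) auto
    have "central_heat_trace TypeA N t
        = (\<Sum>\<^sub>\<infinity>x\<in>?B. exp (- (t / 2) * casimir TypeA N ((\<lambda>(a, b). mixed_weight N a b (int (b 0))) x)))"
      unfolding central_heat_trace_def by (rule infsum_reindex_bij_betw[OF bij, symmetric])
    also have "\<dots> = (\<Sum>\<^sub>\<infinity>x\<in>?B. (\<lambda>x. W x * exp (X N x)) ((\<lambda>(a, b). (a, b, 0)) x))"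
    proof (rule infsum_cong)
      fix x assume x: "x \<in> ?B"
      obtain a b where xx: "x = (a, b)" by (metis surj_pair)
      have ab: "a \<in> parts_le ((N - 1) div 2)" "b \<in> parts_le (N div 2)" using x unfolding xx by simp_all
      define m where "m = real_of_int (int (b 0))"
      define d where "d = real (psize a) - real (psize b)"
      \<comment> \<open>The Casimir number of SU(N) does not change when a constant is added to the
        weight, so the middle entry m drops out.\<close>
      have "m\<^sup>2 + 2 * m * d / real N - (real N * m + d)\<^sup>2 / (real N)\<^sup>2 = - (d\<^sup>2 / (real N)\<^sup>2)"
        using N by (simp add: power2_eq_square field_simps)
      hence "casimir TypeA N (mixed_weight N a b (int (b 0))) = real (psize a) + real (psize b)
          + (2 * total_content a + 2 * total_content b) / real N - d\<^sup>2 / (real N)\<^sup>2"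
        unfolding casimir.simps mixed_weight_sums[OF NN ab] m_def[symmetric] d_def[symmetric] by linarith
      thus "exp (- (t / 2) * casimir TypeA N ((\<lambda>(a, b). mixed_weight N a b (int (b 0))) x))
          = (\<lambda>x. W x * exp (X N x)) ((\<lambda>(a, b). (a, b, 0)) x)"
        unfolding xx prod.case cas d_def by simp
    qed
    also have "\<dots> = (\<Sum>\<^sub>\<infinity>x\<in>box N. W x * exp (X N x))" by (rule infsum_reindex_bij_betw[OF bij0])
    finally have trace: "central_heat_trace TypeA N t = (\<Sum>\<^sub>\<infinity>x\<in>box N. W x * exp (X N x))" .
    have "expansion2 TypeA p N t = (\<Sum>u\<in>E. infsum (g N u) I)"
    proof (rule expansion2_eq)
      show "N \<ge> 1" using N by simp
      fix X1 X2
      let ?h = "ramification_count X1 + ramification_count X2" and ?d = "real (cov_deg X1) - real (cov_deg X2)"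
      have "Phi_A (2 * p) t N X1 X2 = phi N ?h ?d"
        unfolding phi_def KS_def Phi_A_def index_range_eq
      proof (intro sum.cong refl)
        fix k
        have "(\<Sum>\<^sub>\<infinity>n\<in>{0}. v n * (y N n ?d ^ k / fact k)) = y N 0 ?d ^ k / fact k" by (simp add: v_def)
        also have "\<dots> = t ^ k * ?d ^ (2 * k) / (2 ^ k * real N ^ (2 * k) * fact k)"
          by (simp add: y_def power_divide power_mult_distrib power_mult)
        finally show "t ^ k * ?d ^ (2 * k) / (2 ^ k * real N ^ (2 * k) * fact k) = (\<Sum>\<^sub>\<infinity>n\<in>{0}. v n * (y N n ?d ^ k / fact k))"
          by (rule sym)
      qed
      thus "Phi2 TypeA (2 * p) t N X1 X2 = phi N ?h ?d" by simp
    qed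
    thus "\<bar>central_heat_trace TypeA N t - expansion2 TypeA p N t\<bar> \<le> C * real N powi (- 2 * int p - 2)"
      using C N unfolding trace powi_order by simp
  qed
qed

theorem theorem1p2:
  fixes T :: classical_type and p :: nat and t :: real
  assumes "p \<ge> 1" and "t > 0"
  shows "(T \<in> {TypeA', TypeA} \<longrightarrow>
            (\<exists>C N0. \<forall>N\<ge>N0. admissible T N \<longrightarrow>
               \<bar>central_heat_trace T N t - expansion2 T p N t\<bar> \<le> C * real N powi (- 2 * int p - 2)))
       \<and> (T \<in> {TypeB, TypeC, TypeD} \<longrightarrow>
            (\<exists>C N0. \<forall>N\<ge>N0. admissible T N \<longrightarrow>
               \<bar>central_heat_trace T N t - expansion1 T p N t\<bar> \<le> C * real N powi (- int p - 1)))"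
proof (intro conjI impI)
  assume "T \<in> {TypeA', TypeA}"
  hence "\<exists>C. \<forall>N\<ge>3. \<bar>central_heat_trace T N t - expansion2 T p N t\<bar> \<le> C * real N powi (- 2 * int p - 2)"
    using expansion_A'[OF assms(2,1)] expansion_A[OF assms(2,1)] by auto
  thus "\<exists>C N0. \<forall>N\<ge>N0. admissible T N \<longrightarrow>
      \<bar>central_heat_trace T N t - expansion2 T p N t\<bar> \<le> C * real N powi (- 2 * int p - 2)" by blast
next
  assume "T \<in> {TypeB, TypeC, TypeD}"
  from expansion_BCD[OF assms(2) this, of p]
  show "\<exists>C N0. \<forall>N\<ge>N0. admissible T N \<longrightarrow>
      \<bar>central_heat_trace T N t - expansion1 T p N t\<bar> \<le> C * real N powi (- int p - 1)" by blast
qed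

end
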